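(* Let $X,Y$ be symplectic manifolds with compatible almost complex structures and let $M=(M,\omega_M,J_M,p_0,p_1)$ be a connected symplectic manifold with compatible almost complex structure and two marked points. Assume that there exists a pseudoholomorphic map $\gamma:M\times M\to M$ such that $\gamma(p_0,q)=p_0$ and $\gamma(p_1,q)=q$ for all $q\in M$. Let $pr_X:X\times M\to X$ and $pr_Y:Y\times M\to Y$ be the projections, and let $j_0:X=X\times p_0\hookrightarrow X\times M$, $i_0:Y=Y\times p_0\hookrightarrow Y\times M$ be the embeddings. Then $$(pr_X)_*:JH_\bullet^M(Y,X\times M)\to JH_\bullet^M(Y,X)$$ is an isomorphism with inverse $(j_0)_*$. Similarly, $$(pr_Y)^*:JH_\bullet^M(Y,X)\to JH_\bullet^M(Y\times M,X)$$ is an isomorphism with inverse $(i_0)^*$.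
   Context: All manifolds are smooth without boundary; products carry product structures; $pt$ is a point. Let $Y,X$ be symplectic manifolds with compatible almost complex structures $J_Y,J_X$. A smooth map $f$ is pseudoholomorphic if $df\circ J_Y=J_X\circ df$. Pseudoholomorphic correspondences: for $n\ge 1$, $JCor_n(Y,X)$ is the set of global sections over $Y$ of the sheafification of the presheaf sending an open $U\subset Y$ to the set of unordered $n$-tuples $\{f_1,\dots,f_n\}$ of pseudoholomorphic maps $U\to X$, two tuples being identified if $\{f_i(y)\}_i=\{g_i(y)\}_i$ as unordered tuples with multiplicity for every $y\in U$. $JCor_0(Y,X)$ consists of one element, the empty correspondence $\emptyset$. $JCor(Y,X)$ is the set of global sections over $Y$ of the sheafification of $U\mapsto\coprod_{n\ge 0}JCor_n(U,X)$. Addition is local concatenation of tuples, making $JCor(Y,X)$ a commutative monoid with zero $\emptyset$; $JC(Y,X)$ is its Grothendieck group. For pseudoholomorphic $h:Z\to Y$ and $g:X\to W$, $\{f_i\}\mapsto\{f_i\circ h\}$ and $\{f_i\}\mapsto\{g\circ f_i\}$ (locally) define homomorphisms $h^*:JC(Y,X)\to JC(Z,X)$ and $g_*:JC(Y,X)\to JC(Y,W)$. Cohomology groups: put $M^0=pt$ and $JC_n^M(Y,X)=JC(Y\times M^n,X)$. For $0\le i\le n-1$, $\varepsilon\in\{0,1\}$ let $d_{i,\varepsilon}:M^{n-1}\to M^n$ insert $p_\varepsilon$ after the first $i$ factors, $d^{i,\varepsilon}=(id_Y\times d_{i,\varepsilon})^*$, and $d=\sum_{\varepsilon=0}^1\sum_{i=0}^{n-1}(-1)^{\varepsilon+i}d^{i,\varepsilon}:JC^M_n(Y,X)\to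 JC^M_{n-1}(Y,X)$. Then $d^2=0$ and $JH_\bullet^M(Y,X)$ is the homology of this complex. Pseudoholomorphic maps $h:Z\to Y$ and $g:X\to W$ induce $h^*:JH_\bullet^M(Y,X)\to JH_\bullet^M(Z,X)$ (from $(h\times id_{M^n})^*$ on $JC_n^M$) and $g_*:JH_\bullet^M(Y,X)\to JH_\bullet^M(Y,W)$. *)

theory Defs
  imports "HOL-Analysis.Analysis" "HOL-Algebra.Coset" "HOL-Algebra.FiniteProduct"
    "HOL-Library.Multiset"
begin

section \<open>Smooth maps between open subsets of coordinate spaces\<close>

text \<open>
  The space of real $n$-tuples is \<^term>\<open>Euclidean_space n\<close>, i.e. functions
  \<^typ>\<open>nat \<Rightarrow> real\<close> vanishing from index \<open>n\<close> on.  The dimension is thus a value and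
  not a type, which is needed for the manifolds $M^n$ with varying \<open>n\<close>.
\<close>

definition partial_deriv :: "nat \<Rightarrow> ((nat \<Rightarrow> real) \<Rightarrow> real) \<Rightarrow> (nat \<Rightarrow> real) \<Rightarrow> real" where
  "partial_deriv i f x = deriv (\<lambda>t. f (x(i := t))) (x i)"

fun times_cont_diff :: "nat \<Rightarrow> nat \<Rightarrow> (nat \<Rightarrow> real) set \<Rightarrow> ((nat \<Rightarrow> real) \<Rightarrow> real) \<Rightarrow> bool" where
  "times_cont_diff 0 n S f \<longleftrightarrow>
     continuous_map (subtopology (Euclidean_space n) S) euclideanreal f"
| "times_cont_diff (Suc k) n S f \<longleftrightarrow>
     continuous_map (subtopology (Euclidean_space n) S) euclideanreal f \<and>
     (\<forall>i<n. (\<forall>x\<in>S. (\<lambda>t. f (x(i := t))) differentiable at (x i)) \<and>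
            times_cont_diff k n S (partial_deriv i f))"

text \<open>The following are only used for sets \<open>S\<close> that are open in \<^term>\<open>Euclidean_space n\<close>.\<close>

definition smooth_fun :: "nat \<Rightarrow> (nat \<Rightarrow> real) set \<Rightarrow> ((nat \<Rightarrow> real) \<Rightarrow> real) \<Rightarrow> bool" where
  "smooth_fun n S f \<longleftrightarrow> (\<forall>k. times_cont_diff k n S f)"

definition smooth_coord_map ::
    "nat \<Rightarrow> nat \<Rightarrow> (nat \<Rightarrow> real) set \<Rightarrow> ((nat \<Rightarrow> real) \<Rightarrow> (nat \<Rightarrow> real)) \<Rightarrow> bool" where
  "smooth_coord_map m n S F \<longleftrightarrow> (\<forall>j<n. smooth_fun m S (\<lambda>x. F x j))"

definition jacobian ::
    "((nat \<Rightarrow> real) \<Rightarrow> (nat \<Rightarrow> real)) \<Rightarrow> (nat \<Rightarrow> real) \<Rightarrow> nat \<Rightarrow> nat \<Rightarrow> real" where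
  "jacobian F x j i = partial_deriv i (\<lambda>y. F y j) x"

section \<open>Symplectic manifolds with compatible almost complex structures\<close>

text \<open>
  A manifold is given by an indexed atlas; the tensor fields $\omega$ and $J$ are given by
  their components in each chart: at \<open>p \<in> cdom M c\<close> the coordinate vector fields
  $\partial_i$ of the chart \<open>c\<close> satisfy $\omega_p(\partial_i,\partial_j)$ \<open>= sform M c p i j\<close>
  and $J_p\,\partial_j = \sum_i$ \<open>acs M c p i j\<close> $\partial_i$.
\<close>

record ('a, 'i) manifold_data =
  mtop :: "'a topology"
  mdim :: nat
  charts :: "'i set"
  cdom :: "'i \<Rightarrow> 'a set"
  cmap :: "'i \<Rightarrow> 'a \<Rightarrow> nat \<Rightarrow> real"
  sform :: "'i \<Rightarrow> 'a \<Rightarrow> nat \<Rightarrow> nat \<Rightarrow> real"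
  acs :: "'i \<Rightarrow> 'a \<Rightarrow> nat \<Rightarrow> nat \<Rightarrow> real"

abbreviation mspace_of :: "('a, 'i) manifold_data \<Rightarrow> 'a set" where
  "mspace_of M \<equiv> topspace (mtop M)"

definition chart_inv :: "('a, 'i) manifold_data \<Rightarrow> 'i \<Rightarrow> (nat \<Rightarrow> real) \<Rightarrow> 'a" where
  "chart_inv M c = inv_into (cdom M c) (cmap M c)"

definition local_rep ::
    "('a, 'i) manifold_data \<Rightarrow> 'i \<Rightarrow> ('b, 'j) manifold_data \<Rightarrow> 'j \<Rightarrow> ('a \<Rightarrow> 'b) \<Rightarrow>
     (nat \<Rightarrow> real) \<Rightarrow> nat \<Rightarrow> real" where
  "local_rep M c N c' f x = cmap N c' (f (chart_inv M c x))"

definition smooth_manifold :: "('a, 'i) manifold_data \<Rightarrow> bool" where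
  "smooth_manifold M \<longleftrightarrow>
     Hausdorff_space (mtop M) \<and> second_countable (mtop M) \<and>
     (\<Union>c\<in>charts M. cdom M c) = mspace_of M \<and>
     (\<forall>c\<in>charts M. openin (mtop M) (cdom M c) \<and>
        openin (Euclidean_space (mdim M)) (cmap M c ` cdom M c) \<and>
        homeomorphic_map (subtopology (mtop M) (cdom M c))
          (subtopology (Euclidean_space (mdim M)) (cmap M c ` cdom M c)) (cmap M c)) \<and>
     (\<forall>c\<in>charts M. \<forall>c'\<in>charts M.
        smooth_coord_map (mdim M) (mdim M) (cmap M c ` (cdom M c \<inter> cdom M c'))
          (local_rep M c M c' (\<lambda>p. p)))"

definition smooth_map :: "('a, 'i) manifold_data \<Rightarrow> ('b, 'j) manifold_data \<Rightarrow> ('a \<Rightarrow> 'b) \<Rightarrow> bool" where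
  "smooth_map M N f \<longleftrightarrow>
     continuous_map (mtop M) (mtop N) f \<and>
     (\<forall>c\<in>charts M. \<forall>c'\<in>charts N.
        smooth_coord_map (mdim M) (mdim N) (cmap M c ` (cdom M c \<inter> f -` cdom N c'))
          (local_rep M c N c' f))"

text \<open>\<open>differential M c N c' f p\<close> is the matrix of $df_p$ in the charts \<open>c\<close> and \<open>c'\<close>.\<close>

definition differential ::
    "('a, 'i) manifold_data \<Rightarrow> 'i \<Rightarrow> ('b, 'j) manifold_data \<Rightarrow> 'j \<Rightarrow> ('a \<Rightarrow> 'b) \<Rightarrow> 'a \<Rightarrow>
     nat \<Rightarrow> nat \<Rightarrow> real" where
  "differential M c N c' f p = jacobian (local_rep M c N c' f) (cmap M c p)"

definition intertwines_acs ::
    "('a, 'i) manifold_data \<Rightarrow> ('b, 'j) manifold_data \<Rightarrow> ('a \<Rightarrow> 'b) \<Rightarrow> bool" where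
  "intertwines_acs M N f \<longleftrightarrow>
     (\<forall>c\<in>charts M. \<forall>c'\<in>charts N. \<forall>p\<in>cdom M c \<inter> f -` cdom N c'. \<forall>i<mdim N. \<forall>j<mdim M.
        (\<Sum>k<mdim M. differential M c N c' f p i k * acs M c p k j) =
        (\<Sum>k<mdim N. acs N c' (f p) i k * differential M c N c' f p k j))"

definition pseudoholomorphic ::
    "('a, 'i) manifold_data \<Rightarrow> ('b, 'j) manifold_data \<Rightarrow> ('a \<Rightarrow> 'b) \<Rightarrow> bool" where
  "pseudoholomorphic M N f \<longleftrightarrow> smooth_map M N f \<and> intertwines_acs M N f"

definition smooth_components ::
    "('a, 'i) manifold_data \<Rightarrow> ('i \<Rightarrow> 'a \<Rightarrow> nat \<Rightarrow> nat \<Rightarrow> real) \<Rightarrow> bool" where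
  "smooth_components M \<tau> \<longleftrightarrow>
     (\<forall>c\<in>charts M. \<forall>i<mdim M. \<forall>j<mdim M.
        smooth_fun (mdim M) (cmap M c ` cdom M c) (\<lambda>x. \<tau> c (chart_inv M c x) i j))"

text \<open>The second and third conjuncts below say that the components are those of a 2-form;
  the last two are nondegeneracy and closedness.\<close>

definition symplectic_form :: "('a, 'i) manifold_data \<Rightarrow> bool" where
  "symplectic_form M \<longleftrightarrow>
     smooth_components M (sform M) \<and>
     (\<forall>c\<in>charts M. \<forall>p\<in>cdom M c. \<forall>i<mdim M. \<forall>j<mdim M. sform M c p j i = - sform M c p i j) \<and>
     (\<forall>c\<in>charts M. \<forall>c'\<in>charts M. \<forall>p\<in>cdom M c \<inter> cdom M c'. \<forall>i<mdim M. \<forall>j<mdim M.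
        sform M c p i j =
        (\<Sum>k<mdim M. \<Sum>l<mdim M.
           differential M c M c' (\<lambda>q. q) p k i * differential M c M c' (\<lambda>q. q) p l j *
           sform M c' p k l)) \<and>
     (\<forall>c\<in>charts M. \<forall>p\<in>cdom M c. \<forall>v::nat \<Rightarrow> real.
        (\<forall>j<mdim M. (\<Sum>i<mdim M. v i * sform M c p i j) = 0) \<longrightarrow> (\<forall>i<mdim M. v i = 0)) \<and>
     (\<forall>c\<in>charts M. \<forall>p\<in>cdom M c. \<forall>i<mdim M. \<forall>j<mdim M. \<forall>k<mdim M.
        (let D = (\<lambda>a b d. partial_deriv a (\<lambda>x. sform M c (chart_inv M c x) b d) (cmap M c p))
         in D i j k + D j k i + D k i j = 0))"

text \<open>The transformation law of the components of $J$ says that the identity intertwines them.\<close>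

definition almost_complex_structure :: "('a, 'i) manifold_data \<Rightarrow> bool" where
  "almost_complex_structure M \<longleftrightarrow>
     smooth_components M (acs M) \<and> intertwines_acs M M (\<lambda>p. p) \<and>
     (\<forall>c\<in>charts M. \<forall>p\<in>cdom M c. \<forall>i<mdim M. \<forall>j<mdim M.
        (\<Sum>k<mdim M. acs M c p i k * acs M c p k j) = (if i = j then - 1 else 0))"

text \<open>Compatibility: $g(v,w) = \omega(v, Jw)$ is a Riemannian metric.\<close>

definition compatible_acs :: "('a, 'i) manifold_data \<Rightarrow> bool" where
  "compatible_acs M \<longleftrightarrow>
     (\<forall>c\<in>charts M. \<forall>p\<in>cdom M c.
        (let g = (\<lambda>i j. \<Sum>k<mdim M. sform M c p i k * acs M c p k j)
         in (\<forall>i<mdim M. \<forall>j<mdim M. g i j = g j i) \<and>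
            (\<forall>v::nat \<Rightarrow> real. (\<exists>i<mdim M. v i \<noteq> 0) \<longrightarrow>
               (\<Sum>i<mdim M. \<Sum>j<mdim M. v i * g i j * v j) > 0)))"

definition compatible_symplectic_manifold :: "('a, 'i) manifold_data \<Rightarrow> bool" where
  "compatible_symplectic_manifold M \<longleftrightarrow>
     smooth_manifold M \<and> symplectic_form M \<and> almost_complex_structure M \<and> compatible_acs M"

definition open_submanifold :: "('a, 'i) manifold_data \<Rightarrow> 'a set \<Rightarrow> ('a, 'i) manifold_data" where
  "open_submanifold M U =
     M\<lparr>mtop := subtopology (mtop M) U, cdom := (\<lambda>c. cdom M c \<inter> U)\<rparr>"

subsection \<open>Products and powers\<close>

definition block_diag ::
    "nat \<Rightarrow> (nat \<Rightarrow> nat \<Rightarrow> real) \<Rightarrow> (nat \<Rightarrow> nat \<Rightarrow> real) \<Rightarrow> nat \<Rightarrow> nat \<Rightarrow> real" where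
  "block_diag m A B i j =
     (if i < m \<and> j < m then A i j else if m \<le> i \<and> m \<le> j then B (i - m) (j - m) else 0)"

definition prod_manifold ::
    "('a, 'i) manifold_data \<Rightarrow> ('b, 'j) manifold_data \<Rightarrow> ('a \<times> 'b, 'i \<times> 'j) manifold_data"
    (infixr \<open>\<times>\<^sub>m\<close> 70) where
  "M \<times>\<^sub>m N =
    \<lparr> mtop = prod_topology (mtop M) (mtop N),
      mdim = mdim M + mdim N,
      charts = charts M \<times> charts N,
      cdom = (\<lambda>(c, d). cdom M c \<times> cdom N d),
      cmap = (\<lambda>(c, d) (p, q) i. if i < mdim M then cmap M c p i else cmap N d q (i - mdim M)),
      sform = (\<lambda>(c, d) (p, q). block_diag (mdim M) (sform M c p) (sform N d q)),
      acs = (\<lambda>(c, d) (p, q). block_diag (mdim M) (acs M c p) (acs N d q)) \<rparr>"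

text \<open>Points (and chart indices) of $M^n$ are lists of length \<open>n\<close>, with
  $M^{n+1} = M \times M^n$ identified with nonempty lists via \<open>(p, ps) \<mapsto> p # ps\<close>.\<close>

definition uncons :: "'a list \<Rightarrow> 'a \<times> 'a list" where
  "uncons ps = (hd ps, tl ps)"

definition point_manifold :: "('a list, 'i list) manifold_data" where
  "point_manifold =
    \<lparr> mtop = discrete_topology {[]}, mdim = 0, charts = {[]}, cdom = (\<lambda>_. {[]}),
      cmap = (\<lambda>_ _ _. 0), sform = (\<lambda>_ _ _ _. 0), acs = (\<lambda>_ _ _ _. 0) \<rparr>"

definition as_list_manifold ::
    "('a \<times> 'a list, 'i \<times> 'i list) manifold_data \<Rightarrow> ('a list, 'i list) manifold_data" where
  "as_list_manifold N =
    \<lparr> mtop = pullback_topology {ps. ps \<noteq> []} uncons (mtop N),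
      mdim = mdim N,
      charts = {cs. cs \<noteq> [] \<and> uncons cs \<in> charts N},
      cdom = (\<lambda>cs. {ps. ps \<noteq> [] \<and> uncons ps \<in> cdom N (uncons cs)}),
      cmap = (\<lambda>cs ps. cmap N (uncons cs) (uncons ps)),
      sform = (\<lambda>cs ps. sform N (uncons cs) (uncons ps)),
      acs = (\<lambda>cs ps. acs N (uncons cs) (uncons ps)) \<rparr>"

fun power_manifold :: "('a, 'i) manifold_data \<Rightarrow> nat \<Rightarrow> ('a list, 'i list) manifold_data" where
  "power_manifold M 0 = point_manifold"
| "power_manifold M (Suc n) = as_list_manifold (M \<times>\<^sub>m power_manifold M n)"

section \<open>Sheafification\<close>

text \<open>
  All presheaves below are presheaves of functions: a section over \<open>U\<close> is a function on \<open>U\<close>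
  (an element of \<^term>\<open>extensional U\<close>), and presheaf restriction is restriction of functions.
  The sheafification of such a presheaf consists of the functions that are locally sections.
  The lemmas \<open>sheafification_sheaf\<close> and \<open>sheafification_universal\<close> show that this has the
  universal property of the sheafification.
\<close>

definition sheafification ::
    "'a topology \<Rightarrow> ('a set \<Rightarrow> ('a \<Rightarrow> 'b) set) \<Rightarrow> 'a set \<Rightarrow> ('a \<Rightarrow> 'b) set" where
  "sheafification T P U =
     {s \<in> extensional U. \<forall>y\<in>U. \<exists>V. openin T V \<and> y \<in> V \<and> V \<subseteq> U \<and> restrict s V \<in> P V}"

definition presheaf :: "'a topology \<Rightarrow> ('a set \<Rightarrow> 's set) \<Rightarrow> ('a set \<Rightarrow> 'a set \<Rightarrow> 's \<Rightarrow> 's) \<Rightarrow> bool" where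
  "presheaf T F \<rho> \<longleftrightarrow>
     (\<forall>U V. openin T U \<and> openin T V \<and> V \<subseteq> U \<longrightarrow> \<rho> U V \<in> F U \<rightarrow> F V) \<and>
     (\<forall>U. openin T U \<longrightarrow> (\<forall>s\<in>F U. \<rho> U U s = s)) \<and>
     (\<forall>U V W. openin T U \<and> openin T V \<and> openin T W \<and> W \<subseteq> V \<and> V \<subseteq> U \<longrightarrow>
        (\<forall>s\<in>F U. \<rho> V W (\<rho> U V s) = \<rho> U W s))"

definition sheaf :: "'a topology \<Rightarrow> ('a set \<Rightarrow> 's set) \<Rightarrow> ('a set \<Rightarrow> 'a set \<Rightarrow> 's \<Rightarrow> 's) \<Rightarrow> bool" where
  "sheaf T F \<rho> \<longleftrightarrow> presheaf T F \<rho> \<and>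
     (\<forall>\<V> t. (\<forall>V\<in>\<V>. openin T V \<and> t V \<in> F V) \<and>
        (\<forall>V\<in>\<V>. \<forall>W\<in>\<V>. \<rho> V (V \<inter> W) (t V) = \<rho> W (V \<inter> W) (t W)) \<longrightarrow>
        (\<exists>!s. s \<in> F (\<Union>\<V>) \<and> (\<forall>V\<in>\<V>. \<rho> (\<Union>\<V>) V s = t V)))"

definition presheaf_morphism ::
    "'a topology \<Rightarrow> ('a set \<Rightarrow> 's set) \<Rightarrow> ('a set \<Rightarrow> 'a set \<Rightarrow> 's \<Rightarrow> 's) \<Rightarrow>
     ('a set \<Rightarrow> 't set) \<Rightarrow> ('a set \<Rightarrow> 'a set \<Rightarrow> 't \<Rightarrow> 't) \<Rightarrow> ('a set \<Rightarrow> 's \<Rightarrow> 't) \<Rightarrow> bool" where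
  "presheaf_morphism T F \<rho> G \<sigma> \<phi> \<longleftrightarrow>
     (\<forall>U. openin T U \<longrightarrow> \<phi> U \<in> F U \<rightarrow> G U) \<and>
     (\<forall>U V. openin T U \<and> openin T V \<and> V \<subseteq> U \<longrightarrow>
        (\<forall>s\<in>F U. \<sigma> U V (\<phi> U s) = \<phi> V (\<rho> U V s)))"

abbreviation fun_restriction :: "'a set \<Rightarrow> 'a set \<Rightarrow> ('a \<Rightarrow> 'b) \<Rightarrow> 'a \<Rightarrow> 'b" where
  "fun_restriction U V s \<equiv> restrict s V"

lemma presheafD:
  assumes "presheaf T F \<rho>" "openin T U" "s \<in> F U"
  shows "openin T V \<Longrightarrow> V \<subseteq> U \<Longrightarrow> \<rho> U V s \<in> F V" and "\<rho> U U s = s"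
    and "openin T V \<Longrightarrow> openin T W \<Longrightarrow> W \<subseteq> V \<Longrightarrow> V \<subseteq> U \<Longrightarrow> \<rho> V W (\<rho> U V s) = \<rho> U W s"
  using assms by (auto simp: presheaf_def Pi_def)

lemma sheafification_presheaf:
  assumes "presheaf T P fun_restriction"
  shows "presheaf T (sheafification T P) fun_restriction"
proof -
  have closed: "restrict s V \<in> sheafification T P V"
    if "openin T U" "openin T V" "V \<subseteq> U" "s \<in> sheafification T P U" for U V s
  proof -
    have "\<exists>W. openin T W \<and> y \<in> W \<and> W \<subseteq> V \<and> restrict (restrict s V) W \<in> P W" if "y \<in> V" for y
    proof -
      obtain W where W: "openin T W" "y \<in> W" "W \<subseteq> U" "restrict s W \<in> P W"
        using \<open>s \<in> _\<close> \<open>y \<in> V\<close> \<open>V \<subseteq> U\<close> unfolding sheafification_def by blast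
      have o: "openin T (W \<inter> V)" using W \<open>openin T V\<close> by blast
      have "restrict (restrict s W) (W \<inter> V) \<in> P (W \<inter> V)"
        by (rule presheafD(1)[OF assms W(1,4) o]) blast
      moreover have "W \<inter> (W \<inter> V) = W \<inter> V" "V \<inter> (W \<inter> V) = W \<inter> V" by blast+
      ultimately have "restrict (restrict s V) (W \<inter> V) \<in> P (W \<inter> V)"
        by (simp only: restrict_restrict)
      then show ?thesis using o \<open>y \<in> V\<close> W by blast
    qed
    then show ?thesis by (simp add: sheafification_def)
  qed
  show ?thesis
    unfolding presheaf_def
  proof (intro conjI allI impI ballI Pi_I)
    show "restrict s V \<in> sheafification T P V"
      if "openin T U \<and> openin T V \<and> V \<subseteq> U" "s \<in> sheafification T P U" for U V s
      using closed that by blast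
    show "restrict s U = s" if "s \<in> sheafification T P U" for U s
      using that by (simp add: sheafification_def extensional_restrict)
    show "restrict (restrict s V) W = restrict s W"
      if "openin T U \<and> openin T V \<and> openin T W \<and> W \<subseteq> V \<and> V \<subseteq> U" for U V W s
      using that by (simp add: Int_absorb1)
  qed
qed

lemma sheafification_sheaf:
  assumes "presheaf T P fun_restriction"
  shows "sheaf T (sheafification T P) fun_restriction"
  unfolding sheaf_def
proof (intro conjI allI impI sheafification_presheaf[OF assms])
  fix \<V> and t :: "'a set \<Rightarrow> 'a \<Rightarrow> 'b"
  assume "(\<forall>V\<in>\<V>. openin T V \<and> t V \<in> sheafification T P V) \<and>
    (\<forall>V\<in>\<V>. \<forall>W\<in>\<V>. restrict (t V) (V \<inter> W) = restrict (t W) (V \<inter> W))"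
  then have op: "\<And>V. V \<in> \<V> \<Longrightarrow> openin T V" and t: "\<And>V. V \<in> \<V> \<Longrightarrow> t V \<in> sheafification T P V"
    and comp: "\<And>V W. V \<in> \<V> \<Longrightarrow> W \<in> \<V> \<Longrightarrow> restrict (t V) (V \<inter> W) = restrict (t W) (V \<inter> W)"
    by auto
  have ext: "t V \<in> extensional V" if "V \<in> \<V>" for V
    using t[OF that] by (simp add: sheafification_def)
  define s where "s = (\<lambda>y\<in>\<Union>\<V>. t (SOME V. V \<in> \<V> \<and> y \<in> V) y)"
  have s: "s y = t V y" if "V \<in> \<V>" "y \<in> V" for V y
  proof -
    let ?W = "SOME V. V \<in> \<V> \<and> y \<in> V"
    have W: "?W \<in> \<V> \<and> y \<in> ?W" by (rule someI) (use that in blast)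
    have "restrict (t V) (V \<inter> ?W) y = restrict (t ?W) (V \<inter> ?W) y"
      using comp[OF that(1), of ?W] W by simp
    then have "t V y = t ?W y" using that(2) W by simp
    then show ?thesis using that unfolding s_def by auto
  qed
  have r: "restrict s V = t V" if "V \<in> \<V>" for V
    using s[OF that] ext[OF that] by (auto simp: fun_eq_iff extensional_def)
  have "s \<in> sheafification T P (\<Union>\<V>)"
  proof -
    have "\<exists>W. openin T W \<and> y \<in> W \<and> W \<subseteq> \<Union>\<V> \<and> restrict s W \<in> P W" if y: "y \<in> V" "V \<in> \<V>" for y V
    proof -
      obtain W where W: "openin T W" "y \<in> W" "W \<subseteq> V" "restrict (t V) W \<in> P W"
        using t[OF y(2)] y(1) unfolding sheafification_def by blast
      have "restrict (t V) W = restrict s W"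
        using W(3) s[OF y(2)] by (intro restrict_ext) auto
      moreover have "W \<subseteq> \<Union>\<V>" using W(3) y(2) by blast
      ultimately show ?thesis using W by auto
    qed
    then show ?thesis by (auto simp: sheafification_def s_def)
  qed
  moreover have "s' = s"
    if "s' \<in> sheafification T P (\<Union>\<V>)" "\<forall>V\<in>\<V>. restrict s' V = t V" for s'
  proof
    fix y
    show "s' y = s y"
    proof (cases "y \<in> \<Union>\<V>")
      case True
      then obtain V where V: "V \<in> \<V>" "y \<in> V" by blast
      then have "s' y = t V y" using that(2) by (metis restrict_apply')
      then show ?thesis using s[OF V] by simp
    next
      case False
      then show ?thesis using that(1) by (auto simp: sheafification_def s_def extensional_def)
    qed
  qed
  ultimately show "\<exists>!s. s \<in> sheafification T P (\<Union>\<V>) \<and> (\<forall>V\<in>\<V>. restrict s V = t V)"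
    using r by blast
qed

lemma sheafification_universal:
  assumes P: "presheaf T P fun_restriction" and ext: "\<And>U. openin T U \<Longrightarrow> P U \<subseteq> extensional U"
    and G: "sheaf T G \<sigma>" and \<phi>: "presheaf_morphism T P fun_restriction G \<sigma> \<phi>"
  shows "\<And>U. openin T U \<Longrightarrow> P U \<subseteq> sheafification T P U"
    and "\<exists>\<psi>. presheaf_morphism T (sheafification T P) fun_restriction G \<sigma> \<psi> \<and>
           (\<forall>U. openin T U \<longrightarrow> (\<forall>s\<in>P U. \<psi> U s = \<phi> U s)) \<and>
           (\<forall>\<psi>'. presheaf_morphism T (sheafification T P) fun_restriction G \<sigma> \<psi>' \<and>
               (\<forall>U. openin T U \<longrightarrow> (\<forall>s\<in>P U. \<psi>' U s = \<phi> U s)) \<longrightarrow>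
             (\<forall>U. openin T U \<longrightarrow> (\<forall>s\<in>sheafification T P U. \<psi>' U s = \<psi> U s)))"
proof -
  show sub: "P U \<subseteq> sheafification T P U" if "openin T U" for U
  proof
    fix s assume s: "s \<in> P U"
    then have e: "s \<in> extensional U" using ext[OF that] by blast
    then show "s \<in> sheafification T P U"
      using s that by (auto simp: sheafification_def extensional_restrict[OF e] intro!: exI[of _ U])
  qed
  let ?S = "sheafification T P"
  define C where "C s U = {V. openin T V \<and> V \<subseteq> U \<and> restrict s V \<in> P V}" for s :: "'a \<Rightarrow> 'b" and U
  define Q where "Q U s x \<longleftrightarrow> x \<in> G U \<and> (\<forall>V\<in>C s U. \<sigma> U V x = \<phi> V (restrict s V))" for U s x
  have \<phi>G: "\<phi> U s \<in> G U" if "openin T U" "s \<in> P U" for U s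
    using \<phi> that unfolding presheaf_morphism_def by blast
  have \<phi>r: "\<sigma> U V (\<phi> U s) = \<phi> V (restrict s V)"
    if "openin T U" "openin T V" "V \<subseteq> U" "s \<in> P U" for U V s
    using \<phi> that unfolding presheaf_morphism_def by blast
  have Gp: "presheaf T G \<sigma>" using G by (simp add: sheaf_def)
  have \<sigma>G: "\<sigma> U V x \<in> G V" if "openin T U" "openin T V" "V \<subseteq> U" "x \<in> G U" for U V x
    using presheafD(1)[OF Gp that(1,4,2,3)] .
  have \<sigma>\<sigma>: "\<sigma> V W (\<sigma> U V x) = \<sigma> U W x"
    if "openin T U" "openin T V" "openin T W" "W \<subseteq> V" "V \<subseteq> U" "x \<in> G U" for U V W x
    using presheafD(3)[OF Gp that(1,6,2,3,4,5)] .
  have ex1: "\<exists>!x. Q U s x" if U: "openin T U" and s: "s \<in> ?S U" for U s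
  proof -
    have un: "\<Union>(C s U) = U"
      using s unfolding C_def sheafification_def by blast
    have "\<sigma> V (V \<inter> W) (\<phi> V (restrict s V)) = \<sigma> W (V \<inter> W) (\<phi> W (restrict s W))"
      if "V \<in> C s U" "W \<in> C s U" for V W
    proof -
      have "openin T (V \<inter> W)" using that unfolding C_def by blast
      then have "\<sigma> V (V \<inter> W) (\<phi> V (restrict s V)) = \<phi> (V \<inter> W) (restrict (restrict s V) (V \<inter> W))"
        "\<sigma> W (V \<inter> W) (\<phi> W (restrict s W)) = \<phi> (V \<inter> W) (restrict (restrict s W) (V \<inter> W))"
        using that unfolding C_def by (intro \<phi>r; blast)+
      moreover have "V \<inter> (V \<inter> W) = V \<inter> W" "W \<inter> (V \<inter> W) = V \<inter> W" by blast+
      ultimately show ?thesis by (simp only: restrict_restrict)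
    qed
    moreover have "openin T V \<and> \<phi> V (restrict s V) \<in> G V" if "V \<in> C s U" for V
      using that \<phi>G unfolding C_def by blast
    ultimately have "\<exists>!x. x \<in> G (\<Union>(C s U)) \<and> (\<forall>V\<in>C s U. \<sigma> (\<Union>(C s U)) V x = \<phi> V (restrict s V))"
      using G[unfolded sheaf_def, THEN conjunct2, rule_format, of "C s U" "\<lambda>V. \<phi> V (restrict s V)"]
      by blast
    then show ?thesis by (simp add: Q_def un)
  qed
  define \<psi> where "\<psi> U s = (THE x. Q U s x)" for U s
  have \<psi>Q: "Q U s (\<psi> U s)" if "openin T U" "s \<in> ?S U" for U s
    unfolding \<psi>_def by (rule theI'[OF ex1[OF that]])
  have \<psi>I: "x = \<psi> U s" if "openin T U" "s \<in> ?S U" "Q U s x" for U s x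
    using ex1[OF that(1,2)] \<psi>Q[OF that(1,2)] that(3) by blast
  have S: "restrict s V \<in> ?S V" if "openin T U" "openin T V" "V \<subseteq> U" "s \<in> ?S U" for U V s
    using presheafD(1)[OF sheafification_presheaf[OF P] that(1,4,2,3)] .
  have ext_\<phi>: "\<phi> U s = \<psi> U s" if "openin T U" "s \<in> P U" for U s
  proof (rule \<psi>I)
    show "Q U s (\<phi> U s)" using that \<phi>r \<phi>G unfolding Q_def C_def by blast
  qed (use that sub in blast)+
  have mor: "presheaf_morphism T ?S fun_restriction G \<sigma> \<psi>"
    unfolding presheaf_morphism_def
  proof (intro conjI allI impI ballI Pi_I)
    show "\<psi> U s \<in> G U" if "openin T U" "s \<in> ?S U" for U s
      using \<psi>Q[OF that] unfolding Q_def by blast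
    fix U V s assume a: "openin T U \<and> openin T V \<and> V \<subseteq> U" and s: "s \<in> ?S U"
    have q: "Q U s (\<psi> U s)" using \<psi>Q a s by blast
    have "Q V (restrict s V) (\<sigma> U V (\<psi> U s))"
      unfolding Q_def
    proof (intro conjI ballI)
      show "\<sigma> U V (\<psi> U s) \<in> G V" using q a \<sigma>G unfolding Q_def by blast
      fix W assume W: "W \<in> C (restrict s V) V"
      then have eq: "restrict (restrict s V) W = restrict s W"
        unfolding C_def by (simp add: Int_absorb1)
      then have "W \<in> C s U" using W a unfolding C_def by auto
      then show "\<sigma> V W (\<sigma> U V (\<psi> U s)) = \<phi> W (restrict (restrict s V) W)"
        using q \<sigma>\<sigma>[of U V W "\<psi> U s"] W a eq unfolding Q_def C_def by auto
    qed
    then show "\<sigma> U V (\<psi> U s) = \<psi> V (restrict s V)"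
      using \<psi>I S a s by blast
  qed
  have uniq: "\<psi>' U s = \<psi> U s"
    if m: "presheaf_morphism T ?S fun_restriction G \<sigma> \<psi>'"
      and e: "\<forall>U. openin T U \<longrightarrow> (\<forall>s\<in>P U. \<psi>' U s = \<phi> U s)" and U: "openin T U" and s: "s \<in> ?S U"
    for \<psi>' U s
  proof (rule \<psi>I[OF U s])
    show "Q U s (\<psi>' U s)"
      using m e U s unfolding Q_def C_def presheaf_morphism_def by fastforce
  qed
  show "\<exists>\<psi>. presheaf_morphism T ?S fun_restriction G \<sigma> \<psi> \<and>
           (\<forall>U. openin T U \<longrightarrow> (\<forall>s\<in>P U. \<psi> U s = \<phi> U s)) \<and>
           (\<forall>\<psi>'. presheaf_morphism T ?S fun_restriction G \<sigma> \<psi>' \<and>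
               (\<forall>U. openin T U \<longrightarrow> (\<forall>s\<in>P U. \<psi>' U s = \<phi> U s)) \<longrightarrow>
             (\<forall>U. openin T U \<longrightarrow> (\<forall>s\<in>?S U. \<psi>' U s = \<psi> U s)))"
  proof (intro exI[of _ \<psi>] conjI allI impI ballI mor)
    show "\<psi> U s = \<phi> U s" if "openin T U" "s \<in> P U" for U s
      using ext_\<phi>[OF that] by simp
    show "\<psi>' U s = \<psi> U s"
      if "presheaf_morphism T ?S fun_restriction G \<sigma> \<psi>' \<and>
            (\<forall>U. openin T U \<longrightarrow> (\<forall>s\<in>P U. \<psi>' U s = \<phi> U s))"
        and "openin T U" "s \<in> ?S U" for \<psi>' U s
      using uniq that by simp
  qed
qed

section \<open>Pseudoholomorphic correspondences\<close>

text \<open>An unordered \<open>n\<close>-tuple of maps is a multiset \<open>A\<close> of size \<open>n\<close>; its class under the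
  identification of tuples with the same values is represented by the function
  \<open>y \<mapsto> {f y | f \<in> A}\<close> (a multiset).\<close>

definition tuple_sections ::
    "nat \<Rightarrow> ('y, 'i) manifold_data \<Rightarrow> ('x, 'j) manifold_data \<Rightarrow> 'y set \<Rightarrow> ('y \<Rightarrow> 'x multiset) set" where
  "tuple_sections n Y X U =
     {\<lambda>y\<in>U. image_mset (\<lambda>f. f y) A | A.
        size A = n \<and> (\<forall>f\<in>#A. pseudoholomorphic (open_submanifold Y U) X f)}"

definition JCor_n ::
    "nat \<Rightarrow> ('y, 'i) manifold_data \<Rightarrow> ('x, 'j) manifold_data \<Rightarrow> 'y set \<Rightarrow> ('y \<Rightarrow> 'x multiset) set" where
  "JCor_n n Y X U = sheafification (mtop Y) (tuple_sections n Y X) U"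

text \<open>For \<open>n = 0\<close> the only section is the constant empty multiset, the empty correspondence.
  The union below is disjoint for nonempty \<open>U\<close>, so it is the coproduct there; the value of a
  presheaf on the empty set does not affect its sheafification.\<close>

definition JCor :: "('y, 'i) manifold_data \<Rightarrow> ('x, 'j) manifold_data \<Rightarrow> ('y \<Rightarrow> 'x multiset) set" where
  "JCor Y X = sheafification (mtop Y) (\<lambda>U. \<Union>n. JCor_n n Y X U) (mspace_of Y)"

text \<open>Monoids and groups are written multiplicatively, as everywhere in the algebra library.\<close>

definition JCor_monoid ::
    "('y, 'i) manifold_data \<Rightarrow> ('x, 'j) manifold_data \<Rightarrow> ('y \<Rightarrow> 'x multiset) monoid" where
  "JCor_monoid Y X =
    \<lparr> carrier = JCor Y X,
      mult = (\<lambda>s t. \<lambda>y\<in>mspace_of Y. s y + t y),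
      one = (\<lambda>y\<in>mspace_of Y. {#}) \<rparr>"

text \<open>The class of \<open>(a, b)\<close> stands for the formal difference of \<open>a\<close> and \<open>b\<close>.\<close>

definition grothendieck_rel :: "('a, 'm) monoid_scheme \<Rightarrow> (('a \<times> 'a) \<times> ('a \<times> 'a)) set" where
  "grothendieck_rel G =
     {((a, b), (c, d)). a \<in> carrier G \<and> b \<in> carrier G \<and> c \<in> carrier G \<and> d \<in> carrier G \<and>
        (\<exists>k\<in>carrier G. a \<otimes>\<^bsub>G\<^esub> d \<otimes>\<^bsub>G\<^esub> k = c \<otimes>\<^bsub>G\<^esub> b \<otimes>\<^bsub>G\<^esub> k)}"

definition grothendieck_group :: "('a, 'm) monoid_scheme \<Rightarrow> ('a \<times> 'a) set monoid" where
  "grothendieck_group G =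
    \<lparr> carrier = (carrier G \<times> carrier G) // grothendieck_rel G,
      mult = (\<lambda>A B. grothendieck_rel G ``
                {(a \<otimes>\<^bsub>G\<^esub> c, b \<otimes>\<^bsub>G\<^esub> d) | a b c d. (a, b) \<in> A \<and> (c, d) \<in> B}),
      one = grothendieck_rel G `` {(\<one>\<^bsub>G\<^esub>, \<one>\<^bsub>G\<^esub>)} \<rparr>"

text \<open>The homomorphism into \<^term>\<open>grothendieck_group H\<close> induced by a monoid homomorphism \<open>f\<close>
  into \<open>H\<close>.\<close>

definition grothendieck_map ::
    "('b, 'm) monoid_scheme \<Rightarrow> ('a \<Rightarrow> 'b) \<Rightarrow> ('a \<times> 'a) set \<Rightarrow> ('b \<times> 'b) set" where
  "grothendieck_map H f A = grothendieck_rel H `` (map_prod f f ` A)"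

definition JC ::
    "('y, 'i) manifold_data \<Rightarrow> ('x, 'j) manifold_data \<Rightarrow>
     (('y \<Rightarrow> 'x multiset) \<times> ('y \<Rightarrow> 'x multiset)) set monoid" where
  "JC Y X = grothendieck_group (JCor_monoid Y X)"

text \<open>\<open>JC_pull Z X h\<close> is $h^*$ for \<open>h\<close> with source \<open>Z\<close>;
  \<open>JC_push Y W g\<close> is $g_*$ for \<open>g\<close> with target \<open>W\<close>.\<close>

definition JC_pull ::
    "('z, 'k) manifold_data \<Rightarrow> ('x, 'j) manifold_data \<Rightarrow> ('z \<Rightarrow> 'y) \<Rightarrow>
     (('y \<Rightarrow> 'x multiset) \<times> ('y \<Rightarrow> 'x multiset)) set \<Rightarrow>
     (('z \<Rightarrow> 'x multiset) \<times> ('z \<Rightarrow> 'x multiset)) set" where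
  "JC_pull Z X h = grothendieck_map (JCor_monoid Z X) (\<lambda>s. \<lambda>z\<in>mspace_of Z. s (h z))"

definition JC_push ::
    "('y, 'i) manifold_data \<Rightarrow> ('w, 'k) manifold_data \<Rightarrow> ('x \<Rightarrow> 'w) \<Rightarrow>
     (('y \<Rightarrow> 'x multiset) \<times> ('y \<Rightarrow> 'x multiset)) set \<Rightarrow>
     (('y \<Rightarrow> 'w multiset) \<times> ('y \<Rightarrow> 'w multiset)) set" where
  "JC_push Y W g = grothendieck_map (JCor_monoid Y W) (\<lambda>s. \<lambda>y\<in>mspace_of Y. image_mset g (s y))"

section \<open>The cubical complex and its homology\<close>

definition insert_at :: "nat \<Rightarrow> 'a \<Rightarrow> 'a list \<Rightarrow> 'a list" where
  "insert_at i p ps = take i ps @ p # drop i ps"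

definition JC_chain ::
    "('m, 'k) manifold_data \<Rightarrow> ('y, 'i) manifold_data \<Rightarrow> ('x, 'j) manifold_data \<Rightarrow> nat \<Rightarrow>
     (('y \<times> 'm list \<Rightarrow> 'x multiset) \<times> ('y \<times> 'm list \<Rightarrow> 'x multiset)) set monoid" where
  "JC_chain M Y X n = JC (Y \<times>\<^sub>m power_manifold M n) X"

definition JC_face ::
    "('m, 'k) manifold_data \<Rightarrow> ('y, 'i) manifold_data \<Rightarrow> ('x, 'j) manifold_data \<Rightarrow> nat \<Rightarrow> nat \<Rightarrow> 'm \<Rightarrow>
     (('y \<times> 'm list \<Rightarrow> 'x multiset) \<times> ('y \<times> 'm list \<Rightarrow> 'x multiset)) set \<Rightarrow>
     (('y \<times> 'm list \<Rightarrow> 'x multiset) \<times> ('y \<times> 'm list \<Rightarrow> 'x multiset)) set" where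
  "JC_face M Y X n i p = JC_pull (Y \<times>\<^sub>m power_manifold M (n - 1)) X (map_prod id (insert_at i p))"

text \<open>The differential from degree \<open>n\<close> to degree \<open>n - 1\<close>, written multiplicatively.  For
  \<open>n = 0\<close> the product is empty, so \<open>JC_boundary M p0 p1 Y X 0\<close> is trivial and all 0-chains are
  cycles, although there is no chain group in degree \<open>-1\<close>.\<close>

definition JC_boundary ::
    "('m, 'k) manifold_data \<Rightarrow> 'm \<Rightarrow> 'm \<Rightarrow> ('y, 'i) manifold_data \<Rightarrow> ('x, 'j) manifold_data \<Rightarrow> nat \<Rightarrow>
     (('y \<times> 'm list \<Rightarrow> 'x multiset) \<times> ('y \<times> 'm list \<Rightarrow> 'x multiset)) set \<Rightarrow>
     (('y \<times> 'm list \<Rightarrow> 'x multiset) \<times> ('y \<times> 'm list \<Rightarrow> 'x multiset)) set" where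
  "JC_boundary M p0 p1 Y X n a =
     finprod (JC_chain M Y X (n - 1))
       (\<lambda>(\<epsilon>, i). JC_face M Y X n i (if \<epsilon> = 0 then p0 else p1) a
                   [^]\<^bsub>JC_chain M Y X (n - 1)\<^esub> ((- 1) ^ (\<epsilon> + i) :: int))
       ({0, 1 :: nat} \<times> {..<n})"

definition JC_cycles where
  "JC_cycles M p0 p1 Y X n =
     kernel (JC_chain M Y X n) (JC_chain M Y X (n - 1)) (JC_boundary M p0 p1 Y X n)"

definition JC_boundaries where
  "JC_boundaries M p0 p1 Y X n =
     JC_boundary M p0 p1 Y X (Suc n) ` carrier (JC_chain M Y X (Suc n))"

definition JH ::
    "('m, 'k) manifold_data \<Rightarrow> 'm \<Rightarrow> 'm \<Rightarrow> ('y, 'i) manifold_data \<Rightarrow> ('x, 'j) manifold_data \<Rightarrow> nat \<Rightarrow>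
     (('y \<times> 'm list \<Rightarrow> 'x multiset) \<times> ('y \<times> 'm list \<Rightarrow> 'x multiset)) set set monoid" where
  "JH M p0 p1 Y X n =
     (JC_chain M Y X n)\<lparr>carrier := JC_cycles M p0 p1 Y X n\<rparr> Mod JC_boundaries M p0 p1 Y X n"

text \<open>For \<open>A\<close> the homology class of a cycle \<open>a\<close>, the product of the subgroup of boundaries with
  the image of \<open>A\<close> under a chain map is the homology class of the image of \<open>a\<close>.\<close>

definition JH_push ::
    "('m, 'k) manifold_data \<Rightarrow> 'm \<Rightarrow> 'm \<Rightarrow> ('y, 'i) manifold_data \<Rightarrow> ('w, 'j) manifold_data \<Rightarrow> nat \<Rightarrow>
     ('x \<Rightarrow> 'w) \<Rightarrow>
     (('y \<times> 'm list \<Rightarrow> 'x multiset) \<times> ('y \<times> 'm list \<Rightarrow> 'x multiset)) set set \<Rightarrow>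
     (('y \<times> 'm list \<Rightarrow> 'w multiset) \<times> ('y \<times> 'm list \<Rightarrow> 'w multiset)) set set" where
  "JH_push M p0 p1 Y W n g A =
     JC_boundaries M p0 p1 Y W n <#>\<^bsub>JC_chain M Y W n\<^esub>
       (JC_push (Y \<times>\<^sub>m power_manifold M n) W g ` A)"

definition JH_pull ::
    "('m, 'k) manifold_data \<Rightarrow> 'm \<Rightarrow> 'm \<Rightarrow> ('z, 'i) manifold_data \<Rightarrow> ('x, 'j) manifold_data \<Rightarrow> nat \<Rightarrow>
     ('z \<Rightarrow> 'y) \<Rightarrow>
     (('y \<times> 'm list \<Rightarrow> 'x multiset) \<times> ('y \<times> 'm list \<Rightarrow> 'x multiset)) set set \<Rightarrow>
     (('z \<times> 'm list \<Rightarrow> 'x multiset) \<times> ('z \<times> 'm list \<Rightarrow> 'x multiset)) set set" where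
  "JH_pull M p0 p1 Z X n h A =
     JC_boundaries M p0 p1 Z X n <#>\<^bsub>JC_chain M Z X n\<^esub>
       (JC_pull (Z \<times>\<^sub>m power_manifold M n) X (map_prod h id) ` A)"

end

(* The map gamma contracts M onto p0 in the direction of the cubical coordinates: a correspondence f
   with values in X x M is joined to its projection to X x {p0} by the family
   (y, (t, ts)) |-> (x, gamma(t, m)) for (x, m) in f(y, ts), which lives over one more factor M. Its
   faces at t = p0 and t = p1 are the two maps to be compared and its other faces are the homotopy
   applied to the faces of f, so this is a chain homotopy; for Y x M one precomposes with gamma
   instead. The families are correspondences because pseudoholomorphic maps are closed under
   composition and pairing, which in coordinates is the chain rule. *)

theory Submission
  imports Defs "HOL-Algebra.Elementary_Groups"
begin

section \<open>Calculus in coordinate spaces\<close>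

text \<open>The homotopy puts the new factor of the cube in first position. Its two faces of index 0
  then hold the two maps to be compared, and every face of the given chain reappears with its index
  raised by one, hence with the opposite sign. Written additively, d h + h d = e - id, where e is
  the composite that collapses M to p0. The other composite is the identity already on chains, so
  one homotopy settles each half of the theorem.

  Chains are classes of pairs of correspondences, and the differential is a product of integer
  powers of such classes. Correspondences are functions with multiset values, and multisets cancel,
  so a class is determined by its integer multiplicities at all points. The sign computations take
  place there.

  As the dimension is a value, coordinate space consists of functions on the naturals, and
  smoothness means iterated continuous partial derivatives. Existence of partial derivatives alone
  would not give a chain rule; their continuity enters through Hadamard's lemma.\<close>

text \<open>A basic open set of the product topology constrains only finitely many coordinates, so
  one radius serves them all; coordinates from \<open>n\<close> on vanish for both points.\<close>

lemma openin_Euclidean_space_box: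
  assumes "openin (Euclidean_space n) S" "a \<in> S"
  obtains e where "e > 0"
    "\<And>z. z \<in> topspace (Euclidean_space n) \<Longrightarrow> (\<And>i. i < n \<Longrightarrow> \<bar>z i - a i\<bar> < e) \<Longrightarrow> z \<in> S"
proof -
  obtain T where T: "openin (powertop_real UNIV) T" "S = T \<inter> {x. \<forall>i\<ge>n. x i = 0}"
    using assms(1) unfolding Euclidean_space_def openin_subtopology by auto
  then have "a \<in> T" and a0: "\<And>i. i \<ge> n \<Longrightarrow> a i = 0" using assms(2) by auto
  then obtain U where U: "finite {i. U i \<noteq> UNIV}" "\<And>i. open (U i)" "a \<in> Pi\<^sub>E UNIV U" "Pi\<^sub>E UNIV U \<subseteq> T"
    using T(1) by (auto simp: openin_product_topology_alt)
  have "\<exists>e>0. \<forall>t. \<bar>t - a i\<bar> < e \<longrightarrow> t \<in> U i" for i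
    using U(2,3) open_real by (metis PiE_iff UNIV_I open_dist dist_real_def)
  then obtain e where e: "\<And>i. e i > 0" "\<And>i t. \<bar>t - a i\<bar> < e i \<Longrightarrow> t \<in> U i" by metis
  \<comment> \<open>The inserted 1 keeps \<open>Min\<close> meaningful and positive when no
    coordinate is constrained.\<close>
  define d where "d = Min (insert 1 (e ` {i. U i \<noteq> UNIV}))"
  have d: "d > 0" "\<And>i. U i \<noteq> UNIV \<Longrightarrow> d \<le> e i"
    unfolding d_def using U(1) e(1) by (auto simp: Min_gr_iff)
  show thesis
  proof
    fix z assume z: "z \<in> topspace (Euclidean_space n)" "\<And>i. i < n \<Longrightarrow> \<bar>z i - a i\<bar> < d"
    have "z i \<in> U i" for i
    proof (cases "U i = UNIV \<or> i \<ge> n")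
      case True
      then show ?thesis using z(1) a0[of i] e(1)[of i] e(2)[of "z i" i] by (auto simp: topspace_Euclidean_space)
    next
      case False
      then show ?thesis using z(2)[of i] d(2)[of i] e(2)[of "z i" i] by simp
    qed
    then have "z \<in> T" using U(4) by (auto simp: PiE_iff)
    then show "z \<in> S" using z(1) by (simp add: T(2) topspace_Euclidean_space)
  qed (fact d)
qed

text \<open>The reason why partial derivatives at a point of an open set depend only on the values
  in that set.\<close>

lemma eventually_upd_in_openin:
  assumes S: "openin (Euclidean_space n) S" and "x \<in> S" "i < n"
  shows "eventually (\<lambda>t. x(i := t) \<in> S) (nhds (x i))"
proof -
  obtain e where e: "e > 0"
    "\<And>z. z \<in> topspace (Euclidean_space n) \<Longrightarrow> (\<And>i. i < n \<Longrightarrow> \<bar>z i - x i\<bar> < e) \<Longrightarrow> z \<in> S"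
    using openin_Euclidean_space_box[OF assms(1,2)] by blast
  have "x \<in> topspace (Euclidean_space n)" using openin_subset[OF S] assms(2) by blast
  then have "x(i := t) \<in> S" if "dist t (x i) < e" for t
    using that \<open>i < n\<close> e(1) by (intro e(2)) (auto simp: topspace_Euclidean_space dist_real_def)
  then show ?thesis using e(1) unfolding eventually_nhds_metric by blast
qed

lemma continuous_map_Euclidean_space_coordinate:
  "continuous_map (Euclidean_space n) euclideanreal (\<lambda>x. x i)"
  unfolding Euclidean_space_def
  by (intro continuous_map_from_subtopology continuous_map_product_projection) simp

lemma continuous_map_into_Euclidean_space:
  assumes "\<And>x i. x \<in> topspace X \<Longrightarrow> i \<ge> n \<Longrightarrow> f x i = 0"
    and "\<And>i. i < n \<Longrightarrow> continuous_map X euclideanreal (\<lambda>x. f x i)"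
  shows "continuous_map X (Euclidean_space n) f"
proof -
  have "continuous_map X (Euclidean_space n) (\<lambda>x i. if i < n then f x i else 0)"
    by (simp add: continuous_map_componentwise_Euclidean_space assms(2))
  then show ?thesis
    by (rule continuous_map_eq) (use assms(1) in \<open>auto simp: fun_eq_iff\<close>)
qed

section \<open>Iterated continuous differentiability: locality, sums and products\<close>

lemma partial_deriv_cong:
  assumes "openin (Euclidean_space n) S" "x \<in> S" "i < n" "\<And>y. y \<in> S \<Longrightarrow> f y = g y"
  shows "partial_deriv i f x = partial_deriv i g x"
  unfolding partial_deriv_def
  by (rule deriv_cong_ev)
     (use eventually_upd_in_openin[OF assms(1-3)] assms(4) in \<open>auto elim: eventually_mono\<close>)

lemma times_cont_diff_continuous:
  "times_cont_diff k n S f \<Longrightarrow> continuous_map (subtopology (Euclidean_space n) S) euclideanreal f"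
  by (cases k) auto

lemma times_cont_diff_subset:
  "times_cont_diff k n S f \<Longrightarrow> T \<subseteq> S \<Longrightarrow> times_cont_diff k n T f"
proof (induction k arbitrary: f)
  case 0
  then show ?case by (auto intro: continuous_map_from_subtopology_mono)
next
  case (Suc k)
  then show ?case by (auto intro: continuous_map_from_subtopology_mono)
qed

lemma times_cont_diff_SucD: "times_cont_diff (Suc k) n S f \<Longrightarrow> times_cont_diff k n S f"
  by (induction k arbitrary: f) auto

text \<open>Local representatives are total functions with arbitrary values off the chart image, so
  smoothness has to be insensitive to those values. Openness is essential: every small change of one
  coordinate stays in \<open>S\<close>.\<close>

lemma times_cont_diff_cong:
  assumes "openin (Euclidean_space n) S"
  shows "times_cont_diff k n S f \<Longrightarrow> (\<And>x. x \<in> S \<Longrightarrow> f x = g x) \<Longrightarrow> times_cont_diff k n S g"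
proof (induction k arbitrary: f g)
  case 0
  then show ?case using continuous_map_eq[of "subtopology (Euclidean_space n) S" euclideanreal f g] by simp
next
  case (Suc k)
  have "(\<lambda>t. g (x(i := t))) differentiable at (x i)" if "i < n" "x \<in> S" for i x
  proof -
    have ev: "eventually (\<lambda>t. f (x(i := t)) = g (x(i := t))) (nhds (x i))"
      using eventually_upd_in_openin[OF assms that(2,1)]
      by eventually_elim (rule Suc.prems(2))
    have "(\<lambda>t. f (x(i := t))) differentiable at (x i)" using Suc.prems(1) that by auto
    then obtain D where "((\<lambda>t. f (x(i := t))) has_real_derivative D) (at (x i))"
      using real_differentiable_def by blast
    then have "((\<lambda>t. g (x(i := t))) has_real_derivative D) (at (x i))"
      using DERIV_cong_ev[OF refl ev refl] by blast
    then show ?thesis using real_differentiable_def by blast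
  qed
  moreover have "times_cont_diff k n S (partial_deriv i g)" if "i < n" for i
  proof (rule Suc.IH)
    show "times_cont_diff k n S (partial_deriv i f)" using Suc.prems(1) that by simp
    show "partial_deriv i f x = partial_deriv i g x" if "x \<in> S" for x
      by (rule partial_deriv_cong[OF assms that \<open>i < n\<close> Suc.prems(2)])
  qed
  moreover have "continuous_map (subtopology (Euclidean_space n) S) euclideanreal g"
    by (rule continuous_map_eq[OF times_cont_diff_continuous[OF Suc.prems(1)]]) (simp add: Suc.prems(2))
  ultimately show ?case by simp
qed

lemma continuous_map_local:
  assumes "\<And>x. x \<in> S \<Longrightarrow> \<exists>T. openin X T \<and> x \<in> T \<and> T \<subseteq> S \<and> continuous_map (subtopology X T) Y f"
  shows "continuous_map (subtopology X S) Y f"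
proof (rule pasting_lemma[where I = "{T. openin X T \<and> T \<subseteq> S \<and> continuous_map (subtopology X T) Y f}"
      and T = id and f = "\<lambda>_. f"])
  show "openin (subtopology X S) (id T)"
    if "T \<in> {T. openin X T \<and> T \<subseteq> S \<and> continuous_map (subtopology X T) Y f}" for T
    using that by (auto intro: openin_open_subtopology[THEN iffD2] simp: openin_subtopology)
  show "continuous_map (subtopology (subtopology X S) (id T)) Y f"
    if "T \<in> {T. openin X T \<and> T \<subseteq> S \<and> continuous_map (subtopology X T) Y f}" for T
    using that by (simp add: subtopology_subtopology Int_absorb1)
qed (use assms in auto)

text \<open>Needed for composites of maps of manifolds, where the chart in the middle can be fixed
  only near a given point.\<close>

lemma times_cont_diff_local:
  assumes "\<And>x. x \<in> S \<Longrightarrow> \<exists>T. openin (Euclidean_space n) T \<and> x \<in> T \<and> T \<subseteq> S \<and> times_cont_diff k n T f"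
  shows "times_cont_diff k n S f"
  using assms
proof (induction k arbitrary: f)
  case 0
  show ?case
    unfolding times_cont_diff.simps
    by (rule continuous_map_local, drule 0) (simp only: times_cont_diff.simps)
next
  case (Suc k)
  have "continuous_map (subtopology (Euclidean_space n) S) euclideanreal f"
  proof (rule continuous_map_local)
    fix x assume "x \<in> S"
    then obtain T where "openin (Euclidean_space n) T" "x \<in> T" "T \<subseteq> S" "times_cont_diff (Suc k) n T f"
      using Suc.prems by meson
    then show "\<exists>T. openin (Euclidean_space n) T \<and> x \<in> T \<and> T \<subseteq> S \<and>
        continuous_map (subtopology (Euclidean_space n) T) euclideanreal f"
      using times_cont_diff_continuous by meson
  qed
  moreover have "times_cont_diff k n S (partial_deriv i f)" if "i < n" for i
  proof (rule Suc.IH)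
    fix x assume "x \<in> S"
    then show "\<exists>T. openin (Euclidean_space n) T \<and> x \<in> T \<and> T \<subseteq> S \<and> times_cont_diff k n T (partial_deriv i f)"
      using Suc.prems[of x] that by auto
  qed
  moreover have "(\<lambda>t. f (x(i := t))) differentiable at (x i)" if "i < n" "x \<in> S" for i x
    using Suc.prems[OF that(2)] that(1) by auto
  ultimately show ?case by auto
qed

lemma times_cont_diff_const: "times_cont_diff k n S (\<lambda>_. c)"
proof (induction k arbitrary: c)
  case (Suc k)
  have "partial_deriv i (\<lambda>_. c) = (\<lambda>_. 0)" for i by (simp add: partial_deriv_def fun_eq_iff)
  with Suc show ?case by auto
qed auto

lemma has_partial_deriv:
  assumes "times_cont_diff (Suc k) n S f" "x \<in> S" "i < n"
  shows "((\<lambda>t. f (x(i := t))) has_real_derivative partial_deriv i f x) (at (x i))"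
  using assms unfolding partial_deriv_def
  by (auto simp: DERIV_deriv_iff_real_differentiable)

text \<open>Accepts any formula for the derivatives that is correct on \<open>S\<close>, so that
  sum, product and chain rules can supply it instead of an evaluation of
  \<open>deriv\<close>.\<close>

lemma times_cont_diff_SucI:
  assumes S: "openin (Euclidean_space n) S"
    and c: "continuous_map (subtopology (Euclidean_space n) S) euclideanreal f"
    and D: "\<And>i x. i < n \<Longrightarrow> x \<in> S \<Longrightarrow> ((\<lambda>t. f (x(i := t))) has_real_derivative D i x) (at (x i))"
    and DC: "\<And>i. i < n \<Longrightarrow> times_cont_diff k n S (D i)"
  shows "times_cont_diff (Suc k) n S f"
proof -
  have "partial_deriv i f x = D i x" if "i < n" "x \<in> S" for i x
    using DERIV_imp_deriv[OF D[OF that]] by (simp add: partial_deriv_def)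
  then have "times_cont_diff k n S (partial_deriv i f)" if "i < n" for i
    using times_cont_diff_cong[OF S DC[OF that]] that by simp
  then show ?thesis using c D real_differentiable_def by auto
qed

lemma times_cont_diff_add:
  assumes S: "openin (Euclidean_space n) S"
  shows "times_cont_diff k n S f \<Longrightarrow> times_cont_diff k n S g \<Longrightarrow> times_cont_diff k n S (\<lambda>x. f x + g x)"
proof (induction k arbitrary: f g)
  case 0
  then show ?case by (auto intro: continuous_intros)
next
  case (Suc k)
  show ?case
  proof (rule times_cont_diff_SucI[OF S, where D = "\<lambda>i x. partial_deriv i f x + partial_deriv i g x"])
    show "continuous_map (subtopology (Euclidean_space n) S) euclideanreal (\<lambda>x. f x + g x)"
      using Suc.prems by (intro continuous_map_add times_cont_diff_continuous)
    show "((\<lambda>t. f (x(i := t)) + g (x(i := t))) has_real_derivative partial_deriv i f x + partial_deriv i g x) (at (x i))"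
      if "i < n" "x \<in> S" for i x
      using Suc.prems that by (intro DERIV_add has_partial_deriv)
    show "times_cont_diff k n S (\<lambda>x. partial_deriv i f x + partial_deriv i g x)" if "i < n" for i
      using Suc.prems that by (intro Suc.IH) auto
  qed
qed

lemma times_cont_diff_mult:
  assumes S: "openin (Euclidean_space n) S"
  shows "times_cont_diff k n S f \<Longrightarrow> times_cont_diff k n S g \<Longrightarrow> times_cont_diff k n S (\<lambda>x. f x * g x)"
proof (induction k arbitrary: f g)
  case 0
  then show ?case by (auto intro: continuous_map_real_mult)
next
  case (Suc k)
  show ?case
  proof (rule times_cont_diff_SucI[OF S, where D = "\<lambda>i x. partial_deriv i f x * g x + partial_deriv i g x * f x"])
    show "continuous_map (subtopology (Euclidean_space n) S) euclideanreal (\<lambda>x. f x * g x)"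
      using Suc.prems by (intro continuous_map_real_mult times_cont_diff_continuous)
    show "((\<lambda>t. f (x(i := t)) * g (x(i := t))) has_real_derivative partial_deriv i f x * g x + partial_deriv i g x * f x) (at (x i))"
      if "i < n" "x \<in> S" for i x
      using DERIV_mult[OF has_partial_deriv[OF Suc.prems(1) that(2,1)] has_partial_deriv[OF Suc.prems(2) that(2,1)]]
      by (simp only: fun_upd_triv)
    show "times_cont_diff k n S (\<lambda>x. partial_deriv i f x * g x + partial_deriv i g x * f x)" if "i < n" for i
      \<comment> \<open>The Leibniz rule leaves one factor undifferentiated; it is lowered to order
        \<open>k\<close> before the induction hypothesis applies.\<close>
      using Suc.prems times_cont_diff_SucD[OF Suc.prems(1)] times_cont_diff_SucD[OF Suc.prems(2)] that
      by (intro Suc.IH times_cont_diff_add[OF S]) auto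
  qed
qed

lemma times_cont_diff_sum:
  fixes I :: "nat set"
  assumes "openin (Euclidean_space n) S" "\<And>l. l \<in> I \<Longrightarrow> times_cont_diff k n S (f l)"
  shows "times_cont_diff k n S (\<lambda>x. \<Sum>l\<in>I. f l x)"
  using assms(2) by (induction I rule: infinite_finite_induct)
    (auto intro: times_cont_diff_const times_cont_diff_add[OF assms(1)])

text \<open>Hadamard's lemma with coefficients continuous at \<open>a\<close>: move from \<open>a\<close> to \<open>z\<close> one coordinate
  at a time and apply the mean value inequality to each step.\<close>

lemma difference_by_partial_derivs:
  assumes T: "openin (Euclidean_space n) T" and a: "a \<in> T" and G: "times_cont_diff (Suc 0) n T G"
  obtains A where
    "\<And>z. z \<in> topspace (Euclidean_space n) \<Longrightarrow> G z - G a = (\<Sum>l<n. A l z * (z l - a l))"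
    "\<And>l \<epsilon>. l < n \<Longrightarrow> \<epsilon> > 0 \<Longrightarrow> \<exists>\<delta>>0. \<forall>z\<in>topspace (Euclidean_space n).
       (\<forall>i<n. \<bar>z i - a i\<bar> < \<delta>) \<longrightarrow> \<bar>A l z - partial_deriv l G a\<bar> \<le> \<epsilon>"
proof -
  \<comment> \<open>The corners of the path from \<open>a\<close> to \<open>z\<close>: the first
    \<open>l\<close> coordinates have already been moved.\<close>
  define u where "u z l = (\<lambda>i. if i < l then z i else a i)" for z :: "nat \<Rightarrow> real" and l :: nat
  \<comment> \<open>The difference quotient of the l-th step; if the step has length 0, the partial
    derivative at \<open>a\<close> makes the coefficient continuous there.\<close>
  define A where "A l z = (if z l = a l then partial_deriv l G a
      else (G (u z (Suc l)) - G (u z l)) / (z l - a l))" for l z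
  have aE: "a \<in> topspace (Euclidean_space n)" using openin_subset[OF T] a by blast
  have u1: "u z (Suc l) = (u z l)(l := z l)" "u z l = (u z l)(l := a l)" for z l
    by (auto simp: u_def fun_eq_iff less_Suc_eq)
  show thesis
  proof
    fix z assume z: "z \<in> topspace (Euclidean_space n)"
    have "u z n = z" using z aE by (auto simp: u_def fun_eq_iff topspace_Euclidean_space)
    \<comment> \<open>This identity is a telescoping sum of values of \<open>G\<close> and holds
      even if the path leaves \<open>T\<close>; only the estimate below needs points of
      \<open>T\<close>.\<close>
    then have "G z - G a = (\<Sum>l<n. G (u z (Suc l)) - G (u z l))"
      by (subst sum_lessThan_telescope) (simp add: u_def)
    also have "\<dots> = (\<Sum>l<n. A l z * (z l - a l))"
    proof (rule sum.cong)
      fix l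
      show "G (u z (Suc l)) - G (u z l) = A l z * (z l - a l)"
        using u1(1)[of z l] u1(2)[of z l] by (cases "z l = a l") (auto simp: A_def)
    qed simp
    finally show "G z - G a = (\<Sum>l<n. A l z * (z l - a l))" .
  next
    fix l and \<epsilon> :: real assume l: "l < n" and \<epsilon>: "\<epsilon> > 0"
    have "continuous_map (subtopology (Euclidean_space n) T) euclideanreal (partial_deriv l G)"
      using G l by simp
    then have "openin (subtopology (Euclidean_space n) T)
        {z \<in> topspace (subtopology (Euclidean_space n) T). partial_deriv l G z \<in> ball (partial_deriv l G a) \<epsilon>}"
      by (intro openin_continuous_map_preimage) (auto simp: open_openin[symmetric])
    moreover have "topspace (subtopology (Euclidean_space n) T) = T"
      using openin_subset[OF T] by auto
    ultimately have "openin (subtopology (Euclidean_space n) T)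
        {z \<in> T. partial_deriv l G z \<in> ball (partial_deriv l G a) \<epsilon>}" by (simp only:)
    then have "openin (Euclidean_space n) {z \<in> T. partial_deriv l G z \<in> ball (partial_deriv l G a) \<epsilon>}"
      using T by (simp add: openin_open_subtopology)
    then obtain \<delta> where \<delta>: "\<delta> > 0" "\<And>z. z \<in> topspace (Euclidean_space n) \<Longrightarrow> (\<And>i. i < n \<Longrightarrow> \<bar>z i - a i\<bar> < \<delta>) \<Longrightarrow>
        z \<in> T \<and> partial_deriv l G z \<in> ball (partial_deriv l G a) \<epsilon>"
      using openin_Euclidean_space_box[of n "{z \<in> T. partial_deriv l G z \<in> ball (partial_deriv l G a) \<epsilon>}" a]
        a \<epsilon> by (metis (mono_tags, lifting) centre_in_ball mem_Collect_eq)
    have "\<bar>A l z - partial_deriv l G a\<bar> \<le> \<epsilon>"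
      if z: "z \<in> topspace (Euclidean_space n)" "\<forall>i<n. \<bar>z i - a i\<bar> < \<delta>" for z
    proof (cases "z l = a l")
      case False
      define v where "v t = (u z l)(l := t)" for t
      \<comment> \<open>The step stays in the box: coordinates before \<open>l\<close> are those of
        \<open>z\<close>, later ones those of \<open>a\<close>, and the moving one lies between the
        two.\<close>
      have v: "v t \<in> T \<and> partial_deriv l G (v t) \<in> ball (partial_deriv l G a) \<epsilon>"
        if t: "t \<in> closed_segment (a l) (z l)" for t
      proof (rule \<delta>(2))
        show "v t \<in> topspace (Euclidean_space n)"
          using z(1) aE l by (auto simp: v_def u_def topspace_Euclidean_space)
        have "\<bar>t - a l\<bar> \<le> \<bar>z l - a l\<bar>" using t by (auto simp: closed_segment_eq_real_ivl split: if_splits)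
        then show "\<bar>v t i - a i\<bar> < \<delta>" if "i < n" for i
          using z(2)[rule_format, OF that] z(2)[rule_format, OF l] \<delta>(1) by (auto simp: v_def u_def)
      qed
      \<comment> \<open>Subtracting the linear term leaves a function whose derivative along the
        segment is bounded by \<epsilon>.\<close>
      let ?g = "\<lambda>t. G (v t) - partial_deriv l G a * t"
      have "norm (?g (z l) - ?g (a l)) \<le> \<epsilon> * norm (z l - a l)"
      proof (rule field_differentiable_bound[where S = "closed_segment (a l) (z l)"])
        fix t assume t: "t \<in> closed_segment (a l) (z l)"
        have "((\<lambda>s. G ((v t)(l := s))) has_real_derivative partial_deriv l G (v t)) (at (v t l))"
          using has_partial_deriv[OF G] v[OF t] l by blast
        moreover have "(v t)(l := s) = v s" for s by (auto simp: v_def)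
        ultimately have "((\<lambda>s. G (v s)) has_real_derivative partial_deriv l G (v t)) (at t)"
          by (simp add: v_def)
        then show "(?g has_real_derivative partial_deriv l G (v t) - partial_deriv l G a)
            (at t within closed_segment (a l) (z l))"
          by (auto intro!: derivative_eq_intros intro: has_field_derivative_at_within)
        show "norm (partial_deriv l G (v t) - partial_deriv l G a) \<le> \<epsilon>"
          using v[OF t] by (auto simp: dist_real_def)
      qed auto
      moreover have "v (z l) = u z (Suc l)" "v (a l) = u z l" using u1[of z l] by (auto simp: v_def)
      ultimately have "\<bar>G (u z (Suc l)) - G (u z l) - partial_deriv l G a * (z l - a l)\<bar> \<le> \<epsilon> * \<bar>z l - a l\<bar>"
        by (simp add: algebra_simps)
      moreover have "A l z - partial_deriv l G a
          = (G (u z (Suc l)) - G (u z l) - partial_deriv l G a * (z l - a l)) / (z l - a l)"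
        using False by (simp add: A_def diff_divide_distrib)
      ultimately show ?thesis using False by (simp add: abs_divide divide_le_eq)
    qed (use \<epsilon> in \<open>simp add: A_def\<close>)
    then show "\<exists>\<delta>>0. \<forall>z\<in>topspace (Euclidean_space n).
       (\<forall>i<n. \<bar>z i - a i\<bar> < \<delta>) \<longrightarrow> \<bar>A l z - partial_deriv l G a\<bar> \<le> \<epsilon>"
      using \<delta>(1) by blast
  qed
qed

text \<open>Divide Hadamard's identity at \<open>c t\<close> by \<open>t - t0\<close>. The
  coefficients tend to the partial derivatives because each coordinate of the curve, being
  differentiable, is continuous at \<open>t0\<close>.\<close>

lemma chain_rule_curve:
  assumes T: "openin (Euclidean_space n) T" and G: "times_cont_diff (Suc 0) n T G"
    and c0: "c t0 \<in> T" and cE: "eventually (\<lambda>t. c t \<in> topspace (Euclidean_space n)) (nhds t0)"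
    and c: "\<And>l. l < n \<Longrightarrow> ((\<lambda>t. c t l) has_real_derivative c' l) (at t0)"
  shows "((\<lambda>t. G (c t)) has_real_derivative (\<Sum>l<n. partial_deriv l G (c t0) * c' l)) (at t0)"
proof -
  obtain A where A: "\<And>z. z \<in> topspace (Euclidean_space n) \<Longrightarrow> G z - G (c t0) = (\<Sum>l<n. A l z * (z l - c t0 l))"
    "\<And>l \<epsilon>. l < n \<Longrightarrow> \<epsilon> > 0 \<Longrightarrow> \<exists>\<delta>>0. \<forall>z\<in>topspace (Euclidean_space n).
       (\<forall>i<n. \<bar>z i - c t0 i\<bar> < \<delta>) \<longrightarrow> \<bar>A l z - partial_deriv l G (c t0)\<bar> \<le> \<epsilon>"
    using difference_by_partial_derivs[OF T c0 G] by blast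
  have cE': "eventually (\<lambda>t. c t \<in> topspace (Euclidean_space n)) (at t0)"
    using cE by (auto simp: eventually_at_filter elim: eventually_mono)
  have AL: "((\<lambda>t. A l (c t)) \<longlongrightarrow> partial_deriv l G (c t0)) (at t0)" if l: "l < n" for l
  proof (rule tendstoI)
    fix \<epsilon> :: real assume "\<epsilon> > 0"
    then obtain \<delta> where \<delta>: "\<delta> > 0" "\<And>z. z\<in>topspace (Euclidean_space n) \<Longrightarrow>
       (\<forall>i<n. \<bar>z i - c t0 i\<bar> < \<delta>) \<Longrightarrow> \<bar>A l z - partial_deriv l G (c t0)\<bar> \<le> \<epsilon> / 2"
      using A(2)[OF l, of "\<epsilon> / 2"] by auto
    have "eventually (\<lambda>t. \<bar>c t i - c t0 i\<bar> < \<delta>) (at t0)" if "i < n" for i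
    proof -
      have "((\<lambda>t. c t i) \<longlongrightarrow> c t0 i) (at t0)"
        using DERIV_isCont[OF c[OF that]] by (simp add: isCont_def)
      from tendstoD[OF this \<delta>(1)] show ?thesis by (simp add: dist_real_def)
    qed
    then have "eventually (\<lambda>t. \<forall>i\<in>{..<n}. \<bar>c t i - c t0 i\<bar> < \<delta>) (at t0)"
      by (intro eventually_ball_finite) auto
    with cE' show "eventually (\<lambda>t. dist (A l (c t)) (partial_deriv l G (c t0)) < \<epsilon>) (at t0)"
    proof eventually_elim
      case (elim t)
      then show ?case using \<delta>(2)[of "c t"] \<open>\<epsilon> > 0\<close> by (auto simp: dist_real_def)
    qed
  qed
  have "((\<lambda>t. \<Sum>l<n. A l (c t) * ((c t l - c t0 l) / (t - t0))) \<longlongrightarrow> (\<Sum>l<n. partial_deriv l G (c t0) * c' l)) (at t0)"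
    using c by (intro tendsto_sum tendsto_mult AL) (auto simp: has_field_derivative_iff)
  moreover have "eventually (\<lambda>t. (\<Sum>l<n. A l (c t) * ((c t l - c t0 l) / (t - t0))) = (G (c t) - G (c t0)) / (t - t0)) (at t0)"
    using cE' by eventually_elim (simp add: A(1) sum_divide_distrib)
  ultimately show ?thesis
    unfolding has_field_derivative_iff by (rule Lim_transform_eventually)
qed

text \<open>Smoothness speaks only of the first \<open>n\<close> coordinates; the inclusion of the
  image in \<open>T\<close> makes the remaining ones vanish.\<close>

lemma smooth_coord_map_continuous:
  assumes F: "smooth_coord_map m n S F" and "F ` S \<subseteq> T" and T: "T \<subseteq> topspace (Euclidean_space n)"
  shows "continuous_map (subtopology (Euclidean_space m) S) (subtopology (Euclidean_space n) T) F"
proof -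
  have "continuous_map (subtopology (Euclidean_space m) S) (Euclidean_space n) F"
  proof (rule continuous_map_into_Euclidean_space)
    show "F x i = 0" if "x \<in> topspace (subtopology (Euclidean_space m) S)" "n \<le> i" for x i
      using that assms(2) T by (auto simp: topspace_Euclidean_space)
    show "continuous_map (subtopology (Euclidean_space m) S) euclideanreal (\<lambda>x. F x i)" if "i < n" for i
      using F that times_cont_diff_continuous unfolding smooth_coord_map_def smooth_fun_def by blast
  qed
  then show ?thesis using assms(2) by (auto simp: continuous_map_in_subtopology)
qed

section \<open>The chain rule for smooth maps between open subsets of coordinate spaces\<close>

context
  fixes m n S T and F :: "(nat \<Rightarrow> real) \<Rightarrow> (nat \<Rightarrow> real)"
  assumes S: "openin (Euclidean_space m) S" and T: "openin (Euclidean_space n) T"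
    and F: "smooth_coord_map m n S F" and FT: "F ` S \<subseteq> T"
begin

text \<open>The rule for curves, applied to the curve obtained by moving the i-th coordinate of
  \<open>x\<close> and then applying \<open>F\<close>.\<close>

lemma has_partial_deriv_compose:
  assumes G: "times_cont_diff (Suc 0) n T G" and x: "x \<in> S" "i < m"
  shows "((\<lambda>t. G (F (x(i := t)))) has_real_derivative
           (\<Sum>l<n. partial_deriv l G (F x) * partial_deriv i (\<lambda>y. F y l) x)) (at (x i))"
proof -
  have "F (x(i := x i)) = F x" by simp
  have "((\<lambda>t. G (F (x(i := t)))) has_real_derivative
           (\<Sum>l<n. partial_deriv l G (F (x(i := x i))) * partial_deriv i (\<lambda>y. F y l) x)) (at (x i))"
  proof (rule chain_rule_curve[OF T G])
    show "F (x(i := x i)) \<in> T" using x FT by auto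
    show "eventually (\<lambda>t. F (x(i := t)) \<in> topspace (Euclidean_space n)) (nhds (x i))"
      using eventually_upd_in_openin[OF S x]
      by eventually_elim (use FT openin_subset[OF T] in blast)
    show "((\<lambda>t. F (x(i := t)) l) has_real_derivative partial_deriv i (\<lambda>y. F y l) x) (at (x i))" if "l < n" for l
      using has_partial_deriv[of 0 m S "\<lambda>y. F y l"] F that x
      unfolding smooth_coord_map_def smooth_fun_def by blast
  qed
  then show ?thesis by simp
qed

lemma partial_deriv_compose:
  assumes "times_cont_diff (Suc 0) n T G" "x \<in> S" "i < m"
  shows "partial_deriv i (\<lambda>x. G (F x)) x = (\<Sum>l<n. partial_deriv l G (F x) * partial_deriv i (\<lambda>y. F y l) x)"
  using DERIV_imp_deriv[OF has_partial_deriv_compose[OF assms]] by (simp add: partial_deriv_def)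

text \<open>Induction on the order for all \<open>G\<close> at once: by the chain rule, each
  derivative is a sum of products of some partial derivative of \<open>G\<close> composed with
  \<open>F\<close>, of lower order, and a partial derivative of the fixed smooth
  \<open>F\<close>.\<close>

lemma times_cont_diff_compose:
  "times_cont_diff k n T G \<Longrightarrow> times_cont_diff k m S (\<lambda>x. G (F x))"
proof (induction k arbitrary: G)
  case 0
  then show ?case
    using continuous_map_compose[OF smooth_coord_map_continuous[OF F FT openin_subset[OF T]]]
    by (simp add: o_def)
next
  case (Suc k)
  have G1: "times_cont_diff (Suc 0) n T G"
    using Suc.prems by (auto dest: times_cont_diff_continuous)
  show ?case
  proof (rule times_cont_diff_SucI[OF S _ has_partial_deriv_compose[OF G1]])
    show "continuous_map (subtopology (Euclidean_space m) S) euclideanreal (\<lambda>x. G (F x))"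
      using times_cont_diff_continuous[OF Suc.IH[OF times_cont_diff_SucD[OF Suc.prems]]] .
    show "times_cont_diff k m S (\<lambda>x. \<Sum>l<n. partial_deriv l G (F x) * partial_deriv i (\<lambda>y. F y l) x)"
      if i: "i < m" for i
    proof (intro times_cont_diff_sum times_cont_diff_mult S)
      fix l assume "l \<in> {..<n}"
      then show "times_cont_diff k m S (\<lambda>x. partial_deriv l G (F x))"
        using Suc.prems by (intro Suc.IH) auto
      have "times_cont_diff (Suc k) m S (\<lambda>y. F y l)"
        using F \<open>l \<in> _\<close> unfolding smooth_coord_map_def smooth_fun_def by blast
      then show "times_cont_diff k m S (partial_deriv i (\<lambda>y. F y l))" using i by simp
    qed
  qed
qed

lemma smooth_fun_compose: "smooth_fun n T G \<Longrightarrow> smooth_fun m S (\<lambda>x. G (F x))"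
  using times_cont_diff_compose by (simp add: smooth_fun_def)

end

lemma smooth_fun_cong:
  "openin (Euclidean_space n) S \<Longrightarrow> smooth_fun n S f \<Longrightarrow> (\<And>x. x \<in> S \<Longrightarrow> f x = g x) \<Longrightarrow> smooth_fun n S g"
  using times_cont_diff_cong unfolding smooth_fun_def by blast

lemma smooth_fun_subset: "smooth_fun n S f \<Longrightarrow> T \<subseteq> S \<Longrightarrow> smooth_fun n T f"
  unfolding smooth_fun_def by (meson times_cont_diff_subset)

lemma smooth_fun_local:
  assumes "\<And>x. x \<in> S \<Longrightarrow> \<exists>T. openin (Euclidean_space n) T \<and> x \<in> T \<and> T \<subseteq> S \<and> smooth_fun n T f"
  shows "smooth_fun n S f"
  unfolding smooth_fun_def
proof (rule allI, rule times_cont_diff_local)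
  fix k x assume "x \<in> S"
  then obtain T where "openin (Euclidean_space n) T" "x \<in> T" "T \<subseteq> S" "smooth_fun n T f"
    using assms by meson
  then show "\<exists>T. openin (Euclidean_space n) T \<and> x \<in> T \<and> T \<subseteq> S \<and> times_cont_diff k n T f"
    unfolding smooth_fun_def by meson
qed

lemma smooth_fun_const: "smooth_fun n S (\<lambda>_. c)"
  by (simp add: smooth_fun_def times_cont_diff_const)

lemma has_real_derivative_upd_coordinate:
  "((\<lambda>t. (x(i := t)) j) has_real_derivative (if i = j then 1 else 0)) (at s)"
proof (cases "i = j")
  case True
  then show ?thesis by (simp only: fun_upd_same refl if_True DERIV_ident)
next
  case False
  then have "(\<lambda>t. (x(i := t)) j) = (\<lambda>t. x j)" by (intro ext) (metis fun_upd_other)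
  with False show ?thesis by (simp only: DERIV_const if_False)
qed

lemma partial_deriv_coordinate: "partial_deriv i (\<lambda>x. x j) x = (if i = j then 1 else 0)"
  unfolding partial_deriv_def by (rule DERIV_imp_deriv, rule has_real_derivative_upd_coordinate)

lemma smooth_fun_coordinate:
  assumes "openin (Euclidean_space n) S"
  shows "smooth_fun n S (\<lambda>x. x j)"
  unfolding smooth_fun_def
proof (rule allI)
  fix k
  have c: "continuous_map (subtopology (Euclidean_space n) S) euclideanreal (\<lambda>x. x j)"
    by (rule continuous_map_from_subtopology[OF continuous_map_Euclidean_space_coordinate])
  show "times_cont_diff k n S (\<lambda>x. x j)"
  proof (cases k)
    case (Suc k')
    show ?thesis unfolding Suc
    proof (rule times_cont_diff_SucI[OF assms c, where D = "\<lambda>i x. if i = j then 1 else 0"])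
      show "((\<lambda>t. (x(i := t)) j) has_real_derivative (if i = j then 1 else 0)) (at (x i))" for i x
        by (rule has_real_derivative_upd_coordinate)
    qed (rule times_cont_diff_const)
  qed (use c in simp)
qed

section \<open>Pseudoholomorphic maps\<close>

text \<open>The proof never uses the symplectic forms, so it works with the following weaker structure,
  which products, powers and open submanifolds inherit easily.\<close>

definition open_atlas :: "('a, 'i) manifold_data \<Rightarrow> bool" where
  "open_atlas M \<longleftrightarrow>
     (\<Union>c\<in>charts M. cdom M c) = mspace_of M \<and>
     (\<forall>c\<in>charts M. openin (mtop M) (cdom M c) \<and> inj_on (cmap M c) (cdom M c) \<and>
        (\<forall>U. openin (mtop M) U \<longrightarrow> openin (Euclidean_space (mdim M)) (cmap M c ` (cdom M c \<inter> U))))"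

text \<open>Pseudoholomorphy of the identity packs two conditions into one: between charts of
  \<open>M\<close>, its smoothness says that the transition maps are smooth, and the intertwining
  says that the components of J transform as a tensor.\<close>

definition ac_manifold :: "('a, 'i) manifold_data \<Rightarrow> bool" where
  "ac_manifold M \<longleftrightarrow> open_atlas M \<and> pseudoholomorphic M M (\<lambda>p. p)"

lemma open_atlasD:
  assumes "open_atlas M" "c \<in> charts M"
  shows "openin (mtop M) (cdom M c)" "inj_on (cmap M c) (cdom M c)"
    "openin (mtop M) U \<Longrightarrow> openin (Euclidean_space (mdim M)) (cmap M c ` (cdom M c \<inter> U))"
    "p \<in> cdom M c \<Longrightarrow> p \<in> mspace_of M"
    "p \<in> cdom M c \<Longrightarrow> chart_inv M c (cmap M c p) = p"
    "p \<in> cdom M c \<Longrightarrow> local_rep M c N c' f (cmap M c p) = cmap N c' (f p)"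
  using assms unfolding open_atlas_def by (auto simp: chart_inv_def local_rep_def)

lemma open_atlas_cover:
  assumes "open_atlas M" "p \<in> mspace_of M"
  obtains c where "c \<in> charts M" "p \<in> cdom M c"
  using assms unfolding open_atlas_def by blast

lemma openin_chart_image:
  assumes M: "open_atlas M" and c: "c \<in> charts M"
    and f: "continuous_map (mtop M) T f" and V: "openin T V"
  shows "openin (Euclidean_space (mdim M)) (cmap M c ` (cdom M c \<inter> f -` V))"
proof -
  have "openin (mtop M) {x \<in> mspace_of M. f x \<in> V}"
    by (rule openin_continuous_map_preimage[OF f V])
  moreover have "cdom M c \<inter> {x \<in> mspace_of M. f x \<in> V} = cdom M c \<inter> f -` V"
    using open_atlasD(4)[OF M c] by auto
  ultimately show ?thesis using open_atlasD(3)[OF M c] by metis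
qed

lemma cmap_in_Euclidean_space:
  assumes "open_atlas M" "c \<in> charts M" "p \<in> cdom M c"
  shows "cmap M c p \<in> topspace (Euclidean_space (mdim M))"
proof -
  have "openin (Euclidean_space (mdim M)) (cmap M c ` (cdom M c \<inter> cdom M c))"
    using open_atlasD(1,3)[OF assms(1,2)] by blast
  then show ?thesis using openin_subset assms(3) by blast
qed

lemma smooth_coord_map_cong:
  assumes "openin (Euclidean_space m) S" "smooth_coord_map m n S F"
    "\<And>x j. x \<in> S \<Longrightarrow> j < n \<Longrightarrow> F x j = G x j"
  shows "smooth_coord_map m n S G"
  unfolding smooth_coord_map_def
proof (intro allI impI)
  fix j assume "j < n"
  then show "smooth_fun m S (\<lambda>x. G x j)"
    using assms smooth_fun_cong[OF assms(1), of "\<lambda>x. F x j"] by (auto simp: smooth_coord_map_def)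
qed

lemma smooth_coord_map_subset:
  "smooth_coord_map m n S F \<Longrightarrow> T \<subseteq> S \<Longrightarrow> smooth_coord_map m n T F"
  unfolding smooth_coord_map_def using smooth_fun_subset by blast

lemma smooth_coord_map_compose:
  assumes "openin (Euclidean_space m) S" "openin (Euclidean_space n) T"
    "smooth_coord_map m n S F" "F ` S \<subseteq> T" "smooth_coord_map n k T G"
  shows "smooth_coord_map m k S (\<lambda>x. G (F x))"
  unfolding smooth_coord_map_def
proof (intro allI impI)
  fix j assume "j < k"
  then have "smooth_fun n T (\<lambda>x. G x j)" using assms(5) by (simp add: smooth_coord_map_def)
  then show "smooth_fun m S (\<lambda>x. G (F x) j)" by (rule smooth_fun_compose[OF assms(1-4)])
qed

lemma smooth_coord_mapD:
  "smooth_coord_map m n S F \<Longrightarrow> j < n \<Longrightarrow> times_cont_diff k m S (\<lambda>x. F x j)"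
  unfolding smooth_coord_map_def smooth_fun_def by blast

lemma pseudoholomorphic_imp_continuous:
  "pseudoholomorphic M N f \<Longrightarrow> continuous_map (mtop M) (mtop N) f"
  by (simp add: pseudoholomorphic_def smooth_map_def)

lemma pseudoholomorphic_in_mspace:
  "pseudoholomorphic M N f \<Longrightarrow> p \<in> mspace_of M \<Longrightarrow> f p \<in> mspace_of N"
  by (meson continuous_map_image_subset_topspace image_subset_iff pseudoholomorphic_imp_continuous)

lemma pseudoholomorphicI:
  assumes "continuous_map (mtop M) (mtop N) f"
    and "\<And>c c'. c \<in> charts M \<Longrightarrow> c' \<in> charts N \<Longrightarrow>
      smooth_coord_map (mdim M) (mdim N) (cmap M c ` (cdom M c \<inter> f -` cdom N c')) (local_rep M c N c' f)"
    and "\<And>c c' p i j. c \<in> charts M \<Longrightarrow> c' \<in> charts N \<Longrightarrow> p \<in> cdom M c \<Longrightarrow> f p \<in> cdom N c' \<Longrightarrow>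
      i < mdim N \<Longrightarrow> j < mdim M \<Longrightarrow>
      (\<Sum>k<mdim M. differential M c N c' f p i k * acs M c p k j) =
      (\<Sum>k<mdim N. acs N c' (f p) i k * differential M c N c' f p k j)"
  shows "pseudoholomorphic M N f"
  using assms unfolding pseudoholomorphic_def smooth_map_def intertwines_acs_def by auto

lemma pseudoholomorphicD:
  assumes "pseudoholomorphic M N f" "c \<in> charts M" "c' \<in> charts N"
  shows "smooth_coord_map (mdim M) (mdim N) (cmap M c ` (cdom M c \<inter> f -` cdom N c')) (local_rep M c N c' f)"
    and "p \<in> cdom M c \<Longrightarrow> f p \<in> cdom N c' \<Longrightarrow> i < mdim N \<Longrightarrow> j < mdim M \<Longrightarrow>
      (\<Sum>k<mdim M. differential M c N c' f p i k * acs M c p k j) =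
      (\<Sum>k<mdim N. acs N c' (f p) i k * differential M c N c' f p k j)"
  using assms unfolding pseudoholomorphic_def smooth_map_def intertwines_acs_def by auto

lemma differential_eq_local:
  assumes "openin (Euclidean_space (mdim M)) S" "cmap M c p \<in> S" "j < mdim M"
    and "\<And>x. x \<in> S \<Longrightarrow> local_rep M c N c' f x i = F x"
  shows "differential M c N c' f p i j = partial_deriv j F (cmap M c p)"
  unfolding differential_def jacobian_def
  by (rule partial_deriv_cong[OF assms(1-3)]) (rule assms(4))

section \<open>Composition of pseudoholomorphic maps\<close>

context
  fixes L :: "('a, 'i) manifold_data" and M :: "('b, 'j) manifold_data" and N :: "('c, 'k) manifold_data"
    and f :: "'a \<Rightarrow> 'b" and g :: "'b \<Rightarrow> 'c"
  assumes L: "open_atlas L" and M: "open_atlas M" and N: "open_atlas N"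
    and f: "pseudoholomorphic L M f" and g: "pseudoholomorphic M N g"
begin

text \<open>Everything that the chain rule asks for, once charts of all three manifolds are fixed:
  on the points of \<open>c\<close> that go into \<open>c'\<close> and on into \<open>c''\<close>,
  the composite factors through the coordinates of \<open>c'\<close>.\<close>

lemma local_rep_compose:
  assumes c: "c \<in> charts L" "c' \<in> charts M" "c'' \<in> charts N"
  defines "V \<equiv> cdom M c' \<inter> g -` cdom N c''"
  defines "S \<equiv> cmap L c ` (cdom L c \<inter> f -` V)"
  shows "openin (Euclidean_space (mdim L)) S"
    and "openin (Euclidean_space (mdim M)) (cmap M c' ` V)"
    and "smooth_coord_map (mdim L) (mdim M) S (local_rep L c M c' f)"
    and "local_rep L c M c' f ` S \<subseteq> cmap M c' ` V"
    and "smooth_coord_map (mdim M) (mdim N) (cmap M c' ` V) (local_rep M c' N c'' g)"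
    and "\<And>x. x \<in> S \<Longrightarrow> local_rep L c N c'' (\<lambda>x. g (f x)) x = local_rep M c' N c'' g (local_rep L c M c' f x)"
proof -
  have "openin (mtop M) V"
  proof -
    have "openin (mtop M) {x \<in> mspace_of M. g x \<in> cdom N c''}"
      using pseudoholomorphic_imp_continuous[OF g] open_atlasD(1)[OF N c(3)]
      by (rule openin_continuous_map_preimage)
    then have "openin (mtop M) (cdom M c' \<inter> {x \<in> mspace_of M. g x \<in> cdom N c''})"
      using open_atlasD(1)[OF M c(2)] by (rule openin_Int[rotated])
    moreover have "cdom M c' \<inter> {x \<in> mspace_of M. g x \<in> cdom N c''} = V"
      unfolding V_def using open_atlasD(4)[OF M c(2)] by auto
    ultimately show ?thesis by simp
  qed
  then show "openin (Euclidean_space (mdim L)) S"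
    unfolding S_def by (rule openin_chart_image[OF L c(1) pseudoholomorphic_imp_continuous[OF f]])
  show "openin (Euclidean_space (mdim M)) (cmap M c' ` V)"
    unfolding V_def
    by (rule openin_chart_image[OF M c(2) pseudoholomorphic_imp_continuous[OF g] open_atlasD(1)[OF N c(3)]])
  show "smooth_coord_map (mdim L) (mdim M) S (local_rep L c M c' f)"
    by (rule smooth_coord_map_subset[OF pseudoholomorphicD(1)[OF f c(1,2)]]) (auto simp: S_def V_def)
  show "smooth_coord_map (mdim M) (mdim N) (cmap M c' ` V) (local_rep M c' N c'' g)"
    unfolding V_def by (rule pseudoholomorphicD(1)[OF g c(2,3)])
  show "local_rep L c M c' f ` S \<subseteq> cmap M c' ` V"
    unfolding S_def by (auto simp: open_atlasD(6)[OF L c(1)])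
  show "local_rep L c N c'' (\<lambda>x. g (f x)) x = local_rep M c' N c'' g (local_rep L c M c' f x)" if "x \<in> S" for x
    using that unfolding S_def V_def by (auto simp: open_atlasD(6)[OF L c(1)] open_atlasD(6)[OF M c(2)])
qed

lemma differential_compose:
  assumes c: "c \<in> charts L" "c' \<in> charts M" "c'' \<in> charts N"
    and p: "p \<in> cdom L c" "f p \<in> cdom M c'" "g (f p) \<in> cdom N c''" and ij: "i < mdim N" "j < mdim L"
  shows "differential L c N c'' (\<lambda>x. g (f x)) p i j =
    (\<Sum>k<mdim M. differential M c' N c'' g (f p) i k * differential L c M c' f p k j)"
proof -
  note r = local_rep_compose[OF c]
  let ?S = "cmap L c ` (cdom L c \<inter> f -` (cdom M c' \<inter> g -` cdom N c''))"
  have pS: "cmap L c p \<in> ?S" using p by auto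
  have "differential L c N c'' (\<lambda>x. g (f x)) p i j =
      partial_deriv j (\<lambda>x. local_rep M c' N c'' g (local_rep L c M c' f x) i) (cmap L c p)"
    by (rule differential_eq_local[OF r(1) pS ij(2)]) (simp only: r(6))
  also have "\<dots> = (\<Sum>k<mdim M. partial_deriv k (\<lambda>z. local_rep M c' N c'' g z i) (local_rep L c M c' f (cmap L c p)) *
      partial_deriv j (\<lambda>y. local_rep L c M c' f y k) (cmap L c p))"
    by (rule partial_deriv_compose[OF r(1-4) smooth_coord_mapD[OF r(5) ij(1)] pS ij(2)])
  finally show ?thesis
    by (simp add: differential_def jacobian_def open_atlasD(6)[OF L c(1) p(1)])
qed

text \<open>Both conditions can be checked near a point, where a chart of \<open>M\<close> around
  its image is available as an intermediate chart.\<close>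

lemma pseudoholomorphic_compose: "pseudoholomorphic L N (\<lambda>x. g (f x))"
proof (rule pseudoholomorphicI)
  show "continuous_map (mtop L) (mtop N) (\<lambda>x. g (f x))"
    using continuous_map_compose[OF pseudoholomorphic_imp_continuous[OF f] pseudoholomorphic_imp_continuous[OF g]]
    by (simp add: o_def)
next
  fix c c'' assume c: "c \<in> charts L" "c'' \<in> charts N"
  show "smooth_coord_map (mdim L) (mdim N) (cmap L c ` (cdom L c \<inter> (\<lambda>x. g (f x)) -` cdom N c''))
      (local_rep L c N c'' (\<lambda>x. g (f x)))" (is "smooth_coord_map _ _ ?S ?F")
    unfolding smooth_coord_map_def
  proof (intro allI impI smooth_fun_local)
    fix j x assume j: "j < mdim N" and "x \<in> ?S"
    then obtain p where p: "x = cmap L c p" "p \<in> cdom L c" "g (f p) \<in> cdom N c''" by auto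
    have "f p \<in> mspace_of M"
      using pseudoholomorphic_in_mspace[OF f open_atlasD(4)[OF L c(1) p(2)]] .
    then obtain c' where c': "c' \<in> charts M" "f p \<in> cdom M c'" by (rule open_atlas_cover[OF M])
    note r = local_rep_compose[OF c(1) c'(1) c(2)]
    \<comment> \<open>The intermediate chart depends on the point, so smoothness is obtained only on
      a neighbourhood and then glued.\<close>
    have "smooth_coord_map (mdim L) (mdim N) (cmap L c ` (cdom L c \<inter> f -` (cdom M c' \<inter> g -` cdom N c''))) ?F"
      using r(1) smooth_coord_map_compose[OF r(1-5)] by (rule smooth_coord_map_cong) (simp only: r(6))
    then show "\<exists>T. openin (Euclidean_space (mdim L)) T \<and> x \<in> T \<and> T \<subseteq> ?S \<and> smooth_fun (mdim L) T (\<lambda>x. ?F x j)"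
      using r(1) p c' j unfolding smooth_coord_map_def by blast
  qed
next
  fix c c'' p i j
  assume c: "c \<in> charts L" "c'' \<in> charts N" and p: "p \<in> cdom L c" "g (f p) \<in> cdom N c''"
    and ij: "i < mdim N" "j < mdim L"
  have "f p \<in> mspace_of M"
    using pseudoholomorphic_in_mspace[OF f open_atlasD(4)[OF L c(1) p(1)]] .
  then obtain c' where c': "c' \<in> charts M" "f p \<in> cdom M c'" by (rule open_atlas_cover[OF M])
  note D = differential_compose[OF c(1) c'(1) c(2) p(1) c'(2) p(2)]
  let ?A = "differential M c' N c'' g (f p)" and ?B = "differential L c M c' f p"
  let ?J = "acs L c p" and ?J' = "acs M c' (f p)" and ?J'' = "acs N c'' (g (f p))"
  \<comment> \<open>In matrices: Dg Df J = Dg J' Df = J'' Dg Df, with the double sums reassociated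
    at each step.\<close>
  have "(\<Sum>k<mdim L. differential L c N c'' (\<lambda>x. g (f x)) p i k * ?J k j)
      = (\<Sum>k<mdim L. \<Sum>a<mdim M. ?A i a * (?B a k * ?J k j))"
    using ij by (simp add: D sum_distrib_right mult.assoc)
  also have "\<dots> = (\<Sum>a<mdim M. ?A i a * (\<Sum>k<mdim L. ?B a k * ?J k j))"
    by (subst sum.swap) (simp add: sum_distrib_left)
  also have "\<dots> = (\<Sum>a<mdim M. \<Sum>b<mdim M. ?A i a * ?J' a b * ?B b j)"
    by (intro sum.cong refl) (simp add: pseudoholomorphicD(2)[OF f c(1) c'(1) p(1) c'(2) _ ij(2)] sum_distrib_left mult.assoc)
  also have "\<dots> = (\<Sum>b<mdim M. (\<Sum>a<mdim M. ?A i a * ?J' a b) * ?B b j)"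
    by (subst sum.swap) (simp add: sum_distrib_right)
  also have "\<dots> = (\<Sum>b<mdim M. \<Sum>k<mdim N. ?J'' i k * (?A k b * ?B b j))"
    by (intro sum.cong refl) (simp add: pseudoholomorphicD(2)[OF g c'(1) c(2) c'(2) p(2) ij(1)] sum_distrib_right mult.assoc)
  also have "\<dots> = (\<Sum>k<mdim N. ?J'' i k * (\<Sum>b<mdim M. ?A k b * ?B b j))"
    by (subst sum.swap) (simp add: sum_distrib_left)
  also have "\<dots> = (\<Sum>k<mdim N. ?J'' i k * differential L c N c'' (\<lambda>x. g (f x)) p k j)"
    using ij by (simp add: D)
  finally show "(\<Sum>k<mdim L. differential L c N c'' (\<lambda>x. g (f x)) p i k * ?J k j) =
    (\<Sum>k<mdim N. ?J'' i k * differential L c N c'' (\<lambda>x. g (f x)) p k j)" .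
qed

end

text \<open>Maps are total functions, so their values off the manifold must not matter. The
  representatives agree on an open chart image, which determines smoothness and differentials
  there.\<close>

lemma pseudoholomorphic_cong:
  assumes M: "open_atlas M" and N: "open_atlas N"
    and f: "pseudoholomorphic M N f" and eq: "\<And>p. p \<in> mspace_of M \<Longrightarrow> f p = g p"
  shows "pseudoholomorphic M N g"
proof -
  have dom: "cdom M c \<inter> g -` V = cdom M c \<inter> f -` V" if "c \<in> charts M" for c V
    using eq open_atlasD(4)[OF M that] by auto
  have op: "openin (Euclidean_space (mdim M)) (cmap M c ` (cdom M c \<inter> f -` cdom N c'))"
    if "c \<in> charts M" "c' \<in> charts N" for c c'
    using openin_chart_image[OF M that(1) pseudoholomorphic_imp_continuous[OF f] open_atlasD(1)[OF N that(2)]] .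
  have lr: "local_rep M c N c' f x = local_rep M c N c' g x"
    if "x \<in> cmap M c ` (cdom M c \<inter> f -` cdom N c')" "c \<in> charts M" for x c c'
  proof -
    obtain p where "x = cmap M c p" "p \<in> cdom M c" using \<open>x \<in> _\<close> by blast
    then show ?thesis using eq[OF open_atlasD(4)[OF M that(2)]] by (simp add: open_atlasD(6)[OF M that(2)])
  qed
  show ?thesis
  proof (rule pseudoholomorphicI)
    show "continuous_map (mtop M) (mtop N) g"
      by (rule continuous_map_eq[OF pseudoholomorphic_imp_continuous[OF f] eq])
    show "smooth_coord_map (mdim M) (mdim N) (cmap M c ` (cdom M c \<inter> g -` cdom N c')) (local_rep M c N c' g)"
      if "c \<in> charts M" "c' \<in> charts N" for c c'
      unfolding dom[OF that(1)] using op[OF that] pseudoholomorphicD(1)[OF f that]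
      by (rule smooth_coord_map_cong) (simp add: lr that)
    fix c c' p i j assume a: "c \<in> charts M" "c' \<in> charts N" "p \<in> cdom M c" "g p \<in> cdom N c'" "i < mdim N" "j < mdim M"
    have gp: "g p = f p" using eq open_atlasD(4)[OF M a(1,3)] by simp
    have "differential M c N c' g p i j = differential M c N c' f p i j" if "j < mdim M" for i j
      unfolding differential_def jacobian_def
      by (rule partial_deriv_cong[OF op[OF a(1,2)] _ that]) (use a gp lr in auto)
    then show "(\<Sum>k<mdim M. differential M c N c' g p i k * acs M c p k j) =
       (\<Sum>k<mdim N. acs N c' (g p) i k * differential M c N c' g p k j)"
      using pseudoholomorphicD(2)[OF f a(1,2,3) _ a(5,6)] a(4,6) gp by simp
  qed
qed

text \<open>A chart is a homeomorphism onto an open set and therefore an open map into coordinate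
  space. The identity is smooth by smoothness of the transition maps and intertwines J by the
  transformation law in \<open>almost_complex_structure\<close>.\<close>

lemma compatible_symplectic_manifold_imp_ac_manifold:
  assumes "compatible_symplectic_manifold M"
  shows "ac_manifold M"
proof -
  have sm: "smooth_manifold M" and ac: "intertwines_acs M M (\<lambda>p. p)"
    using assms by (auto simp: compatible_symplectic_manifold_def almost_complex_structure_def)
  have "openin (mtop M) (cdom M c) \<and> inj_on (cmap M c) (cdom M c) \<and>
        (\<forall>U. openin (mtop M) U \<longrightarrow> openin (Euclidean_space (mdim M)) (cmap M c ` (cdom M c \<inter> U)))"
    if c: "c \<in> charts M" for c
  proof -
    have o: "openin (mtop M) (cdom M c)" "openin (Euclidean_space (mdim M)) (cmap M c ` cdom M c)"
      and h: "homeomorphic_map (subtopology (mtop M) (cdom M c))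
          (subtopology (Euclidean_space (mdim M)) (cmap M c ` cdom M c)) (cmap M c)"
      using sm c by (auto simp: smooth_manifold_def)
    have ts: "topspace (subtopology (mtop M) (cdom M c)) = cdom M c" using openin_subset[OF o(1)] by auto
    have "openin (Euclidean_space (mdim M)) (cmap M c ` (cdom M c \<inter> U))" if "openin (mtop M) U" for U
    proof -
      have "openin (subtopology (mtop M) (cdom M c)) (cdom M c \<inter> U)"
        using that by (auto simp: openin_subtopology)
      then have "openin (subtopology (Euclidean_space (mdim M)) (cmap M c ` cdom M c)) (cmap M c ` (cdom M c \<inter> U))"
        using homeomorphic_imp_open_map[OF h] unfolding open_map_def by blast
      then show ?thesis using o(2) by (rule openin_trans_full)
    qed
    moreover have "inj_on (cmap M c) (cdom M c)"
      using h ts unfolding homeomorphic_map_def by simp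
    ultimately show ?thesis using o by blast
  qed
  then have "open_atlas M" using sm unfolding open_atlas_def smooth_manifold_def by blast
  moreover have "smooth_map M M (\<lambda>p. p)" using sm unfolding smooth_manifold_def smooth_map_def by (auto simp: vimage_def Int_def)
  ultimately show ?thesis using ac by (simp add: ac_manifold_def pseudoholomorphic_def)
qed

lemma ac_manifold_imp_open_atlas [simp]: "ac_manifold M \<Longrightarrow> open_atlas M"
  by (simp add: ac_manifold_def)

lemma pseudoholomorphic_id: "ac_manifold M \<Longrightarrow> pseudoholomorphic M M (\<lambda>p. p)"
  by (simp add: ac_manifold_def)

lemma pseudoholomorphic_const:
  assumes N: "open_atlas N" and q: "q \<in> mspace_of N"
  shows "pseudoholomorphic M N (\<lambda>_. q)"
proof (rule pseudoholomorphicI)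
  have lr: "local_rep M c N c' (\<lambda>_. q) = (\<lambda>_. cmap N c' q)" for c c' by (simp add: local_rep_def fun_eq_iff)
  show "smooth_coord_map (mdim M) (mdim N) (cmap M c ` (cdom M c \<inter> (\<lambda>_. q) -` cdom N c')) (local_rep M c N c' (\<lambda>_. q))" for c c'
    unfolding smooth_coord_map_def lr by (intro allI impI smooth_fun_const)
  have "differential M c N c' (\<lambda>_. q) p i j = 0" for c c' p i j
    unfolding differential_def jacobian_def partial_deriv_def lr by simp
  then show "(\<Sum>k<mdim M. differential M c N c' (\<lambda>_. q) p i k * acs M c p k j) =
      (\<Sum>k<mdim N. acs N c' q i k * differential M c N c' (\<lambda>_. q) p k j)" for c c' p i j by simp
qed (use q in simp)

subsection \<open>Open submanifolds\<close>

lemma open_submanifold_sel [simp]: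
  "mtop (open_submanifold M U) = subtopology (mtop M) U" "mdim (open_submanifold M U) = mdim M"
  "charts (open_submanifold M U) = charts M" "cdom (open_submanifold M U) c = cdom M c \<inter> U"
  "cmap (open_submanifold M U) = cmap M" "acs (open_submanifold M U) = acs M"
  by (simp_all add: open_submanifold_def)

lemma open_atlas_open_submanifold:
  assumes M: "open_atlas M" and U: "openin (mtop M) U"
  shows "open_atlas (open_submanifold M U)"
proof -
  have "openin (Euclidean_space (mdim M)) (cmap M c ` (cdom M c \<inter> U \<inter> V))"
    if "c \<in> charts M" "openin (subtopology (mtop M) U) V" for c V
    using that open_atlasD(3)[OF M, of c "U \<inter> V"] U openin_trans_full[OF that(2) U]
    by (metis Int_assoc openin_Int)
  moreover have "(\<Union>c\<in>charts M. cdom M c \<inter> U) = mspace_of M \<inter> U"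
    using M unfolding open_atlas_def by blast
  moreover have "openin (subtopology (mtop M) U) (cdom M c \<inter> U)" "inj_on (cmap M c) (cdom M c \<inter> U)"
    if "c \<in> charts M" for c
    using open_atlasD(1,2)[OF M that] by (auto simp: openin_subtopology inj_on_Int)
  ultimately show ?thesis unfolding open_atlas_def by simp
qed

text \<open>The inverse chart of the submanifold is taken on a smaller domain, so the old and new
  representatives are guaranteed to agree only on the smaller chart image; that image is open, which
  suffices.\<close>

lemma pseudoholomorphic_restrict:
  assumes M: "open_atlas M" and N: "open_atlas N" and U: "openin (mtop M) U"
    and f: "pseudoholomorphic M N f"
  shows "pseudoholomorphic (open_submanifold M U) N f"
proof -
  let ?M = "open_submanifold M U"
  note MU = open_atlas_open_submanifold[OF M U]
  have cf: "continuous_map (mtop ?M) (mtop N) f"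
    using pseudoholomorphic_imp_continuous[OF f] by (simp add: continuous_map_from_subtopology)
  have op: "openin (Euclidean_space (mdim M)) (cmap M c ` (cdom M c \<inter> U \<inter> f -` cdom N c'))"
    if "c \<in> charts M" "c' \<in> charts N" for c c'
    using openin_chart_image[OF MU _ cf open_atlasD(1)[OF N that(2)]] that(1) by simp
  have lr: "local_rep ?M c N c' f x = local_rep M c N c' f x"
    if "x \<in> cmap M c ` (cdom M c \<inter> U \<inter> f -` cdom N c')" "c \<in> charts M" for x c c'
  proof -
    obtain p where "x = cmap M c p" "p \<in> cdom M c" "p \<in> U" using \<open>x \<in> _\<close> by blast
    then show ?thesis using that(2)
      by (simp add: open_atlasD(6)[OF M that(2)] open_atlasD(6)[OF MU, unfolded open_submanifold_sel, of c p])
  qed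
  show ?thesis
  proof (rule pseudoholomorphicI[OF cf])
    show "smooth_coord_map (mdim ?M) (mdim N) (cmap ?M c ` (cdom ?M c \<inter> f -` cdom N c')) (local_rep ?M c N c' f)"
      if "c \<in> charts ?M" "c' \<in> charts N" for c c'
    proof -
      have c: "c \<in> charts M" using that(1) by simp
      have "smooth_coord_map (mdim M) (mdim N) (cmap M c ` (cdom M c \<inter> U \<inter> f -` cdom N c')) (local_rep M c N c' f)"
        by (rule smooth_coord_map_subset[OF pseudoholomorphicD(1)[OF f c that(2)]]) blast
      with op[OF c that(2)] show ?thesis
        unfolding open_submanifold_sel by (rule smooth_coord_map_cong) (simp only: lr[OF _ c])
    qed
    fix c c' p i j assume a: "c \<in> charts ?M" "c' \<in> charts N" "p \<in> cdom ?M c" "f p \<in> cdom N c'" "i < mdim N" "j < mdim ?M"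
    then have c: "c \<in> charts M" by simp
    have "cmap M c p \<in> cmap M c ` (cdom M c \<inter> U \<inter> f -` cdom N c')" using a by simp
    then have "differential ?M c N c' f p i j = differential M c N c' f p i j" if "j < mdim M" for i j
      unfolding differential_def jacobian_def open_submanifold_sel
      by (rule partial_deriv_cong[OF op[OF c a(2)] _ that]) (simp only: lr[OF _ c])
    then show "(\<Sum>k<mdim ?M. differential ?M c N c' f p i k * acs ?M c p k j) =
       (\<Sum>k<mdim N. acs N c' (f p) i k * differential ?M c N c' f p k j)"
      using pseudoholomorphicD(2)[OF f _ a(2) _ a(4,5)] a by simp
  qed
qed

lemma pseudoholomorphic_into_open_submanifold:
  assumes f: "pseudoholomorphic M N f" and U: "\<And>p. p \<in> mspace_of M \<Longrightarrow> f p \<in> U"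
  shows "pseudoholomorphic M (open_submanifold N U) f"
proof -
  let ?N = "open_submanifold N U"
  have lr: "local_rep M c ?N c' f = local_rep M c N c' f" for c c'
    by (simp add: local_rep_def fun_eq_iff)
  show ?thesis
  proof (rule pseudoholomorphicI)
    show "continuous_map (mtop M) (mtop ?N) f"
      using pseudoholomorphic_imp_continuous[OF f] U by (auto simp: continuous_map_in_subtopology)
    show "smooth_coord_map (mdim M) (mdim ?N) (cmap M c ` (cdom M c \<inter> f -` cdom ?N c')) (local_rep M c ?N c' f)"
      if "c \<in> charts M" "c' \<in> charts ?N" for c c'
      unfolding lr open_submanifold_sel
      by (rule smooth_coord_map_subset[OF pseudoholomorphicD(1)[OF f]]) (use that in auto)
    show "(\<Sum>k<mdim M. differential M c ?N c' f p i k * acs M c p k j) =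
       (\<Sum>k<mdim ?N. acs ?N c' (f p) i k * differential M c ?N c' f p k j)"
      if "c \<in> charts M" "c' \<in> charts ?N" "p \<in> cdom M c" "f p \<in> cdom ?N c'" "i < mdim ?N" "j < mdim M" for c c' p i j
      using pseudoholomorphicD(2)[OF f, of c c' p i j] that by (simp add: differential_def lr)
  qed
qed

subsection \<open>Products\<close>

lemma prod_manifold_sel [simp]:
  "mtop (M \<times>\<^sub>m N) = prod_topology (mtop M) (mtop N)" "mdim (M \<times>\<^sub>m N) = mdim M + mdim N"
  "charts (M \<times>\<^sub>m N) = charts M \<times> charts N" "cdom (M \<times>\<^sub>m N) (c, d) = cdom M c \<times> cdom N d"
  "cmap (M \<times>\<^sub>m N) (c, d) pq i =
     (if i < mdim M then cmap M c (fst pq) i else cmap N d (snd pq) (i - mdim M))"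
  "acs (M \<times>\<^sub>m N) (c, d) pq = block_diag (mdim M) (acs M c (fst pq)) (acs N d (snd pq))"
  by (simp_all add: prod_manifold_def split_beta)

lemma sum_lessThan_add_split:
  fixes f :: "nat \<Rightarrow> real"
  shows "(\<Sum>k<m + n. f k) = (\<Sum>k<m. f k) + (\<Sum>k<n. f (m + k))"
  by (induction n) simp_all

text \<open>The cut to zero puts the result into \<open>Euclidean_space m\<close>. The shifted
  function \<open>last_coords\<close> needs no cut, as points of
  \<open>Euclidean_space (m + n)\<close> vanish from \<open>m + n\<close> on.\<close>

definition first_coords :: "nat \<Rightarrow> (nat \<Rightarrow> real) \<Rightarrow> nat \<Rightarrow> real" where
  "first_coords m x = (\<lambda>i. if i < m then x i else 0)"

definition last_coords :: "nat \<Rightarrow> (nat \<Rightarrow> real) \<Rightarrow> nat \<Rightarrow> real" where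
  "last_coords m x = (\<lambda>i. x (m + i))"

lemma continuous_map_first_coords:
  "continuous_map (Euclidean_space (m + n)) (Euclidean_space m) (first_coords m)"
  by (rule continuous_map_into_Euclidean_space)
     (simp_all add: first_coords_def continuous_map_Euclidean_space_coordinate)

lemma continuous_map_last_coords:
  "continuous_map (Euclidean_space (m + n)) (Euclidean_space n) (last_coords m)"
  by (rule continuous_map_into_Euclidean_space)
     (simp_all add: last_coords_def continuous_map_Euclidean_space_coordinate topspace_Euclidean_space)

lemma coords_prod_chart:
  assumes M: "open_atlas M" and N: "open_atlas N" and "c \<in> charts M" "d \<in> charts N" "p \<in> cdom M c" "q \<in> cdom N d"
  shows "first_coords (mdim M) (cmap (M \<times>\<^sub>m N) (c, d) (p, q)) = cmap M c p"
    and "last_coords (mdim M) (cmap (M \<times>\<^sub>m N) (c, d) (p, q)) = cmap N d q"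
  using cmap_in_Euclidean_space[OF M] assms
  by (auto simp: first_coords_def last_coords_def fun_eq_iff topspace_Euclidean_space)

text \<open>Presents the image of a box as an intersection of two preimages under continuous
  coordinate projections, which makes its openness immediate.\<close>

lemma prod_chart_image:
  assumes M: "open_atlas M" and N: "open_atlas N" and c: "c \<in> charts M" "d \<in> charts N"
    and UV: "U \<subseteq> cdom M c" "V \<subseteq> cdom N d"
  shows "cmap (M \<times>\<^sub>m N) (c, d) ` (U \<times> V) =
    {x \<in> topspace (Euclidean_space (mdim M + mdim N)). first_coords (mdim M) x \<in> cmap M c ` U} \<inter>
    {x \<in> topspace (Euclidean_space (mdim M + mdim N)). last_coords (mdim M) x \<in> cmap N d ` V}"
proof (intro subset_antisym subsetI)
  fix x assume "x \<in> cmap (M \<times>\<^sub>m N) (c, d) ` (U \<times> V)"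
  then obtain p q where pq: "p \<in> U" "q \<in> V" "x = cmap (M \<times>\<^sub>m N) (c, d) (p, q)" by auto
  then have "p \<in> cdom M c" "q \<in> cdom N d" using UV by auto
  moreover from this have "x \<in> topspace (Euclidean_space (mdim M + mdim N))"
    using cmap_in_Euclidean_space[OF N c(2)] pq(3) by (auto simp: topspace_Euclidean_space)
  ultimately show "x \<in> {x \<in> topspace (Euclidean_space (mdim M + mdim N)). first_coords (mdim M) x \<in> cmap M c ` U} \<inter>
    {x \<in> topspace (Euclidean_space (mdim M + mdim N)). last_coords (mdim M) x \<in> cmap N d ` V}"
    using coords_prod_chart[OF M N c] pq by auto
next
  fix x assume "x \<in> {x \<in> topspace (Euclidean_space (mdim M + mdim N)). first_coords (mdim M) x \<in> cmap M c ` U} \<inter>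
    {x \<in> topspace (Euclidean_space (mdim M + mdim N)). last_coords (mdim M) x \<in> cmap N d ` V}"
  then obtain p q where pq: "p \<in> U" "q \<in> V" "first_coords (mdim M) x = cmap M c p" "last_coords (mdim M) x = cmap N d q"
    by auto
  have "x i = cmap (M \<times>\<^sub>m N) (c, d) (p, q) i" for i
    using fun_cong[OF pq(3), of i] fun_cong[OF pq(4), of "i - mdim M"]
    by (auto simp: first_coords_def last_coords_def)
  then have "x = cmap (M \<times>\<^sub>m N) (c, d) (p, q)" by blast
  then show "x \<in> cmap (M \<times>\<^sub>m N) (c, d) ` (U \<times> V)" using pq by blast
qed

lemma open_atlas_prod:
  assumes M: "open_atlas M" and N: "open_atlas N"
  shows "open_atlas (M \<times>\<^sub>m N)"
  unfolding open_atlas_def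
proof (intro conjI ballI allI impI)
  show "(\<Union>c\<in>charts (M \<times>\<^sub>m N). cdom (M \<times>\<^sub>m N) c) = mspace_of (M \<times>\<^sub>m N)"
    using M N by (fastforce simp: open_atlas_def)
  fix e assume "e \<in> charts (M \<times>\<^sub>m N)"
  then obtain c d where e: "e = (c, d)" and c: "c \<in> charts M" and d: "d \<in> charts N" by auto
  show "openin (mtop (M \<times>\<^sub>m N)) (cdom (M \<times>\<^sub>m N) e)"
    using open_atlasD(1)[OF M c] open_atlasD(1)[OF N d] by (simp add: e openin_prod_Times_iff)
  show "inj_on (cmap (M \<times>\<^sub>m N) e) (cdom (M \<times>\<^sub>m N) e)"
  proof (rule inj_onI)
    fix x y assume a: "x \<in> cdom (M \<times>\<^sub>m N) e" "y \<in> cdom (M \<times>\<^sub>m N) e" "cmap (M \<times>\<^sub>m N) e x = cmap (M \<times>\<^sub>m N) e y"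
    then have "cmap M c (fst x) = cmap M c (fst y)" "cmap N d (snd x) = cmap N d (snd y)"
      using coords_prod_chart[OF M N c d, of "fst x" "snd x"] coords_prod_chart[OF M N c d, of "fst y" "snd y"]
      by (auto simp: e)
    then show "x = y"
      using a open_atlasD(2)[OF M c] open_atlasD(2)[OF N d] unfolding inj_on_def
      by (auto simp: e mem_Times_iff prod_eq_iff)
  qed
  fix W assume W: "openin (mtop (M \<times>\<^sub>m N)) W"
  show "openin (Euclidean_space (mdim (M \<times>\<^sub>m N))) (cmap (M \<times>\<^sub>m N) e ` (cdom (M \<times>\<^sub>m N) e \<inter> W))"
  proof (subst openin_subopen, intro ballI)
    fix x assume "x \<in> cmap (M \<times>\<^sub>m N) e ` (cdom (M \<times>\<^sub>m N) e \<inter> W)"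
    then obtain p q where pq: "p \<in> cdom M c" "q \<in> cdom N d" "(p, q) \<in> W" and x: "x = cmap (M \<times>\<^sub>m N) (c, d) (p, q)"
      by (auto simp: e)
    \<comment> \<open>A general open set of the product is no box, so the image is shown to contain
      an open box image around each of its points.\<close>
    obtain U V where UV: "openin (mtop M) U" "openin (mtop N) V" "p \<in> U" "q \<in> V" "U \<times> V \<subseteq> W"
      using W[unfolded prod_manifold_sel openin_prod_topology_alt, rule_format, OF pq(3)] by metis
    let ?I = "cmap (M \<times>\<^sub>m N) (c, d) ` ((cdom M c \<inter> U) \<times> (cdom N d \<inter> V))"
    have "openin (Euclidean_space (mdim M + mdim N)) ?I"
      unfolding prod_chart_image[OF M N c d Int_lower1 Int_lower1]
      using open_atlasD(3)[OF M c UV(1)] open_atlasD(3)[OF N d UV(2)]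
      by (intro openin_Int openin_continuous_map_preimage[OF continuous_map_first_coords]
          openin_continuous_map_preimage[OF continuous_map_last_coords])
    moreover have "x \<in> ?I" unfolding x by (rule imageI) (use pq UV in simp)
    moreover have "?I \<subseteq> cmap (M \<times>\<^sub>m N) e ` (cdom (M \<times>\<^sub>m N) e \<inter> W)"
      unfolding e using UV(5) by (intro image_mono) auto
    ultimately show "\<exists>T. openin (Euclidean_space (mdim (M \<times>\<^sub>m N))) T \<and> x \<in> T \<and>
        T \<subseteq> cmap (M \<times>\<^sub>m N) e ` (cdom (M \<times>\<^sub>m N) e \<inter> W)"
      by auto
  qed
qed

text \<open>The differential of the pair stacks the two differentials and J of the product is block
  diagonal, so the equation splits by rows into those for \<open>f\<close> and
  \<open>g\<close>.\<close>

lemma pseudoholomorphic_pair: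
  assumes f: "pseudoholomorphic L M f" and g: "pseudoholomorphic L N g"
  shows "pseudoholomorphic L (M \<times>\<^sub>m N) (\<lambda>x. (f x, g x))"
proof -
  let ?h = "\<lambda>x. (f x, g x)"
  have lr: "local_rep L c (M \<times>\<^sub>m N) (c', d') ?h x i =
     (if i < mdim M then local_rep L c M c' f x i else local_rep L c N d' g x (i - mdim M))" for c c' d' x i
    by (simp add: local_rep_def)
  show ?thesis
  proof (rule pseudoholomorphicI)
    show "continuous_map (mtop L) (mtop (M \<times>\<^sub>m N)) ?h"
      using f g by (simp add: continuous_map_paired pseudoholomorphic_imp_continuous)
    fix c e assume "c \<in> charts L" "e \<in> charts (M \<times>\<^sub>m N)"
    then obtain c' d' where c: "c \<in> charts L" "c' \<in> charts M" "d' \<in> charts N" "e = (c', d')" by auto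
    show "smooth_coord_map (mdim L) (mdim (M \<times>\<^sub>m N)) (cmap L c ` (cdom L c \<inter> ?h -` cdom (M \<times>\<^sub>m N) e)) (local_rep L c (M \<times>\<^sub>m N) e ?h)"
      unfolding smooth_coord_map_def
    proof (intro allI impI)
      let ?S = "cmap L c ` (cdom L c \<inter> ?h -` cdom (M \<times>\<^sub>m N) e)"
      fix j assume "j < mdim (M \<times>\<^sub>m N)"
      then have j: "j < mdim M + mdim N" by simp
      show "smooth_fun (mdim L) ?S (\<lambda>x. local_rep L c (M \<times>\<^sub>m N) e ?h x j)"
      proof (cases "j < mdim M")
        case True
        have "smooth_coord_map (mdim L) (mdim M) ?S (local_rep L c M c' f)"
          by (rule smooth_coord_map_subset[OF pseudoholomorphicD(1)[OF f c(1,2)]]) (auto simp: c(4))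
        with True show ?thesis by (simp add: c(4) lr smooth_coord_map_def)
      next
        case False
        have "smooth_coord_map (mdim L) (mdim N) ?S (local_rep L c N d' g)"
          by (rule smooth_coord_map_subset[OF pseudoholomorphicD(1)[OF g c(1,3)]]) (auto simp: c(4))
        with False j show ?thesis by (simp add: c(4) lr smooth_coord_map_def)
      qed
    qed
    fix p i j assume p: "p \<in> cdom L c" "?h p \<in> cdom (M \<times>\<^sub>m N) e" and ij: "i < mdim (M \<times>\<^sub>m N)" "j < mdim L"
    have D: "differential L c (M \<times>\<^sub>m N) (c', d') ?h p i j =
       (if i < mdim M then differential L c M c' f p i j else differential L c N d' g p (i - mdim M) j)" for i j
      by (simp add: differential_def jacobian_def lr)
    have m: "\<not> mdim M + k < mdim M" for k by simp
    show "(\<Sum>k<mdim L. differential L c (M \<times>\<^sub>m N) e ?h p i k * acs L c p k j) =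
      (\<Sum>k<mdim (M \<times>\<^sub>m N). acs (M \<times>\<^sub>m N) e (?h p) i k * differential L c (M \<times>\<^sub>m N) e ?h p k j)"
    proof (cases "i < mdim M")
      case True
      then show ?thesis
        using pseudoholomorphicD(2)[OF f c(1,2) p(1) _ True ij(2)] p(2)
        by (simp add: D sum_lessThan_add_split block_diag_def c(4))
    next
      case False
      then have "i - mdim M < mdim N" using ij by simp
      then show ?thesis
        using pseudoholomorphicD(2)[OF g c(1,3) p(1) _ _ ij(2), of "i - mdim M"] p(2) False
        by (simp add: D sum_lessThan_add_split block_diag_def c(4))
    qed
  qed
qed

lemma sum_window:
  fixes f :: "nat \<Rightarrow> real"
  assumes "a + m \<le> n"
  shows "(\<Sum>k<n. if a \<le> k \<and> k < a + m then f k else 0) = (\<Sum>l<m. f (a + l))"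
proof -
  have "(\<Sum>k<n. if a \<le> k \<and> k < a + m then f k else 0) = sum f {k \<in> {..<n}. a \<le> k \<and> k < a + m}"
    by (rule sum.inter_filter[symmetric]) simp
  also have "\<dots> = (\<Sum>l<m. f (a + l))"
    by (rule sum.reindex_bij_witness[of _ "\<lambda>l. a + l" "\<lambda>k. k - a"]) (use assms in auto)
  finally show ?thesis .
qed

text \<open>Covers the projections of a product and the identification of \<open>as_list_manifold N\<close>
  with \<open>N\<close>: in suitable charts the map is a projection to consecutive coordinates.\<close>

lemma pseudoholomorphic_coordinate_projection:
  assumes L: "open_atlas L" and M: "ac_manifold M"
    and cont: "continuous_map (mtop L) (mtop M) f"
    and \<kappa>: "\<And>c. c \<in> charts L \<Longrightarrow> \<kappa> c \<in> charts M"
    and dom: "\<And>c p. c \<in> charts L \<Longrightarrow> p \<in> cdom L c \<Longrightarrow> f p \<in> cdom M (\<kappa> c)"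
    and coords: "\<And>c p l. c \<in> charts L \<Longrightarrow> p \<in> cdom L c \<Longrightarrow> l < mdim M \<Longrightarrow>
      cmap M (\<kappa> c) (f p) l = cmap L c p (a + l)"
    and dim: "a + mdim M \<le> mdim L"
    and acs: "\<And>c p l j. c \<in> charts L \<Longrightarrow> p \<in> cdom L c \<Longrightarrow> l < mdim M \<Longrightarrow> j < mdim L \<Longrightarrow>
      acs L c p (a + l) j = (if a \<le> j \<and> j < a + mdim M then acs M (\<kappa> c) (f p) l (j - a) else 0)"
  shows "pseudoholomorphic L M f"
proof -
  have oM: "open_atlas M" using M by simp
  note id = pseudoholomorphic_id[OF M]
  \<comment> \<open>The linear projection to the window of coordinates from \<open>a\<close> to
    \<open>a + mdim M\<close>; in the charts \<open>c\<close> and \<open>\<kappa> c\<close> the map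
    \<open>f\<close> is exactly this.\<close>
  define P where "P x = (\<lambda>l. if l < mdim M then x (a + l) else 0)" for x :: "nat \<Rightarrow> real"
  define S where "S c c' = cmap L c ` (cdom L c \<inter> f -` cdom M c')" for c c'
  define T where "T c c' = cmap M (\<kappa> c) ` (cdom M (\<kappa> c) \<inter> cdom M c')" for c c'
  have P: "P (cmap L c p) = cmap M (\<kappa> c) (f p)" if "c \<in> charts L" "p \<in> cdom L c" for c p
    using coords[OF that] cmap_in_Euclidean_space[OF oM \<kappa>[OF that(1)] dom[OF that]]
    by (auto simp: P_def fun_eq_iff topspace_Euclidean_space)
  have S: "openin (Euclidean_space (mdim L)) (S c c')" if "c \<in> charts L" "c' \<in> charts M" for c c'
    unfolding S_def by (rule openin_chart_image[OF L that(1) cont open_atlasD(1)[OF oM that(2)]])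
  have T: "openin (Euclidean_space (mdim M)) (T c c')" if "c \<in> charts L" "c' \<in> charts M" for c c'
    unfolding T_def by (rule open_atlasD(3)[OF oM \<kappa>[OF that(1)] open_atlasD(1)[OF oM that(2)]])
  have sP: "smooth_coord_map (mdim L) (mdim M) (S c c') P" if "c \<in> charts L" "c' \<in> charts M" for c c'
    using smooth_fun_coordinate[OF S[OF that]] by (simp add: smooth_coord_map_def P_def)
  have PS: "P ` S c c' \<subseteq> T c c'" if "c \<in> charts L" for c c'
    unfolding S_def T_def using P[OF that] dom[OF that] by auto
  have sid: "smooth_coord_map (mdim M) (mdim M) (T c c') (local_rep M (\<kappa> c) M c' (\<lambda>p. p))"
    if "c \<in> charts L" "c' \<in> charts M" for c c'
    using pseudoholomorphicD(1)[OF id \<kappa>[OF that(1)] that(2)] by (simp add: T_def vimage_def)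
  \<comment> \<open>For an arbitrary target chart, \<open>f\<close> is the projection followed by a
    transition map of \<open>M\<close>, so smoothness and intertwining are inherited from the
    identity of \<open>M\<close>.\<close>
  have lr: "local_rep L c M c' f x = local_rep M (\<kappa> c) M c' (\<lambda>p. p) (P x)"
    if c: "c \<in> charts L" and x: "x \<in> S c c'" for c c' x
  proof -
    obtain p where p: "x = cmap L c p" "p \<in> cdom L c" using x by (auto simp: S_def)
    then show ?thesis
      by (simp add: P[OF c] open_atlasD(6)[OF L c] open_atlasD(6)[OF oM \<kappa>[OF c] dom[OF c]])
  qed
  show ?thesis
  proof (rule pseudoholomorphicI[OF cont])
    fix c c' assume c: "c \<in> charts L" "c' \<in> charts M"
    show "smooth_coord_map (mdim L) (mdim M) (cmap L c ` (cdom L c \<inter> f -` cdom M c')) (local_rep L c M c' f)"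
      unfolding S_def[symmetric]
      using S[OF c] smooth_coord_map_compose[OF S[OF c] T[OF c] sP[OF c] PS[OF c(1)] sid[OF c]]
      by (rule smooth_coord_map_cong) (simp only: lr[OF c(1)])
    fix p i j assume p: "p \<in> cdom L c" "f p \<in> cdom M c'" and ij: "i < mdim M" "j < mdim L"
    let ?D = "differential M (\<kappa> c) M c' (\<lambda>p. p) (f p)"
    have xS: "cmap L c p \<in> S c c'" unfolding S_def using p by blast
    \<comment> \<open>The columns outside the window vanish, and those inside are columns of the
      differential of the transition map.\<close>
    have D: "differential L c M c' f p i j = (if a \<le> j \<and> j < a + mdim M then ?D i (j - a) else 0)"
      if ij: "i < mdim M" "j < mdim L" for i j
    proof -
      have "differential L c M c' f p i j = partial_deriv j (\<lambda>x. local_rep M (\<kappa> c) M c' (\<lambda>p. p) (P x) i) (cmap L c p)"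
        by (rule differential_eq_local[OF S[OF c] xS ij(2)]) (simp only: lr[OF c(1)])
      also have "\<dots> = (\<Sum>l<mdim M. partial_deriv l (\<lambda>z. local_rep M (\<kappa> c) M c' (\<lambda>p. p) z i) (P (cmap L c p)) *
          partial_deriv j (\<lambda>y. P y l) (cmap L c p))"
        by (rule partial_deriv_compose[OF S[OF c] T[OF c] sP[OF c] PS[OF c(1)] smooth_coord_mapD[OF sid[OF c] ij(1)] xS ij(2)])
      also have "\<dots> = (\<Sum>l<mdim M. if a \<le> j \<and> l = j - a then ?D i l else 0)"
        by (intro sum.cong refl)
           (auto simp: P_def partial_deriv_coordinate differential_def jacobian_def P[OF c(1) p(1), unfolded P_def])
      also have "\<dots> = (if a \<le> j \<and> j < a + mdim M then ?D i (j - a) else 0)"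
        by (cases "a \<le> j") auto
      finally show ?thesis .
    qed
    define b where "b \<longleftrightarrow> a \<le> j \<and> j < a + mdim M"
    have Db: "differential L c M c' f p k j = (if b then ?D k (j - a) else 0)" if "k < mdim M" for k
      unfolding b_def by (rule D[OF that ij(2)])
    \<comment> \<open>The rows of J in the window have no entries outside it, so the whole product
      of matrices reduces to one on \<open>M\<close>.\<close>
    have acsb: "acs L c p (a + l) j = (if b then acs M (\<kappa> c) (f p) l (j - a) else 0)" if "l < mdim M" for l
      unfolding b_def by (rule acs[OF c(1) p(1) that ij(2)])
    have "(\<Sum>k<mdim L. differential L c M c' f p i k * acs L c p k j) =
        (\<Sum>k<mdim L. if a \<le> k \<and> k < a + mdim M then ?D i (k - a) * acs L c p k j else 0)"
      by (intro sum.cong refl) (simp add: D ij)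
    also have "\<dots> = (\<Sum>l<mdim M. ?D i l * acs L c p (a + l) j)"
      by (subst sum_window[OF dim]) simp
    also have "\<dots> = (if b then (\<Sum>l<mdim M. ?D i l * acs M (\<kappa> c) (f p) l (j - a)) else 0)"
      by (cases b) (simp_all add: acsb)
    also have "\<dots> = (if b then (\<Sum>k<mdim M. acs M c' (f p) i k * ?D k (j - a)) else 0)"
      using pseudoholomorphicD(2)[OF id \<kappa>[OF c(1)] c(2) dom[OF c(1) p(1)] p(2) ij(1), of "j - a"]
      by (auto simp: b_def)
    also have "\<dots> = (\<Sum>k<mdim M. acs M c' (f p) i k * differential L c M c' f p k j)"
      by (cases b) (simp_all add: Db)
    finally show "(\<Sum>k<mdim L. differential L c M c' f p i k * acs L c p k j) =
      (\<Sum>k<mdim M. acs M c' (f p) i k * differential L c M c' f p k j)" .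
  qed
qed

lemma pseudoholomorphic_fst:
  assumes M: "ac_manifold M" and N: "open_atlas N"
  shows "pseudoholomorphic (M \<times>\<^sub>m N) M fst"
  by (rule pseudoholomorphic_coordinate_projection[OF open_atlas_prod[OF _ N] M, where \<kappa> = fst and a = 0])
     (use M in \<open>auto simp: continuous_map_fst block_diag_def\<close>)

lemma pseudoholomorphic_snd:
  assumes M: "open_atlas M" and N: "ac_manifold N"
  shows "pseudoholomorphic (M \<times>\<^sub>m N) N snd"
  by (rule pseudoholomorphic_coordinate_projection[OF open_atlas_prod[OF M] N, where \<kappa> = snd and a = "mdim M"])
     (use N in \<open>auto simp: continuous_map_snd block_diag_def\<close>)

lemma ac_manifold_prod:
  assumes M: "ac_manifold M" and N: "ac_manifold N"
  shows "ac_manifold (M \<times>\<^sub>m N)"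
proof -
  have o: "open_atlas M" "open_atlas N" using M N by simp_all
  show ?thesis
    unfolding ac_manifold_def
    using pseudoholomorphic_pair[OF pseudoholomorphic_fst[OF M o(2)] pseudoholomorphic_snd[OF o(1) N]]
      open_atlas_prod[OF o] by simp
qed

subsection \<open>Powers\<close>

lemma as_list_manifold_sel [simp]:
  "mtop (as_list_manifold N) = pullback_topology {ps. ps \<noteq> []} uncons (mtop N)"
  "mdim (as_list_manifold N) = mdim N"
  "charts (as_list_manifold N) = {cs. cs \<noteq> [] \<and> uncons cs \<in> charts N}"
  "cdom (as_list_manifold N) cs = {ps. ps \<noteq> [] \<and> uncons ps \<in> cdom N (uncons cs)}"
  "cmap (as_list_manifold N) cs ps = cmap N (uncons cs) (uncons ps)"
  "acs (as_list_manifold N) cs ps = acs N (uncons cs) (uncons ps)"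
  by (simp_all add: as_list_manifold_def)

lemma uncons_Cons [simp]: "uncons (p # ps) = (p, ps)"
  by (simp add: uncons_def)

lemma uncons_image: "uncons ` {ps. ps \<noteq> [] \<and> uncons ps \<in> A} = A"
proof (intro subset_antisym subsetI)
  fix x assume "x \<in> A"
  then have "x = uncons (fst x # snd x)" "fst x # snd x \<in> {ps. ps \<noteq> [] \<and> uncons ps \<in> A}" by auto
  then show "x \<in> uncons ` {ps. ps \<noteq> [] \<and> uncons ps \<in> A}" by blast
qed auto

lemma open_atlas_as_list_manifold:
  assumes N: "open_atlas N"
  shows "open_atlas (as_list_manifold N)"
  unfolding open_atlas_def
proof (intro conjI ballI allI impI)
  show "(\<Union>c\<in>charts (as_list_manifold N). cdom (as_list_manifold N) c) = mspace_of (as_list_manifold N)"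
  proof (intro subset_antisym subsetI)
    fix ps assume "ps \<in> mspace_of (as_list_manifold N)"
    then have ps: "ps \<noteq> []" "uncons ps \<in> mspace_of N" by (auto simp: topspace_pullback_topology)
    obtain c where c: "c \<in> charts N" "uncons ps \<in> cdom N c" by (rule open_atlas_cover[OF N ps(2)])
    then have "fst c # snd c \<in> charts (as_list_manifold N)" "ps \<in> cdom (as_list_manifold N) (fst c # snd c)"
      using ps by auto
    then show "ps \<in> (\<Union>c\<in>charts (as_list_manifold N). cdom (as_list_manifold N) c)" by blast
  next
    fix ps assume "ps \<in> (\<Union>c\<in>charts (as_list_manifold N). cdom (as_list_manifold N) c)"
    then obtain cs where "uncons cs \<in> charts N" "ps \<noteq> []" "uncons ps \<in> cdom N (uncons cs)" by auto
    then show "ps \<in> mspace_of (as_list_manifold N)"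
      using open_atlasD(4)[OF N, of "uncons cs" "uncons ps"] by (simp add: topspace_pullback_topology)
  qed
  fix cs assume "cs \<in> charts (as_list_manifold N)"
  then have cs: "cs \<noteq> []" "uncons cs \<in> charts N" by auto
  show "openin (mtop (as_list_manifold N)) (cdom (as_list_manifold N) cs)"
    unfolding as_list_manifold_sel openin_pullback_topology using open_atlasD(1)[OF N cs(2)] by blast
  show "inj_on (cmap (as_list_manifold N) cs) (cdom (as_list_manifold N) cs)"
    using open_atlasD(2)[OF N cs(2)] by (auto simp: inj_on_def uncons_def intro: list.expand)
  fix U assume "openin (mtop (as_list_manifold N)) U"
  then obtain V where V: "openin (mtop N) V" "U = uncons -` V \<inter> {ps. ps \<noteq> []}"
    by (auto simp: openin_pullback_topology)
  have "cmap (as_list_manifold N) cs ` (cdom (as_list_manifold N) cs \<inter> U) =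
      cmap N (uncons cs) ` uncons ` {ps. ps \<noteq> [] \<and> uncons ps \<in> cdom N (uncons cs) \<inter> V}"
    unfolding image_image as_list_manifold_sel V(2) by (rule image_cong) auto
  then show "openin (Euclidean_space (mdim (as_list_manifold N)))
      (cmap (as_list_manifold N) cs ` (cdom (as_list_manifold N) cs \<inter> U))"
    using open_atlasD(3)[OF N cs(2) V(1)] by (simp only: uncons_image as_list_manifold_sel(2))
qed

lemma pseudoholomorphic_uncons:
  assumes N: "ac_manifold N"
  shows "pseudoholomorphic (as_list_manifold N) N uncons"
proof (rule pseudoholomorphic_coordinate_projection[OF open_atlas_as_list_manifold N, where \<kappa> = uncons and a = 0])
  show "continuous_map (mtop (as_list_manifold N)) (mtop N) uncons"
    using continuous_map_pullback[where ?T1.0 = "mtop N" and ?T2.0 = "mtop N" and g = id and f = uncons and A = "{ps. ps \<noteq> []}"]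
    by simp
qed (use N in auto)

lemma pseudoholomorphic_Cons:
  assumes f: "pseudoholomorphic L N f"
  shows "pseudoholomorphic L (as_list_manifold N) (\<lambda>x. fst (f x) # snd (f x))"
proof -
  let ?g = "\<lambda>x. fst (f x) # snd (f x)"
  have lr: "local_rep L c (as_list_manifold N) cs ?g = local_rep L c N (uncons cs) f" for c cs
    by (simp add: local_rep_def fun_eq_iff)
  show ?thesis
  proof (rule pseudoholomorphicI)
    show "continuous_map (mtop L) (mtop (as_list_manifold N)) ?g"
      unfolding as_list_manifold_sel
      by (rule continuous_map_pullback') (use pseudoholomorphic_imp_continuous[OF f] in \<open>auto simp: o_def\<close>)
    show "smooth_coord_map (mdim L) (mdim (as_list_manifold N))
        (cmap L c ` (cdom L c \<inter> ?g -` cdom (as_list_manifold N) cs)) (local_rep L c (as_list_manifold N) cs ?g)"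
      if "c \<in> charts L" "cs \<in> charts (as_list_manifold N)" for c cs
      unfolding lr by (rule smooth_coord_map_subset[OF pseudoholomorphicD(1)[OF f, of c "uncons cs", folded as_list_manifold_sel(2)[of N]]]) (use that in auto)
    show "(\<Sum>k<mdim L. differential L c (as_list_manifold N) cs ?g p i k * acs L c p k j) =
        (\<Sum>k<mdim (as_list_manifold N). acs (as_list_manifold N) cs (?g p) i k * differential L c (as_list_manifold N) cs ?g p k j)"
      if "c \<in> charts L" "cs \<in> charts (as_list_manifold N)" "p \<in> cdom L c" "?g p \<in> cdom (as_list_manifold N) cs"
        "i < mdim (as_list_manifold N)" "j < mdim L" for c cs p i j
      using pseudoholomorphicD(2)[OF f, of c "uncons cs" p i j] that by (simp add: differential_def lr)
  qed
qed

lemma ac_manifold_as_list_manifold: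
  assumes N: "ac_manifold N"
  shows "ac_manifold (as_list_manifold N)"
  unfolding ac_manifold_def
proof
  show o: "open_atlas (as_list_manifold N)" using N by (simp add: open_atlas_as_list_manifold)
  show "pseudoholomorphic (as_list_manifold N) (as_list_manifold N) (\<lambda>p. p)"
    \<comment> \<open>The identity on nonempty lists is splitting off the head followed by putting
      it back.\<close>
    by (rule pseudoholomorphic_cong[OF o o pseudoholomorphic_Cons[OF pseudoholomorphic_uncons[OF N]]])
       (auto simp: topspace_pullback_topology uncons_def)
qed

lemma ac_manifold_point: "ac_manifold point_manifold"
proof -
  \<comment> \<open>In dimension 0 the zero function is the only point, so this singleton is the
    whole space.\<close>
  have "openin (Euclidean_space 0) {\<lambda>_. 0}"
    using openin_topspace[of "Euclidean_space 0"] by (simp add: topspace_Euclidean_space fun_eq_iff[symmetric])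
  then have "open_atlas point_manifold"
    unfolding open_atlas_def point_manifold_def
    by (auto simp: image_constant_conv)
  moreover have "pseudoholomorphic point_manifold point_manifold (\<lambda>p. p)"
    by (rule pseudoholomorphicI) (simp_all add: point_manifold_def smooth_coord_map_def)
  ultimately show ?thesis by (simp add: ac_manifold_def)
qed

lemma ac_manifold_power: "ac_manifold M \<Longrightarrow> ac_manifold (power_manifold M n)"
  by (induction n) (simp_all add: ac_manifold_point ac_manifold_prod ac_manifold_as_list_manifold)

lemma mspace_power_Suc:
  "mspace_of (power_manifold M (Suc n)) = {p # ps | p ps. p \<in> mspace_of M \<and> ps \<in> mspace_of (power_manifold M n)}"
  by (auto simp: topspace_pullback_topology uncons_def neq_Nil_conv)

lemma pseudoholomorphic_hd_tl:
  assumes "ac_manifold M"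
  shows "pseudoholomorphic (power_manifold M (Suc n)) M hd"
    and "pseudoholomorphic (power_manifold M (Suc n)) (power_manifold M n) tl"
proof -
  let ?N = "M \<times>\<^sub>m power_manifold M n"
  have N: "ac_manifold ?N" "ac_manifold (power_manifold M n)"
    using assms by (simp_all add: ac_manifold_prod ac_manifold_power)
  note u = pseudoholomorphic_uncons[OF N(1)]
  have "pseudoholomorphic (as_list_manifold ?N) M (\<lambda>x. fst (uncons x))"
    using pseudoholomorphic_compose[OF _ _ _ u pseudoholomorphic_fst] N assms
    by (simp add: ac_manifold_as_list_manifold)
  then show "pseudoholomorphic (power_manifold M (Suc n)) M hd" by (simp add: uncons_def)
  have "pseudoholomorphic (as_list_manifold ?N) (power_manifold M n) (\<lambda>x. snd (uncons x))"
    using pseudoholomorphic_compose[OF _ _ _ u pseudoholomorphic_snd] N assms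
    by (simp add: ac_manifold_as_list_manifold)
  then show "pseudoholomorphic (power_manifold M (Suc n)) (power_manifold M n) tl" by (simp add: uncons_def)
qed

text \<open>Follows the recursive construction of the powers: insertion at \<open>Suc i\<close>
  keeps the head and inserts at \<open>i\<close> in the tail, while insertion at 0 pairs with a
  constant map.\<close>

lemma pseudoholomorphic_insert_at:
  assumes M: "ac_manifold M" and p: "p \<in> mspace_of M"
  shows "i \<le> n \<Longrightarrow> pseudoholomorphic (power_manifold M n) (power_manifold M (Suc n)) (insert_at i p)"
proof (induction i arbitrary: n)
  case 0
  have "pseudoholomorphic (power_manifold M n) (M \<times>\<^sub>m power_manifold M n) (\<lambda>ps. (p, ps))"
    using M p by (intro pseudoholomorphic_pair pseudoholomorphic_const pseudoholomorphic_id) (simp_all add: ac_manifold_power)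
  from pseudoholomorphic_Cons[OF this] have "pseudoholomorphic (power_manifold M n) (power_manifold M (Suc n)) ((#) p)"
    by simp
  moreover have "insert_at 0 p = (#) p" by (simp add: insert_at_def fun_eq_iff)
  ultimately show ?case by (simp only:)
next
  case (Suc i)
  then obtain m where n: "n = Suc m" "i \<le> m" by (cases n) auto
  let ?P = "power_manifold M"
  have ac: "open_atlas (?P k)" for k by (rule ac_manifold_imp_open_atlas[OF ac_manifold_power[OF M]])
  have "pseudoholomorphic (?P n) (?P n) (\<lambda>ps. insert_at i p (tl ps))"
    unfolding n(1) by (rule pseudoholomorphic_compose[OF ac ac ac pseudoholomorphic_hd_tl(2)[OF M] Suc.IH[OF n(2)]])
  then have "pseudoholomorphic (?P n) (M \<times>\<^sub>m ?P n) (\<lambda>ps. (hd ps, insert_at i p (tl ps)))"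
    using pseudoholomorphic_hd_tl(1)[OF M, of m] unfolding n(1) by (intro pseudoholomorphic_pair)
  from pseudoholomorphic_Cons[OF this]
  have "pseudoholomorphic (?P n) (?P (Suc n)) (\<lambda>ps. hd ps # insert_at i p (tl ps))" by simp
  \<comment> \<open>The formula with \<open>hd\<close> and \<open>tl\<close> agrees with the
    insertion on nonempty lists, hence on all points of this power.\<close>
  then show ?case
  proof (rule pseudoholomorphic_cong[OF ac ac])
    fix ps assume "ps \<in> mspace_of (?P n)"
    then obtain q qs where "ps = q # qs" using mspace_power_Suc[of M m] n(1) by auto
    then show "hd ps # insert_at i p (tl ps) = insert_at (Suc i) p ps" by (simp add: insert_at_def)
  qed
qed

lemma pseudoholomorphic_map_prod:
  assumes "ac_manifold Y" "ac_manifold Z" "open_atlas Y'" "open_atlas Z'"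
    and h: "pseudoholomorphic Y Y' h" and g: "pseudoholomorphic Z Z' g"
  shows "pseudoholomorphic (Y \<times>\<^sub>m Z) (Y' \<times>\<^sub>m Z') (map_prod h g)"
proof -
  have "pseudoholomorphic (Y \<times>\<^sub>m Z) (Y' \<times>\<^sub>m Z') (\<lambda>x. (h (fst x), g (snd x)))"
    using assms
    by (intro pseudoholomorphic_pair pseudoholomorphic_compose[OF _ _ _ pseudoholomorphic_fst h]
        pseudoholomorphic_compose[OF _ _ _ pseudoholomorphic_snd g]) (simp_all add: open_atlas_prod)
  moreover have "map_prod h g = (\<lambda>x. (h (fst x), g (snd x)))" by (simp add: fun_eq_iff)
  ultimately show ?thesis by (simp only:)
qed

section \<open>Operations on correspondences\<close>

text \<open>The two nested sheafifications collapse: a function that is locally a section of some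
  \<open>JCor_n\<close> is locally given by a tuple, and conversely the length is recovered as
  \<open>size A\<close>.\<close>

lemma JCor_iff:
  "s \<in> JCor Y X \<longleftrightarrow> s \<in> extensional (mspace_of Y) \<and>
     (\<forall>y\<in>mspace_of Y. \<exists>V A. openin (mtop Y) V \<and> y \<in> V \<and>
        (\<forall>f\<in>#A. pseudoholomorphic (open_submanifold Y V) X f) \<and>
        (\<forall>z\<in>V. s z = image_mset (\<lambda>f. f z) A))"
  (is "_ \<longleftrightarrow> ?ext \<and> (\<forall>y\<in>_. ?loc y)")
proof (intro iffI conjI ballI)
  assume s: "s \<in> JCor Y X"
  then show ?ext by (simp add: JCor_def sheafification_def)
  fix y assume "y \<in> mspace_of Y"
  then obtain V n where V: "y \<in> V" "restrict s V \<in> JCor_n n Y X V"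
    using s unfolding JCor_def sheafification_def by blast
  then obtain W where W: "openin (mtop Y) W" "y \<in> W" "W \<subseteq> V" "restrict (restrict s V) W \<in> tuple_sections n Y X W"
    unfolding JCor_n_def sheafification_def by blast
  then obtain A where A: "restrict s W = (\<lambda>y\<in>W. image_mset (\<lambda>f. f y) A)"
      "\<forall>f\<in>#A. pseudoholomorphic (open_submanifold Y W) X f"
    unfolding tuple_sections_def by (auto simp: Int_absorb1)
  have "s z = image_mset (\<lambda>f. f z) A" if "z \<in> W" for z
    using fun_cong[OF A(1), of z] that by simp
  then show "?loc y" using W A by blast
next
  assume a: "?ext \<and> (\<forall>y\<in>mspace_of Y. ?loc y)"
  have "\<exists>V. openin (mtop Y) V \<and> y \<in> V \<and> V \<subseteq> mspace_of Y \<and> restrict s V \<in> (\<Union>n. JCor_n n Y X V)"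
    if "y \<in> mspace_of Y" for y
  proof -
    have "?loc y" using a that by blast
    then obtain V A where V: "openin (mtop Y) V" "y \<in> V"
        "\<forall>f\<in>#A. pseudoholomorphic (open_submanifold Y V) X f" "\<forall>z\<in>V. s z = image_mset (\<lambda>f. f z) A"
      by blast
    have "restrict s V = (\<lambda>y\<in>V. image_mset (\<lambda>f. f y) A)" using V(4) by (auto simp: fun_eq_iff)
    then have "restrict s V \<in> tuple_sections (size A) Y X V"
      using V(3) unfolding tuple_sections_def by blast
    then have "restrict s V \<in> JCor_n (size A) Y X V"
      using V(1) unfolding JCor_n_def sheafification_def by auto
    then show ?thesis using V(1,2) openin_subset by blast
  qed
  then show "s \<in> JCor Y X" using a by (simp add: JCor_def sheafification_def)
qed

lemma JCor_extensional: "s \<in> JCor Y X \<Longrightarrow> s \<in> extensional (mspace_of Y)"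
  by (simp add: JCor_def sheafification_def)

lemma JCor_restrict_eq:
  assumes "s \<in> JCor Y X" "\<And>y. y \<in> mspace_of Y \<Longrightarrow> t y = s y"
  shows "(\<lambda>y\<in>mspace_of Y. t y) = s"
  using assms JCor_extensional[of s Y X] by (intro extensionalityI[where A = "mspace_of Y"]) auto

lemma JCor_local:
  assumes "s \<in> JCor Y X" "y \<in> mspace_of Y"
  obtains V A where "openin (mtop Y) V" "y \<in> V"
    "\<forall>f\<in>#A. pseudoholomorphic (open_submanifold Y V) X f"
    "\<forall>z\<in>V. s z = image_mset (\<lambda>f. f z) A"
  using assms unfolding JCor_iff by meson

lemma JCorI:
  assumes "s \<in> extensional (mspace_of Y)"
    and "\<And>y. y \<in> mspace_of Y \<Longrightarrow> \<exists>V A. openin (mtop Y) V \<and> y \<in> V \<and>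
        (\<forall>f\<in>#A. pseudoholomorphic (open_submanifold Y V) X f) \<and> (\<forall>z\<in>V. s z = image_mset (\<lambda>f. f z) A)"
  shows "s \<in> JCor Y X"
  using assms unfolding JCor_iff by blast

text \<open>Makes identities that hold only at points of the manifold, such as those for \<gamma>,
  applicable inside the multisets.\<close>

lemma JCor_values:
  assumes "s \<in> JCor Y X" "y \<in> mspace_of Y" "x \<in># s y"
  shows "x \<in> mspace_of X"
proof -
  obtain V A where V: "y \<in> V" "\<forall>f\<in>#A. pseudoholomorphic (open_submanifold Y V) X f"
      "\<forall>z\<in>V. s z = image_mset (\<lambda>f. f z) A"
    by (rule JCor_local[OF assms(1,2)])
  then obtain f where f: "f \<in># A" "x = f y" using assms(3) by auto
  show ?thesis unfolding f(2)
    by (rule pseudoholomorphic_in_mspace[OF bspec[OF V(2) f(1)]]) (use V(1) assms(2) in simp)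
qed

lemma pseudoholomorphic_restrict_further:
  assumes Y: "ac_manifold Y" and X: "open_atlas X" and V: "openin (mtop Y) V" and W: "openin (mtop Y) W" "W \<subseteq> V"
    and f: "pseudoholomorphic (open_submanifold Y V) X f"
  shows "pseudoholomorphic (open_submanifold Y W) X f"
proof -
  have o: "open_atlas Y" "open_atlas (open_submanifold Y V)" "open_atlas (open_submanifold Y W)"
    using Y V W by (simp_all add: open_atlas_open_submanifold)
  have "pseudoholomorphic (open_submanifold Y W) (open_submanifold Y V) (\<lambda>y. y)"
    by (rule pseudoholomorphic_into_open_submanifold[OF pseudoholomorphic_restrict[OF o(1,1) W(1) pseudoholomorphic_id[OF Y]]])
       (use W(2) in auto)
  from pseudoholomorphic_compose[OF o(3,2) X this f] show ?thesis .
qed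

text \<open>Common form of pullback (\<Phi> is \<open>snd\<close>), pushforward (\<open>h\<close> is
  the identity) and the homotopy for X x M, where the map applied to the values also depends on the
  base point \<open>z\<close>.\<close>

definition corr_op ::
    "('z, 'k) manifold_data \<Rightarrow> ('z \<Rightarrow> 'y) \<Rightarrow> ('z \<times> 'x \<Rightarrow> 'w) \<Rightarrow> ('y \<Rightarrow> 'x multiset) \<Rightarrow> 'z \<Rightarrow> 'w multiset" where
  "corr_op Z h \<Phi> s = (\<lambda>z\<in>mspace_of Z. image_mset (\<lambda>x. \<Phi> (z, x)) (s (h z)))"

text \<open>If \<open>s\<close> is locally the tuple of the maps f, the result is locally the tuple
  of the maps sending z to \<Phi> (z, f (h z)), which are composites of pairings.\<close>

lemma corr_op_in_JCor:
  assumes Z: "ac_manifold Z" and Y: "open_atlas Y" and X: "open_atlas X" and W: "open_atlas W"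
    and h: "pseudoholomorphic Z Y h" and \<Phi>: "pseudoholomorphic (Z \<times>\<^sub>m X) W \<Phi>" and s: "s \<in> JCor Y X"
  shows "corr_op Z h \<Phi> s \<in> JCor Z W"
proof (rule JCorI)
  fix z assume z: "z \<in> mspace_of Z"
  obtain V A where V: "openin (mtop Y) V" "h z \<in> V"
      "\<forall>f\<in>#A. pseudoholomorphic (open_submanifold Y V) X f"
      "\<forall>y\<in>V. s y = image_mset (\<lambda>f. f y) A"
    by (rule JCor_local[OF s pseudoholomorphic_in_mspace[OF h z]])
  define U where "U = {z \<in> mspace_of Z. h z \<in> V}"
  have U: "openin (mtop Z) U" unfolding U_def
    by (rule openin_continuous_map_preimage[OF pseudoholomorphic_imp_continuous[OF h] V(1)])
  have oZ: "open_atlas Z" using Z by simp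
  note oU = open_atlas_open_submanifold[OF oZ U] and oV = open_atlas_open_submanifold[OF Y V(1)]
  have hU: "pseudoholomorphic (open_submanifold Z U) (open_submanifold Y V) h"
    by (rule pseudoholomorphic_into_open_submanifold[OF pseudoholomorphic_restrict[OF oZ Y U h]]) (simp add: U_def)
  have "pseudoholomorphic (open_submanifold Z U) W (\<lambda>z. \<Phi> (z, f (h z)))" if "f \<in># A" for f
  proof -
    have "pseudoholomorphic (open_submanifold Z U) (Z \<times>\<^sub>m X) (\<lambda>z. (z, f (h z)))"
      by (rule pseudoholomorphic_pair[OF pseudoholomorphic_restrict[OF oZ oZ U pseudoholomorphic_id[OF Z]]
            pseudoholomorphic_compose[OF oU oV X hU bspec[OF V(3) that]]])
    from pseudoholomorphic_compose[OF oU open_atlas_prod[OF oZ X] W this \<Phi>] show ?thesis .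
  qed
  moreover have "corr_op Z h \<Phi> s z' = image_mset (\<lambda>f. f z') (image_mset (\<lambda>f z. \<Phi> (z, f (h z))) A)"
    if "z' \<in> U" for z'
    using that bspec[OF V(4), of "h z'"] by (simp add: corr_op_def U_def multiset.map_comp o_def)
  moreover have "z \<in> U" using z V(2) by (simp add: U_def)
  ultimately show "\<exists>V A. openin (mtop Z) V \<and> z \<in> V \<and>
        (\<forall>f\<in>#A. pseudoholomorphic (open_submanifold Z V) W f) \<and> (\<forall>z\<in>V. corr_op Z h \<Phi> s z = image_mset (\<lambda>f. f z) A)"
    using U by (intro exI[of _ U] exI[of _ "image_mset (\<lambda>f z. \<Phi> (z, f (h z))) A"]) auto
qed (simp add: corr_op_def)

lemma JCor_monoid_sel [simp]:
  "carrier (JCor_monoid Y X) = JCor Y X"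
  "s \<otimes>\<^bsub>JCor_monoid Y X\<^esub> t = (\<lambda>y\<in>mspace_of Y. s y + t y)"
  "\<one>\<^bsub>JCor_monoid Y X\<^esub> = (\<lambda>y\<in>mspace_of Y. {#})"
  by (simp_all add: JCor_monoid_def)

lemma JCor_add:
  assumes Y: "ac_manifold Y" and X: "open_atlas X" and s: "s \<in> JCor Y X" and t: "t \<in> JCor Y X"
  shows "(\<lambda>y\<in>mspace_of Y. s y + t y) \<in> JCor Y X"
proof (rule JCorI)
  fix y assume y: "y \<in> mspace_of Y"
  obtain V A where V: "openin (mtop Y) V" "y \<in> V"
      "\<forall>f\<in>#A. pseudoholomorphic (open_submanifold Y V) X f"
      "\<forall>y\<in>V. s y = image_mset (\<lambda>f. f y) A"
    by (rule JCor_local[OF s y])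
  obtain V' A' where V': "openin (mtop Y) V'" "y \<in> V'"
      "\<forall>f\<in>#A'. pseudoholomorphic (open_submanifold Y V') X f"
      "\<forall>y\<in>V'. t y = image_mset (\<lambda>f. f y) A'"
    by (rule JCor_local[OF t y])
  have o: "openin (mtop Y) (V \<inter> V')" using V(1) V'(1) by blast
  have "pseudoholomorphic (open_submanifold Y (V \<inter> V')) X f" if "f \<in># A + A'" for f
    using that pseudoholomorphic_restrict_further[OF Y X V(1) o Int_lower1 bspec[OF V(3)]]
      pseudoholomorphic_restrict_further[OF Y X V'(1) o Int_lower2 bspec[OF V'(3)]] by auto
  moreover have "restrict (\<lambda>y. s y + t y) (mspace_of Y) z = image_mset (\<lambda>f. f z) (A + A')" if "z \<in> V \<inter> V'" for z
    using that V(4) V'(4) openin_subset[OF V(1)] by auto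
  ultimately show "\<exists>V A. openin (mtop Y) V \<and> y \<in> V \<and>
        (\<forall>f\<in>#A. pseudoholomorphic (open_submanifold Y V) X f) \<and>
        (\<forall>z\<in>V. restrict (\<lambda>y. s y + t y) (mspace_of Y) z = image_mset (\<lambda>f. f z) A)"
    using o V(2) V'(2) by (intro exI[of _ "V \<inter> V'"] exI[of _ "A + A'"]) auto
qed simp

lemma JCor_zero: "(\<lambda>y\<in>mspace_of Y. {#}) \<in> JCor Y X"
  by (rule JCorI, simp, intro exI[of _ "mspace_of Y"] exI[of _ "{#}"]) auto

lemma comm_monoid_JCor:
  assumes "ac_manifold Y" "open_atlas X"
  shows "comm_monoid (JCor_monoid Y X)"
proof (rule comm_monoidI)
  show "\<one>\<^bsub>JCor_monoid Y X\<^esub> \<otimes>\<^bsub>JCor_monoid Y X\<^esub> s = s" if "s \<in> carrier (JCor_monoid Y X)" for s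
    using JCor_extensional[of s Y X] that by (auto simp: fun_eq_iff extensional_def)
qed (use assms in \<open>auto simp: JCor_add JCor_zero fun_eq_iff add.assoc add.commute\<close>)

lemma corr_op_hom:
  assumes "ac_manifold Z" "open_atlas Y" "open_atlas X" "open_atlas W"
    and h: "pseudoholomorphic Z Y h" and "pseudoholomorphic (Z \<times>\<^sub>m X) W \<Phi>"
  shows "corr_op Z h \<Phi> \<in> hom (JCor_monoid Y X) (JCor_monoid Z W)"
proof (rule homI)
  show "corr_op Z h \<Phi> s \<in> carrier (JCor_monoid Z W)" if "s \<in> carrier (JCor_monoid Y X)" for s
    using that corr_op_in_JCor[OF assms] by simp
  show "corr_op Z h \<Phi> (s \<otimes>\<^bsub>JCor_monoid Y X\<^esub> t) =
      corr_op Z h \<Phi> s \<otimes>\<^bsub>JCor_monoid Z W\<^esub> corr_op Z h \<Phi> t" for s t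
    using pseudoholomorphic_in_mspace[OF h] by (auto simp: corr_op_def fun_eq_iff)
qed

lemma pull_eq_corr_op: "(\<lambda>s. \<lambda>z\<in>mspace_of Z. s (h z)) = corr_op Z h snd"
  by (simp add: corr_op_def fun_eq_iff)

lemma push_eq_corr_op: "(\<lambda>s. \<lambda>y\<in>mspace_of Y. image_mset g (s y)) = corr_op Y (\<lambda>y. y) (\<lambda>z. g (snd z))"
  by (simp add: corr_op_def fun_eq_iff)

section \<open>Grothendieck groups\<close>

context comm_monoid
begin

lemma grothendieck_rel_iff:
  "((a, b), (c, d)) \<in> grothendieck_rel G \<longleftrightarrow>
     a \<in> carrier G \<and> b \<in> carrier G \<and> c \<in> carrier G \<and> d \<in> carrier G \<and>
        (\<exists>k\<in>carrier G. a \<otimes> d \<otimes> k = c \<otimes> b \<otimes> k)"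
  by (simp add: grothendieck_rel_def)

lemma equiv_grothendieck_rel: "equiv (carrier G \<times> carrier G) (grothendieck_rel G)"
proof (rule equivI)
  show "grothendieck_rel G \<subseteq> (carrier G \<times> carrier G) \<times> (carrier G \<times> carrier G)"
    by (auto simp: grothendieck_rel_def)
  show "refl_on (carrier G \<times> carrier G) (grothendieck_rel G)"
    by (auto simp: refl_on_def grothendieck_rel_def)
  show "sym (grothendieck_rel G)"
    unfolding sym_def grothendieck_rel_def by (auto, metis)
  show "trans (grothendieck_rel G)"
  proof (rule transI, clarify)
    fix a b c d e f
    assume "((a, b), (c, d)) \<in> grothendieck_rel G" "((c, d), (e, f)) \<in> grothendieck_rel G"
    then obtain k l where c: "a \<in> carrier G" "b \<in> carrier G" "c \<in> carrier G" "d \<in> carrier G" "e \<in> carrier G" "f \<in> carrier G"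
        "k \<in> carrier G" "l \<in> carrier G" and eq: "a \<otimes> d \<otimes> k = c \<otimes> b \<otimes> k" "c \<otimes> f \<otimes> l = e \<otimes> d \<otimes> l"
      by (auto simp: grothendieck_rel_iff)
    \<comment> \<open>Multiplying the two relations without cancelling leaves the middle term
      \<open>d\<close> and both witnesses, so their product is the new witness.\<close>
    have "a \<otimes> f \<otimes> (d \<otimes> k \<otimes> l) = (a \<otimes> d \<otimes> k) \<otimes> (f \<otimes> l)" using c by (simp add: m_ac)
    also have "\<dots> = (c \<otimes> f \<otimes> l) \<otimes> (b \<otimes> k)" unfolding eq(1) using c by (simp add: m_ac)
    also have "\<dots> = e \<otimes> b \<otimes> (d \<otimes> k \<otimes> l)" unfolding eq(2) using c by (simp add: m_ac)
    finally show "((a, b), (e, f)) \<in> grothendieck_rel G"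
      using c by (auto simp: grothendieck_rel_iff)
  qed
qed

definition gclass :: "'a \<Rightarrow> 'a \<Rightarrow> ('a \<times> 'a) set" where
  "gclass a b = grothendieck_rel G `` {(a, b)}"

lemma gclass_eq_iff:
  assumes "a \<in> carrier G" "b \<in> carrier G" "c \<in> carrier G" "d \<in> carrier G"
  shows "gclass a b = gclass c d \<longleftrightarrow> (\<exists>k\<in>carrier G. a \<otimes> d \<otimes> k = c \<otimes> b \<otimes> k)"
  using eq_equiv_class_iff[OF equiv_grothendieck_rel, of "(a, b)" "(c, d)"] assms
  by (auto simp: gclass_def grothendieck_rel_iff)

lemma gclass_self: "a \<in> carrier G \<Longrightarrow> b \<in> carrier G \<Longrightarrow> (a, b) \<in> gclass a b"
  unfolding gclass_def by (auto simp: grothendieck_rel_iff)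

lemma carrier_grothendieck_group:
  "carrier (grothendieck_group G) = {gclass a b | a b. a \<in> carrier G \<and> b \<in> carrier G}"
  by (auto simp: grothendieck_group_def quotient_def gclass_def)

lemma gclassE:
  assumes "A \<in> carrier (grothendieck_group G)"
  obtains a b where "a \<in> carrier G" "b \<in> carrier G" "A = gclass a b"
  using assms by (auto simp: carrier_grothendieck_group)

lemma gclass_in_carrier: "a \<in> carrier G \<Longrightarrow> b \<in> carrier G \<Longrightarrow> gclass a b \<in> carrier (grothendieck_group G)"
  by (auto simp: carrier_grothendieck_group)

lemma in_gclassD: "(c, d) \<in> gclass a b \<Longrightarrow> c \<in> carrier G \<and> d \<in> carrier G \<and> gclass c d = gclass a b"
  unfolding gclass_def using equiv_class_eq[OF equiv_grothendieck_rel, of "(a, b)" "(c, d)"]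
  by (auto simp: grothendieck_rel_iff)

text \<open>Operations on classes are defined by saturating the results for all representatives;
  once these results are shown equivalent, the saturation is a single class.\<close>

lemma gclass_Image_const:
  assumes ne: "S \<noteq> {}" and S: "\<And>p. p \<in> S \<Longrightarrow> grothendieck_rel G `` {p} = C"
  shows "grothendieck_rel G `` S = C"
  using assms by blast

lemma gclass_mult:
  assumes "a \<in> carrier G" "b \<in> carrier G" "c \<in> carrier G" "d \<in> carrier G"
  shows "gclass a b \<otimes>\<^bsub>grothendieck_group G\<^esub> gclass c d = gclass (a \<otimes> c) (b \<otimes> d)"
proof -
  let ?S = "{(a' \<otimes> c', b' \<otimes> d') | a' b' c' d'. (a', b') \<in> gclass a b \<and> (c', d') \<in> gclass c d}"
  have "gclass (a' \<otimes> c') (b' \<otimes> d') = gclass (a \<otimes> c) (b \<otimes> d)"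
    if p: "(a', b') \<in> gclass a b" "(c', d') \<in> gclass c d" for a' b' c' d'
  proof -
    have car: "a' \<in> carrier G" "b' \<in> carrier G" "c' \<in> carrier G" "d' \<in> carrier G"
      using in_gclassD[OF p(1)] in_gclassD[OF p(2)] by auto
    obtain k where k: "k \<in> carrier G" "a' \<otimes> b \<otimes> k = a \<otimes> b' \<otimes> k"
      using in_gclassD[OF p(1)] assms gclass_eq_iff[of a' b' a b] by auto
    obtain l where l: "l \<in> carrier G" "c' \<otimes> d \<otimes> l = c \<otimes> d' \<otimes> l"
      using in_gclassD[OF p(2)] assms gclass_eq_iff[of c' d' c d] by auto
    \<comment> \<open>Independence of the representatives: the two relations are multiplied, and so
      are their witnesses.\<close>
    have "a' \<otimes> c' \<otimes> (b \<otimes> d) \<otimes> (k \<otimes> l) = (a' \<otimes> b \<otimes> k) \<otimes> (c' \<otimes> d \<otimes> l)"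
      using car assms k(1) l(1) by (simp add: m_ac)
    also have "\<dots> = a \<otimes> c \<otimes> (b' \<otimes> d') \<otimes> (k \<otimes> l)"
      unfolding k(2) l(2) using car assms k(1) l(1) by (simp add: m_ac)
    finally show ?thesis
      using car assms k(1) l(1) by (subst gclass_eq_iff) auto
  qed
  note const = this
  have "grothendieck_rel G `` ?S = gclass (a \<otimes> c) (b \<otimes> d)"
  proof (rule gclass_Image_const)
    have "(a \<otimes> c, b \<otimes> d) \<in> ?S"
      using gclass_self[OF assms(1,2)] gclass_self[OF assms(3,4)] by blast
    then show "?S \<noteq> {}" by (metis empty_iff)
    fix q assume "q \<in> ?S"
    then obtain a' b' c' d' where q: "q = (a' \<otimes> c', b' \<otimes> d')" "(a', b') \<in> gclass a b" "(c', d') \<in> gclass c d"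
      by blast
    show "grothendieck_rel G `` {q} = gclass (a \<otimes> c) (b \<otimes> d)"
      using const[OF q(2,3)] by (simp only: gclass_def q(1))
  qed
  then show ?thesis by (simp add: grothendieck_group_def)
qed

lemma gclass_one: "\<one>\<^bsub>grothendieck_group G\<^esub> = gclass \<one> \<one>"
  by (simp add: grothendieck_group_def gclass_def)

lemma comm_group_grothendieck_group: "comm_group (grothendieck_group G)"
proof (rule comm_groupI)
  fix A assume "A \<in> carrier (grothendieck_group G)"
  then obtain a b where a: "a \<in> carrier G" "b \<in> carrier G" "A = gclass a b" by (rule gclassE)
  \<comment> \<open>The inverse of a formal difference exchanges its two entries.\<close>
  then have "gclass b a \<otimes>\<^bsub>grothendieck_group G\<^esub> A = \<one>\<^bsub>grothendieck_group G\<^esub>"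
    by (auto simp: gclass_mult gclass_one gclass_eq_iff m_ac)
  then show "\<exists>B\<in>carrier (grothendieck_group G). B \<otimes>\<^bsub>grothendieck_group G\<^esub> A = \<one>\<^bsub>grothendieck_group G\<^esub>"
    using a gclass_in_carrier by blast
  show "\<one>\<^bsub>grothendieck_group G\<^esub> \<otimes>\<^bsub>grothendieck_group G\<^esub> A = A"
    using a by (simp add: gclass_mult gclass_one)
next
  fix A B C assume "A \<in> carrier (grothendieck_group G)" "B \<in> carrier (grothendieck_group G)" "C \<in> carrier (grothendieck_group G)"
  then show "A \<otimes>\<^bsub>grothendieck_group G\<^esub> B \<otimes>\<^bsub>grothendieck_group G\<^esub> C = A \<otimes>\<^bsub>grothendieck_group G\<^esub> (B \<otimes>\<^bsub>grothendieck_group G\<^esub> C)"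
    by (elim gclassE) (simp add: gclass_mult m_ac)
next
  fix A B assume "A \<in> carrier (grothendieck_group G)" "B \<in> carrier (grothendieck_group G)"
  then show "A \<otimes>\<^bsub>grothendieck_group G\<^esub> B = B \<otimes>\<^bsub>grothendieck_group G\<^esub> A"
    and "A \<otimes>\<^bsub>grothendieck_group G\<^esub> B \<in> carrier (grothendieck_group G)"
    by (elim gclassE, simp add: gclass_mult gclass_in_carrier m_comm)+
qed (simp add: gclass_one gclass_in_carrier)

lemma grothendieck_map_gclass:
  assumes H: "comm_monoid H" and f: "f \<in> hom G H" and ab: "a \<in> carrier G" "b \<in> carrier G"
  shows "grothendieck_map H f (gclass a b) = comm_monoid.gclass H (f a) (f b)"
proof -
  interpret H: comm_monoid H by fact
  have "grothendieck_rel H `` {(f c, f d)} = H.gclass (f a) (f b)" if p: "(c, d) \<in> gclass a b" for c d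
  proof -
    have car: "c \<in> carrier G" "d \<in> carrier G" using in_gclassD[OF p] by auto
    obtain k where k: "k \<in> carrier G" "c \<otimes> b \<otimes> k = a \<otimes> d \<otimes> k"
      using in_gclassD[OF p] ab gclass_eq_iff[of c d a b] by auto
    have fc: "f x \<in> carrier H" if "x \<in> carrier G" for x using f that by (auto simp: hom_def)
    have fm: "f (x \<otimes> y) = f x \<otimes>\<^bsub>H\<^esub> f y" if "x \<in> carrier G" "y \<in> carrier G" for x y
      using f that by (auto simp: hom_def)
    have "f c \<otimes>\<^bsub>H\<^esub> f b \<otimes>\<^bsub>H\<^esub> f k = f a \<otimes>\<^bsub>H\<^esub> f d \<otimes>\<^bsub>H\<^esub> f k"
      using arg_cong[OF k(2), of f] car ab k(1) by (simp add: fm)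
    then have "H.gclass (f c) (f d) = H.gclass (f a) (f b)"
      using car ab k(1) fc by (subst H.gclass_eq_iff) auto
    then show ?thesis by (simp add: H.gclass_def)
  qed
  note const = this
  show ?thesis
    unfolding grothendieck_map_def
  proof (rule H.gclass_Image_const)
    show "map_prod f f ` gclass a b \<noteq> {}" using gclass_self[OF ab] by (metis empty_iff image_is_empty)
    fix q assume "q \<in> map_prod f f ` gclass a b"
    then obtain c d where "q = (f c, f d)" "(c, d) \<in> gclass a b" by auto
    then show "grothendieck_rel H `` {q} = H.gclass (f a) (f b)" using const by (simp only:)
  qed
qed

lemma grothendieck_map_hom:
  assumes H: "comm_monoid H" and f: "f \<in> hom G H"
  shows "grothendieck_map H f \<in> hom (grothendieck_group G) (grothendieck_group H)"
proof -
  interpret H: comm_monoid H by fact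
  have fc: "f x \<in> carrier H" if "x \<in> carrier G" for x using f that by (auto simp: hom_def)
  have fm: "f (x \<otimes> y) = f x \<otimes>\<^bsub>H\<^esub> f y" if "x \<in> carrier G" "y \<in> carrier G" for x y
    using f that by (auto simp: hom_def)
  show ?thesis
  proof (rule homI)
    fix A assume "A \<in> carrier (grothendieck_group G)"
    then show "grothendieck_map H f A \<in> carrier (grothendieck_group H)"
      by (elim gclassE) (simp add: grothendieck_map_gclass[OF H f] H.gclass_in_carrier fc)
  next
    fix A B assume "A \<in> carrier (grothendieck_group G)" "B \<in> carrier (grothendieck_group G)"
    then show "grothendieck_map H f (A \<otimes>\<^bsub>grothendieck_group G\<^esub> B) =
        grothendieck_map H f A \<otimes>\<^bsub>grothendieck_group H\<^esub> grothendieck_map H f B"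
      by (elim gclassE) (simp add: gclass_mult grothendieck_map_gclass[OF H f] H.gclass_mult fc fm)
  qed
qed

end

section \<open>Counting multiplicities\<close>

text \<open>As correspondences are functions, these homomorphisms to the integers separate points,
  so identities in \<open>JC Y X\<close> become identities between integers.\<close>

definition JC_count :: "'y \<Rightarrow> 'x \<Rightarrow> (('y \<Rightarrow> 'x multiset) \<times> ('y \<Rightarrow> 'x multiset)) set \<Rightarrow> int" where
  "JC_count y x A = (case SOME p. p \<in> A of (a, b) \<Rightarrow> int (count (a y) x) - int (count (b y) x))"

text \<open>The choice in \<open>JC_count\<close> is harmless: at \<open>y\<close> the witness of
  equivalence is a multiset that cancels, so differences of multiplicities agree for all
  representatives.\<close>

lemma JC_count_gclass:
  assumes Y: "ac_manifold Y" and X: "open_atlas X" and y: "y \<in> mspace_of Y"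
    and ab: "a \<in> JCor Y X" "b \<in> JCor Y X"
  shows "JC_count y x (comm_monoid.gclass (JCor_monoid Y X) a b) = int (count (a y) x) - int (count (b y) x)"
proof -
  interpret comm_monoid "JCor_monoid Y X" by (rule comm_monoid_JCor[OF Y X])
  obtain c d where cd: "(SOME p. p \<in> gclass a b) = (c, d)" by (cases "SOME p. p \<in> gclass a b")
  have "(c, d) \<in> gclass a b" unfolding cd[symmetric] by (rule someI[of _ "(a, b)"]) (use ab gclass_self in simp)
  then have c: "c \<in> JCor Y X" "d \<in> JCor Y X" "gclass c d = gclass a b" using in_gclassD by auto
  then obtain k where "k \<in> JCor Y X"
      "c \<otimes>\<^bsub>JCor_monoid Y X\<^esub> b \<otimes>\<^bsub>JCor_monoid Y X\<^esub> k = a \<otimes>\<^bsub>JCor_monoid Y X\<^esub> d \<otimes>\<^bsub>JCor_monoid Y X\<^esub> k"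
    using ab gclass_eq_iff[of c d a b] by auto
  then have "c y + b y + k y = a y + d y + k y" using y by (auto dest: fun_cong[of _ _ y])
  then have "count (c y + b y) x = count (a y + d y) x" by simp
  then show ?thesis by (simp add: JC_count_def cd)
qed

locale corr_group =
  fixes Y :: "('y, 'i) manifold_data" and X :: "('x, 'j) manifold_data"
  assumes Y: "ac_manifold Y" and X: "open_atlas X"
begin

sublocale J: comm_monoid "JCor_monoid Y X" by (rule comm_monoid_JCor[OF Y X])

sublocale comm_group "JC Y X" unfolding JC_def by (rule J.comm_group_grothendieck_group)

lemma JC_E:
  assumes "A \<in> carrier (JC Y X)"
  obtains a b where "a \<in> JCor Y X" "b \<in> JCor Y X" "A = J.gclass a b"
  using assms unfolding JC_def by (auto elim: J.gclassE)

lemma JC_count_mult: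
  assumes "y \<in> mspace_of Y" "A \<in> carrier (JC Y X)" "B \<in> carrier (JC Y X)"
  shows "JC_count y x (A \<otimes>\<^bsub>JC Y X\<^esub> B) = JC_count y x A + JC_count y x B"
proof -
  obtain a b where a: "a \<in> JCor Y X" "b \<in> JCor Y X" "A = J.gclass a b" by (rule JC_E[OF assms(2)])
  obtain c d where c: "c \<in> JCor Y X" "d \<in> JCor Y X" "B = J.gclass c d" by (rule JC_E[OF assms(3)])
  have "A \<otimes>\<^bsub>JC Y X\<^esub> B = J.gclass (a \<otimes>\<^bsub>JCor_monoid Y X\<^esub> c) (b \<otimes>\<^bsub>JCor_monoid Y X\<^esub> d)"
    using a c J.gclass_mult by (simp add: JC_def)
  then show ?thesis
    using a c assms(1) JCor_add[OF Y X] by (simp add: JC_count_gclass[OF Y X])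
qed

text \<open>Equal counts mean that \<open>a + d\<close> and \<open>c + b\<close> agree at every
  point, so the classes are related with the empty correspondence as witness.\<close>

lemma JC_eqI:
  assumes "A \<in> carrier (JC Y X)" "B \<in> carrier (JC Y X)"
    and eq: "\<And>y x. y \<in> mspace_of Y \<Longrightarrow> JC_count y x A = JC_count y x B"
  shows "A = B"
proof -
  obtain a b where a: "a \<in> JCor Y X" "b \<in> JCor Y X" "A = J.gclass a b" by (rule JC_E[OF assms(1)])
  obtain c d where c: "c \<in> JCor Y X" "d \<in> JCor Y X" "B = J.gclass c d" by (rule JC_E[OF assms(2)])
  have "a y + d y = c y + b y" if y: "y \<in> mspace_of Y" for y
  proof (rule multiset_eqI)
    fix x
    have "int (count (a y) x) - int (count (b y) x) = int (count (c y) x) - int (count (d y) x)"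
      using eq[OF y, of x] a c y by (simp add: JC_count_gclass[OF Y X])
    then show "count (a y + d y) x = count (c y + b y) x" by simp
  qed
  then have "a \<otimes>\<^bsub>JCor_monoid Y X\<^esub> d = c \<otimes>\<^bsub>JCor_monoid Y X\<^esub> b" by (auto simp: fun_eq_iff)
  then show ?thesis
    using a c by (auto simp: J.gclass_eq_iff intro!: bexI[OF _ JCor_zero])
qed

text \<open>Arbitrary additive functions are treated, as boundaries are evaluated later not only by
  \<open>JC_count\<close> but also by counts preceded by a homomorphism of chain groups.\<close>

lemma additive_one:
  fixes \<phi> :: "_ \<Rightarrow> int"
  assumes "\<And>A B. A \<in> carrier (JC Y X) \<Longrightarrow> B \<in> carrier (JC Y X) \<Longrightarrow> \<phi> (A \<otimes>\<^bsub>JC Y X\<^esub> B) = \<phi> A + \<phi> B"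
  shows "\<phi> \<one>\<^bsub>JC Y X\<^esub> = 0"
  using assms[of "\<one>\<^bsub>JC Y X\<^esub>" "\<one>\<^bsub>JC Y X\<^esub>"] by simp

lemma additive_int_pow:
  fixes \<phi> :: "_ \<Rightarrow> int"
  assumes \<phi>: "\<And>A B. A \<in> carrier (JC Y X) \<Longrightarrow> B \<in> carrier (JC Y X) \<Longrightarrow> \<phi> (A \<otimes>\<^bsub>JC Y X\<^esub> B) = \<phi> A + \<phi> B"
    and A: "A \<in> carrier (JC Y X)"
  shows "\<phi> (A [^]\<^bsub>JC Y X\<^esub> (k :: int)) = k * \<phi> A"
proof -
  have "\<phi> \<in> hom (JC Y X) integer_group" by (rule homI) (simp_all add: \<phi>)
  then interpret group_hom "JC Y X" integer_group \<phi>
    by (simp add: group_hom_def group_hom_axioms_def is_group)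
  show ?thesis using hom_int_pow[OF A, of k] by simp
qed

lemma additive_finprod:
  fixes \<phi> :: "_ \<Rightarrow> int"
  assumes \<phi>: "\<And>A B. A \<in> carrier (JC Y X) \<Longrightarrow> B \<in> carrier (JC Y X) \<Longrightarrow> \<phi> (A \<otimes>\<^bsub>JC Y X\<^esub> B) = \<phi> A + \<phi> B"
    and "finite I" "\<And>i. i \<in> I \<Longrightarrow> f i \<in> carrier (JC Y X)"
  shows "\<phi> (finprod (JC Y X) f I) = (\<Sum>i\<in>I. \<phi> (f i))"
  using assms(2,3)
proof (induction I)
  case empty
  then show ?case by (simp add: additive_one[OF \<phi>])
next
  case (insert i I)
  then show ?case by (simp add: \<phi> finprod_insert Pi_iff)
qed

end

section \<open>Lifting identities between correspondences to their groups\<close>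

lemma grothendieck_map_JC_hom:
  assumes "corr_group Y X" "corr_group Z W" "f \<in> hom (JCor_monoid Y X) (JCor_monoid Z W)"
  shows "grothendieck_map (JCor_monoid Z W) f \<in> hom (JC Y X) (JC Z W)"
proof -
  interpret A: corr_group Y X by fact
  interpret B: corr_group Z W by fact
  show ?thesis unfolding JC_def by (rule A.J.grothendieck_map_hom[OF B.J.comm_monoid_axioms assms(3)])
qed

text \<open>Every compatibility of faces with chain maps and homotopies is a square of this kind, so
  it need only be checked on single correspondences, where it is an identity of functions.\<close>

lemma grothendieck_map_JC_eq:
  assumes "corr_group Y X" "corr_group Z W" "corr_group Z' W'" "corr_group Z'' W''"
    and f: "f \<in> hom (JCor_monoid Y X) (JCor_monoid Z W)" "f' \<in> hom (JCor_monoid Z W) (JCor_monoid Z'' W'')"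
    and g: "g \<in> hom (JCor_monoid Y X) (JCor_monoid Z' W')" "g' \<in> hom (JCor_monoid Z' W') (JCor_monoid Z'' W'')"
    and eq: "\<And>s. s \<in> JCor Y X \<Longrightarrow> f' (f s) = g' (g s)" and A: "A \<in> carrier (JC Y X)"
  shows "grothendieck_map (JCor_monoid Z'' W'') f' (grothendieck_map (JCor_monoid Z W) f A) =
    grothendieck_map (JCor_monoid Z'' W'') g' (grothendieck_map (JCor_monoid Z' W') g A)"
proof -
  interpret A: corr_group Y X by fact
  interpret B: corr_group Z W by fact
  interpret C: corr_group Z' W' by fact
  interpret D: corr_group Z'' W'' by fact
  obtain a b where ab: "a \<in> JCor Y X" "b \<in> JCor Y X" "A = A.J.gclass a b" by (rule A.JC_E[OF A])
  have "f a \<in> JCor Z W" "f b \<in> JCor Z W" "g a \<in> JCor Z' W'" "g b \<in> JCor Z' W'"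
    using f g ab by (auto simp: hom_def)
  then show ?thesis
    using ab f g eq
    by (simp add: A.J.grothendieck_map_gclass[OF B.J.comm_monoid_axioms]
        A.J.grothendieck_map_gclass[OF C.J.comm_monoid_axioms]
        B.J.grothendieck_map_gclass[OF D.J.comm_monoid_axioms] C.J.grothendieck_map_gclass[OF D.J.comm_monoid_axioms])
qed

lemma grothendieck_map_JC_inverse:
  assumes "corr_group Y X" "corr_group Z W"
    and f: "f \<in> hom (JCor_monoid Y X) (JCor_monoid Z W)" and g: "g \<in> hom (JCor_monoid Z W) (JCor_monoid Y X)"
    and eq: "\<And>s. s \<in> JCor Y X \<Longrightarrow> g (f s) = s" and A: "A \<in> carrier (JC Y X)"
  shows "grothendieck_map (JCor_monoid Y X) g (grothendieck_map (JCor_monoid Z W) f A) = A"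
proof -
  interpret A: corr_group Y X by fact
  interpret B: corr_group Z W by fact
  obtain a b where ab: "a \<in> JCor Y X" "b \<in> JCor Y X" "A = A.J.gclass a b" by (rule A.JC_E[OF A])
  have "f a \<in> JCor Z W" "f b \<in> JCor Z W" using f ab by (auto simp: hom_def)
  then show ?thesis
    using ab f g eq
    by (simp add: A.J.grothendieck_map_gclass[OF B.J.comm_monoid_axioms] B.J.grothendieck_map_gclass[OF A.J.comm_monoid_axioms])
qed

section \<open>Chain homotopy equivalences\<close>

text \<open>The image of a coset lies in one coset of \<open>B\<close> but need not fill it;
  multiplication by \<open>B\<close> does. This justifies the formula for the induced maps on
  homology.\<close>

lemma (in comm_group) set_mult_image_coset:
  assumes B: "subgroup B G" and C: "subgroup C K" "group K"
    and f: "f \<in> hom K G" and fC: "f ` C \<subseteq> B" and a: "a \<in> carrier K"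
  shows "B <#> f ` (C #>\<^bsub>K\<^esub> a) = B #> f a"
proof (intro subset_antisym subsetI)
  interpret B: subgroup B G by fact
  interpret C: subgroup C K by fact
  interpret K: group K by fact
  have fc: "f x \<in> carrier G" if "x \<in> carrier K" for x using f that by (auto simp: hom_def)
  {
    fix x assume "x \<in> B <#> f ` (C #>\<^bsub>K\<^esub> a)"
    then obtain b c where x: "b \<in> B" "c \<in> C" "x = b \<otimes> f (c \<otimes>\<^bsub>K\<^esub> a)"
      by (auto simp: set_mult_def r_coset_def)
    have "f (c \<otimes>\<^bsub>K\<^esub> a) = f c \<otimes> f a" using f x(2) a C.mem_carrier by (auto simp: hom_def)
    moreover have "f c \<in> B" using fC x(2) by blast
    ultimately have "x = (b \<otimes> f c) \<otimes> f a" "b \<otimes> f c \<in> B"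
      using x fc a B.mem_carrier by (auto simp: m_assoc)
    then show "x \<in> B #> f a" by (auto simp: r_coset_def)
  next
    fix x assume "x \<in> B #> f a"
    then obtain b where "b \<in> B" "x = b \<otimes> f a" by (auto simp: r_coset_def)
    moreover have "a \<in> C #>\<^bsub>K\<^esub> a" using a C.one_closed K.l_one by (force simp: r_coset_def)
    ultimately show "x \<in> B <#> f ` (C #>\<^bsub>K\<^esub> a)" by (auto simp: set_mult_def)
  }
qed

locale homology_at =
  fixes C1 :: "('a, 'p) monoid_scheme" and C :: "('b, 'q) monoid_scheme" and C' :: "('c, 'r) monoid_scheme"
    and d1 :: "'a \<Rightarrow> 'b" and d :: "'b \<Rightarrow> 'c"
  assumes C1: "group C1" and C: "comm_group C" and C': "group C'"
    and d1: "d1 \<in> hom C1 C" and d: "d \<in> hom C C'"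
begin

sublocale C: comm_group C by (rule C)

abbreviation "Z \<equiv> kernel C C' d"
abbreviation "B \<equiv> d1 ` carrier C1"
abbreviation "H \<equiv> C\<lparr>carrier := Z\<rparr> Mod B"

lemma subgroup_Z: "subgroup Z C"
  using C' d by (intro group_hom.subgroup_kernel) (simp add: group_hom_def group_hom_axioms_def C.is_group)

lemma subgroup_B: "subgroup B C"
  using C1 d1 by (intro group_hom.img_is_subgroup) (simp add: group_hom_def group_hom_axioms_def C.is_group)

lemma ZD: "a \<in> Z \<Longrightarrow> a \<in> carrier C"
  by (simp add: kernel_def)

lemma carrier_H: "carrier H = {B #>\<^bsub>C\<^esub> a | a. a \<in> Z}"
  by (auto simp: FactGroup_def RCOSETS_def r_coset_def)

lemma mult_H:
  assumes "a \<in> Z" "b \<in> Z"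
  shows "(B #>\<^bsub>C\<^esub> a) \<otimes>\<^bsub>H\<^esub> (B #>\<^bsub>C\<^esub> b) = B #>\<^bsub>C\<^esub> (a \<otimes>\<^bsub>C\<^esub> b)"
proof -
  have "(B #>\<^bsub>C\<^esub> a) \<otimes>\<^bsub>H\<^esub> (B #>\<^bsub>C\<^esub> b) = (B #>\<^bsub>C\<^esub> a) <#>\<^bsub>C\<^esub> (B #>\<^bsub>C\<^esub> b)"
    by (simp add: FactGroup_def set_mult_def)
  also have "\<dots> = B #>\<^bsub>C\<^esub> (a \<otimes>\<^bsub>C\<^esub> b)"
    using assms ZD by (intro normal.rcos_sum C.subgroup_imp_normal subgroup_B) auto
  finally show ?thesis .
qed

lemma coset_eq:
  assumes "a \<in> carrier C" "b \<in> B"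
  shows "B #>\<^bsub>C\<^esub> (b \<otimes>\<^bsub>C\<^esub> a) = B #>\<^bsub>C\<^esub> a"
proof -
  have "B #>\<^bsub>C\<^esub> (b \<otimes>\<^bsub>C\<^esub> a) = (B #>\<^bsub>C\<^esub> b) #>\<^bsub>C\<^esub> a"
    using assms subgroup.subset[OF subgroup_B] by (subst C.coset_mult_assoc) auto
  also have "B #>\<^bsub>C\<^esub> b = B" using assms(2) by (rule subgroup.rcos_const[OF subgroup_B C.is_group])
  finally show ?thesis .
qed

end

text \<open>On homology one composite is the identity because it is so on chains; the other one
  changes a cycle by a boundary and hence fixes its coset.\<close>

lemma chain_homotopy_equivalence_isomorphisms:
  assumes "homology_at C1 C C' dC1 dC" "homology_at D1 D D' dD1 dD"
    and f: "f1 \<in> hom C1 D1" "f \<in> hom C D" "f' \<in> hom C' D'"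
    and g: "g1 \<in> hom D1 C1" "g \<in> hom D C" "g' \<in> hom D' C'"
    and f_chain: "\<And>a. a \<in> carrier C1 \<Longrightarrow> dD1 (f1 a) = f (dC1 a)" "\<And>a. a \<in> carrier C \<Longrightarrow> dD (f a) = f' (dC a)"
    and g_chain: "\<And>a. a \<in> carrier D1 \<Longrightarrow> dC1 (g1 a) = g (dD1 a)" "\<And>a. a \<in> carrier D \<Longrightarrow> dC (g a) = g' (dD a)"
    and fg: "\<And>b. b \<in> carrier D \<Longrightarrow> f (g b) = b"
    and gf: "\<And>a. a \<in> carrier C \<Longrightarrow> dC a = \<one>\<^bsub>C'\<^esub> \<Longrightarrow> \<exists>e\<in>carrier C1. g (f a) = dC1 e \<otimes>\<^bsub>C\<^esub> a"
  shows "group_isomorphisms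
    (C\<lparr>carrier := kernel C C' dC\<rparr> Mod (dC1 ` carrier C1)) (D\<lparr>carrier := kernel D D' dD\<rparr> Mod (dD1 ` carrier D1))
    (\<lambda>A. (dD1 ` carrier D1) <#>\<^bsub>D\<^esub> (f ` A)) (\<lambda>A. (dC1 ` carrier C1) <#>\<^bsub>C\<^esub> (g ` A))"
proof -
  interpret C: homology_at C1 C C' dC1 dC by fact
  interpret D: homology_at D1 D D' dD1 dD by fact
  have f_cl: "D.B <#>\<^bsub>D\<^esub> (f ` (C.B #>\<^bsub>C\<^esub> a)) = D.B #>\<^bsub>D\<^esub> f a" if "a \<in> C.Z" for a
  proof (rule D.C.set_mult_image_coset[OF D.subgroup_B C.subgroup_B C.C.is_group f(2)])
    show "f ` C.B \<subseteq> D.B" using f(1) f_chain(1)[symmetric] by (auto simp: hom_def)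
  qed (rule C.ZD[OF that])
  have g_cl: "C.B <#>\<^bsub>C\<^esub> (g ` (D.B #>\<^bsub>D\<^esub> a)) = C.B #>\<^bsub>C\<^esub> g a" if "a \<in> D.Z" for a
  proof (rule C.C.set_mult_image_coset[OF C.subgroup_B D.subgroup_B D.C.is_group g(2)])
    show "g ` D.B \<subseteq> C.B" using g(1) g_chain(1)[symmetric] by (auto simp: hom_def)
  qed (rule D.ZD[OF that])
  have fZ: "f a \<in> D.Z" if "a \<in> C.Z" for a
    using that f(2) f_chain(2)[of a] hom_one[OF f(3) C.C' D.C'] by (auto simp: kernel_def hom_def)
  have gZ: "g a \<in> C.Z" if "a \<in> D.Z" for a
    using that g(2) g_chain(2)[of a] hom_one[OF g(3) D.C' C.C'] by (auto simp: kernel_def hom_def)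
  have Zm: "a \<otimes>\<^bsub>C\<^esub> b \<in> C.Z" if "a \<in> C.Z" "b \<in> C.Z" for a b
    using that by (rule subgroup.m_closed[OF C.subgroup_Z])
  have Zm': "a \<otimes>\<^bsub>D\<^esub> b \<in> D.Z" if "a \<in> D.Z" "b \<in> D.Z" for a b
    using that by (rule subgroup.m_closed[OF D.subgroup_Z])
  have fm: "f (a \<otimes>\<^bsub>C\<^esub> b) = f a \<otimes>\<^bsub>D\<^esub> f b" if "a \<in> C.Z" "b \<in> C.Z" for a b
    using f(2) that C.ZD by (auto simp: hom_def)
  have gm: "g (a \<otimes>\<^bsub>D\<^esub> b) = g a \<otimes>\<^bsub>C\<^esub> g b" if "a \<in> D.Z" "b \<in> D.Z" for a b
    using g(2) that D.ZD by (auto simp: hom_def)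
  show ?thesis
    unfolding group_isomorphisms_def
  proof (intro conjI ballI)
    show "(\<lambda>A. D.B <#>\<^bsub>D\<^esub> f ` A) \<in> hom C.H D.H"
    proof (rule homI)
      fix A assume "A \<in> carrier C.H"
      then obtain a where a: "a \<in> C.Z" "A = C.B #>\<^bsub>C\<^esub> a" unfolding C.carrier_H by blast
      show "D.B <#>\<^bsub>D\<^esub> f ` A \<in> carrier D.H"
        unfolding a(2) f_cl[OF a(1)] D.carrier_H using fZ[OF a(1)] by blast
      fix A' assume "A' \<in> carrier C.H"
      then obtain a' where a': "a' \<in> C.Z" "A' = C.B #>\<^bsub>C\<^esub> a'" unfolding C.carrier_H by blast
      show "D.B <#>\<^bsub>D\<^esub> f ` (A \<otimes>\<^bsub>C.H\<^esub> A') = (D.B <#>\<^bsub>D\<^esub> f ` A) \<otimes>\<^bsub>D.H\<^esub> (D.B <#>\<^bsub>D\<^esub> f ` A')"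
        by (simp only: a(2) a'(2) C.mult_H[OF a(1) a'(1)] f_cl[OF a(1)] f_cl[OF a'(1)] f_cl[OF Zm[OF a(1) a'(1)]]
            D.mult_H[OF fZ[OF a(1)] fZ[OF a'(1)]] fm[OF a(1) a'(1)])
    qed
    show "(\<lambda>A. C.B <#>\<^bsub>C\<^esub> g ` A) \<in> hom D.H C.H"
    proof (rule homI)
      fix A assume "A \<in> carrier D.H"
      then obtain a where a: "a \<in> D.Z" "A = D.B #>\<^bsub>D\<^esub> a" unfolding D.carrier_H by blast
      show "C.B <#>\<^bsub>C\<^esub> g ` A \<in> carrier C.H"
        unfolding a(2) g_cl[OF a(1)] C.carrier_H using gZ[OF a(1)] by blast
      fix A' assume "A' \<in> carrier D.H"
      then obtain a' where a': "a' \<in> D.Z" "A' = D.B #>\<^bsub>D\<^esub> a'" unfolding D.carrier_H by blast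
      show "C.B <#>\<^bsub>C\<^esub> g ` (A \<otimes>\<^bsub>D.H\<^esub> A') = (C.B <#>\<^bsub>C\<^esub> g ` A) \<otimes>\<^bsub>C.H\<^esub> (C.B <#>\<^bsub>C\<^esub> g ` A')"
        by (simp only: a(2) a'(2) D.mult_H[OF a(1) a'(1)] g_cl[OF a(1)] g_cl[OF a'(1)] g_cl[OF Zm'[OF a(1) a'(1)]]
            C.mult_H[OF gZ[OF a(1)] gZ[OF a'(1)]] gm[OF a(1) a'(1)])
    qed
  next
    fix A assume "A \<in> carrier C.H"
    then obtain a where a: "a \<in> C.Z" "A = C.B #>\<^bsub>C\<^esub> a" unfolding C.carrier_H by blast
    obtain e where e: "e \<in> carrier C1" "g (f a) = dC1 e \<otimes>\<^bsub>C\<^esub> a"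
      using gf[of a] a(1) by (auto simp: kernel_def)
    have "C.B #>\<^bsub>C\<^esub> g (f a) = C.B #>\<^bsub>C\<^esub> a"
      unfolding e(2) by (rule C.coset_eq[OF C.ZD[OF a(1)] imageI[OF e(1)]])
    then show "C.B <#>\<^bsub>C\<^esub> g ` (D.B <#>\<^bsub>D\<^esub> f ` A) = A"
      by (simp only: a(2) f_cl[OF a(1)] g_cl[OF fZ[OF a(1)]])
  next
    fix A assume "A \<in> carrier D.H"
    then obtain a where a: "a \<in> D.Z" "A = D.B #>\<^bsub>D\<^esub> a" unfolding D.carrier_H by blast
    show "D.B <#>\<^bsub>D\<^esub> f ` (C.B <#>\<^bsub>C\<^esub> g ` A) = A"
      by (simp only: a(2) g_cl[OF a(1)] f_cl[OF gZ[OF a(1)]] fg[OF D.ZD[OF a(1)]])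
  qed
qed

section \<open>The cubical complex\<close>

context
  fixes M :: "('m, 'k) manifold_data" and p0 p1 :: 'm
  assumes M: "ac_manifold M" and p: "p0 \<in> mspace_of M" "p1 \<in> mspace_of M"
begin

abbreviation "pt \<epsilon> \<equiv> (if \<epsilon> = (0 :: nat) then p0 else p1)"

lemma pt_in: "pt \<epsilon> \<in> mspace_of M" using p by simp

lemma ac_manifold_prod_power: "ac_manifold Y \<Longrightarrow> ac_manifold (Y \<times>\<^sub>m power_manifold M n)"
  by (rule ac_manifold_prod[OF _ ac_manifold_power[OF M]])

lemma corr_group_chain:
  assumes "ac_manifold Y" "ac_manifold X"
  shows "corr_group (Y \<times>\<^sub>m power_manifold M n) X"
  using assms by (simp add: corr_group_def ac_manifold_prod_power)

lemma pseudoholomorphic_face: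
  assumes Y: "ac_manifold Y" and q: "q \<in> mspace_of M" and i: "i \<le> n"
  shows "pseudoholomorphic (Y \<times>\<^sub>m power_manifold M n) (Y \<times>\<^sub>m power_manifold M (Suc n)) (map_prod id (insert_at i q))"
proof -
  have "pseudoholomorphic Y Y id" using pseudoholomorphic_id[OF Y] by (simp add: id_def)
  then show ?thesis
    using Y ac_manifold_power[OF M]
    by (intro pseudoholomorphic_map_prod pseudoholomorphic_insert_at[OF M q i]) (simp_all del: power_manifold.simps)
qed

lemma face_hom:
  assumes Y: "ac_manifold Y" and X: "ac_manifold X" and q: "q \<in> mspace_of M" and i: "i \<le> n"
  shows "(\<lambda>s. \<lambda>z\<in>mspace_of (Y \<times>\<^sub>m power_manifold M n). s (map_prod id (insert_at i q) z)) \<in>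
    hom (JCor_monoid (Y \<times>\<^sub>m power_manifold M (Suc n)) X) (JCor_monoid (Y \<times>\<^sub>m power_manifold M n) X)"
  unfolding pull_eq_corr_op
  by (rule corr_op_hom[OF ac_manifold_prod_power[OF Y] _ _ _ pseudoholomorphic_face[OF Y q i] pseudoholomorphic_snd])
     (use X Y ac_manifold_prod_power[OF Y] in \<open>simp_all del: power_manifold.simps prod_manifold_sel\<close>)

lemma JC_face_hom:
  assumes Y: "ac_manifold Y" and X: "ac_manifold X" and q: "q \<in> mspace_of M" and i: "i < n"
  shows "JC_face M Y X n i q \<in> hom (JC_chain M Y X n) (JC_chain M Y X (n - 1))"
proof -
  obtain m where n: "n = Suc m" "i \<le> m" using i by (cases n) auto
  show ?thesis
    unfolding JC_face_def JC_pull_def JC_chain_def n(1) diff_Suc_1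
    by (rule grothendieck_map_JC_hom[OF corr_group_chain[OF Y X] corr_group_chain[OF Y X] face_hom[OF Y X q n(2)]])
qed

text \<open>A face is a pullback, so counting after it is evaluation at the point with the extra
  coordinate inserted.\<close>

lemma JC_count_face:
  assumes Y: "ac_manifold Y" and X: "ac_manifold X" and q: "q \<in> mspace_of M" and i: "i < n"
    and A: "A \<in> carrier (JC_chain M Y X n)" and y: "y \<in> mspace_of Y" and ps: "ps \<in> mspace_of (power_manifold M (n - 1))"
  shows "JC_count (y, ps) x (JC_face M Y X n i q A) = JC_count (y, insert_at i q ps) x A"
proof -
  obtain m where n: "n = Suc m" "i \<le> m" using i by (cases n) auto
  interpret S: corr_group "Y \<times>\<^sub>m power_manifold M (Suc m)" X by (rule corr_group_chain[OF Y X])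
  interpret T: corr_group "Y \<times>\<^sub>m power_manifold M m" X by (rule corr_group_chain[OF Y X])
  obtain a b where ab: "a \<in> JCor (Y \<times>\<^sub>m power_manifold M (Suc m)) X" "b \<in> JCor (Y \<times>\<^sub>m power_manifold M (Suc m)) X"
      "A = S.J.gclass a b"
    using A unfolding n(1) JC_chain_def by (rule S.JC_E)
  let ?r = "\<lambda>s. \<lambda>z\<in>mspace_of (Y \<times>\<^sub>m power_manifold M m). s (map_prod id (insert_at i q) z)"
  note r = face_hom[OF Y X q n(2)]
  have z: "(y, ps) \<in> mspace_of (Y \<times>\<^sub>m power_manifold M m)" using y ps n(1) by simp
  have z': "(y, insert_at i q ps) \<in> mspace_of (Y \<times>\<^sub>m power_manifold M (Suc m))"
    using pseudoholomorphic_in_mspace[OF pseudoholomorphic_face[OF Y q n(2)] z] by (simp only: map_prod_simp id_apply)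
  have "JC_face M Y X n i q A = T.J.gclass (?r a) (?r b)"
    unfolding JC_face_def JC_pull_def n(1) diff_Suc_1 ab(3)
    by (rule S.J.grothendieck_map_gclass[OF T.J.comm_monoid_axioms r]) (use ab in simp_all)
  moreover have "?r a \<in> JCor (Y \<times>\<^sub>m power_manifold M m) X" "?r b \<in> JCor (Y \<times>\<^sub>m power_manifold M m) X"
    using hom_in_carrier[OF r] ab(1,2) by simp_all
  ultimately show ?thesis
    using ab JC_count_gclass[OF T.Y T.X z] JC_count_gclass[OF S.Y S.X z'] z by simp
qed

text \<open>Turns the product of integer powers into an alternating sum for every additive function,
  so that counts after a chain map or a homotopy can be expanded in the same way as plain
  counts.\<close>

lemma JC_boundary_additive:
  fixes \<phi> :: "_ \<Rightarrow> int"
  assumes Y: "ac_manifold Y" and X: "ac_manifold X" and A: "A \<in> carrier (JC_chain M Y X n)"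
    and \<phi>: "\<And>A B. A \<in> carrier (JC_chain M Y X (n - 1)) \<Longrightarrow> B \<in> carrier (JC_chain M Y X (n - 1)) \<Longrightarrow>
      \<phi> (A \<otimes>\<^bsub>JC_chain M Y X (n - 1)\<^esub> B) = \<phi> A + \<phi> B"
  shows "JC_boundary M p0 p1 Y X n A \<in> carrier (JC_chain M Y X (n - 1))"
    and "\<phi> (JC_boundary M p0 p1 Y X n A) =
      (\<Sum>(\<epsilon>, i)\<in>{0, 1} \<times> {..<n}. (- 1) ^ (\<epsilon> + i) * \<phi> (JC_face M Y X n i (pt \<epsilon>) A))"
proof -
  interpret S: corr_group "Y \<times>\<^sub>m power_manifold M (n - 1)" X by (rule corr_group_chain[OF Y X])
  have face: "JC_face M Y X n i (pt \<epsilon>) A \<in> carrier (JC (Y \<times>\<^sub>m power_manifold M (n - 1)) X)" if "i < n" for i \<epsilon>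
    using hom_in_carrier[OF JC_face_hom[OF Y X pt_in that] A] unfolding JC_chain_def .
  have summand: "(case k of (\<epsilon>, i) \<Rightarrow> JC_face M Y X n i (pt \<epsilon>) A
          [^]\<^bsub>JC (Y \<times>\<^sub>m power_manifold M (n - 1)) X\<^esub> ((- 1) ^ (\<epsilon> + i) :: int))
      \<in> carrier (JC (Y \<times>\<^sub>m power_manifold M (n - 1)) X)" if kI: "k \<in> {0, 1 :: nat} \<times> {..<n}" for k
  proof -
    obtain \<epsilon> i where k: "k = (\<epsilon>, i)" "i < n" using kI by auto
    show ?thesis unfolding k(1) prod.case by (rule S.int_pow_closed[OF face[OF k(2)]])
  qed
  show "JC_boundary M p0 p1 Y X n A \<in> carrier (JC_chain M Y X (n - 1))"
    unfolding JC_boundary_def JC_chain_def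
    by (rule S.finprod_closed) (rule Pi_I, rule summand)
  have "\<phi> (JC_boundary M p0 p1 Y X n A) =
      (\<Sum>k\<in>{0, 1} \<times> {..<n}. \<phi> (case k of (\<epsilon>, i) \<Rightarrow> JC_face M Y X n i (pt \<epsilon>) A
          [^]\<^bsub>JC (Y \<times>\<^sub>m power_manifold M (n - 1)) X\<^esub> ((- 1) ^ (\<epsilon> + i) :: int)))"
    unfolding JC_boundary_def JC_chain_def
    by (rule S.additive_finprod[OF \<phi>[unfolded JC_chain_def] _ summand]) simp_all
  also have "\<dots> = (\<Sum>(\<epsilon>, i)\<in>{0, 1} \<times> {..<n}. (- 1) ^ (\<epsilon> + i) * \<phi> (JC_face M Y X n i (pt \<epsilon>) A))"
  proof (rule sum.cong[OF refl])
    fix k assume "k \<in> {0, 1 :: nat} \<times> {..<n}"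
    then obtain \<epsilon> i where k: "k = (\<epsilon>, i)" "i < n" by auto
    show "\<phi> (case k of (\<epsilon>, i) \<Rightarrow> JC_face M Y X n i (pt \<epsilon>) A
          [^]\<^bsub>JC (Y \<times>\<^sub>m power_manifold M (n - 1)) X\<^esub> ((- 1) ^ (\<epsilon> + i) :: int)) =
        (case k of (\<epsilon>, i) \<Rightarrow> (- 1) ^ (\<epsilon> + i) * \<phi> (JC_face M Y X n i (pt \<epsilon>) A))"
      unfolding k(1) prod.case
      by (rule S.additive_int_pow[OF \<phi>[unfolded JC_chain_def] face[OF k(2)]])
  qed
  finally show "\<phi> (JC_boundary M p0 p1 Y X n A) =
      (\<Sum>(\<epsilon>, i)\<in>{0, 1} \<times> {..<n}. (- 1) ^ (\<epsilon> + i) * \<phi> (JC_face M Y X n i (pt \<epsilon>) A))" .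
qed

lemma chain_mult_count:
  assumes Y: "ac_manifold Y" and X: "ac_manifold X" and y: "y \<in> mspace_of Y" "ps \<in> mspace_of (power_manifold M n)"
    and "A \<in> carrier (JC_chain M Y X n)" "B \<in> carrier (JC_chain M Y X n)"
  shows "JC_count (y, ps) x (A \<otimes>\<^bsub>JC_chain M Y X n\<^esub> B) = JC_count (y, ps) x A + JC_count (y, ps) x B"
proof -
  interpret S: corr_group "Y \<times>\<^sub>m power_manifold M n" X by (rule corr_group_chain[OF Y X])
  show ?thesis unfolding JC_chain_def
    by (rule S.JC_count_mult) (use assms in \<open>simp_all add: JC_chain_def\<close>)
qed

lemma chain_eqI:
  assumes Y: "ac_manifold Y" and X: "ac_manifold X"
    and "A \<in> carrier (JC_chain M Y X n)" "B \<in> carrier (JC_chain M Y X n)"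
    and eq: "\<And>y ps x. y \<in> mspace_of Y \<Longrightarrow> ps \<in> mspace_of (power_manifold M n) \<Longrightarrow>
      JC_count (y, ps) x A = JC_count (y, ps) x B"
  shows "A = B"
proof -
  interpret S: corr_group "Y \<times>\<^sub>m power_manifold M n" X by (rule corr_group_chain[OF Y X])
  show ?thesis
  proof (rule S.JC_eqI)
    fix z x assume "z \<in> mspace_of (Y \<times>\<^sub>m power_manifold M n)"
    then show "JC_count z x A = JC_count z x B" using eq by (cases z) simp
  qed (use assms(3,4) in \<open>simp_all add: JC_chain_def\<close>)
qed

lemma comm_group_chain:
  assumes Y: "ac_manifold Y" and X: "ac_manifold X"
  shows "comm_group (JC_chain M Y X n)"
proof -
  interpret S: corr_group "Y \<times>\<^sub>m power_manifold M n" X by (rule corr_group_chain[OF Y X])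
  show ?thesis unfolding JC_chain_def by (rule S.comm_group_axioms)
qed

section \<open>The boundary operator and the homotopy formula\<close>

context
  fixes Y :: "('y, 'i) manifold_data" and X :: "('x, 'j) manifold_data"
  assumes Y: "ac_manifold Y" and X: "ac_manifold X"
begin

abbreviation "bd \<equiv> JC_boundary M p0 p1 Y X"
abbreviation "ch \<equiv> JC_chain M Y X"

lemma boundary_closed: "A \<in> carrier (ch n) \<Longrightarrow> bd n A \<in> carrier (ch (n - 1))"
  \<comment> \<open>Closure does not involve the additive function; the zero function fills its
    place.\<close>
  by (rule JC_boundary_additive(1)[OF Y X, where \<phi> = "\<lambda>_. 0"]) simp_all

lemma boundary_count:
  assumes "A \<in> carrier (ch n)" "y \<in> mspace_of Y" "ps \<in> mspace_of (power_manifold M (n - 1))"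
  shows "JC_count (y, ps) x (bd n A) =
    (\<Sum>(\<epsilon>, i)\<in>{0, 1} \<times> {..<n}. (- 1) ^ (\<epsilon> + i) * JC_count (y, ps) x (JC_face M Y X n i (pt \<epsilon>) A))"
  by (rule JC_boundary_additive(2)[OF Y X assms(1) chain_mult_count[OF Y X assms(2,3)]])

lemma boundary_count_insert:
  assumes "A \<in> carrier (ch n)" "y \<in> mspace_of Y" "ps \<in> mspace_of (power_manifold M (n - 1))"
  shows "JC_count (y, ps) x (bd n A) =
    (\<Sum>(\<epsilon>, i)\<in>{0, 1} \<times> {..<n}. (- 1) ^ (\<epsilon> + i) * JC_count (y, insert_at i (pt \<epsilon>) ps) x A)"
  unfolding boundary_count[OF assms]
  by (rule sum.cong[OF refl]) (auto simp: JC_count_face[OF Y X _ _ assms] p)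

lemma boundary_hom: "bd n \<in> hom (ch n) (ch (n - 1))"
proof (rule homI)
  fix A B assume A: "A \<in> carrier (ch n)" and B: "B \<in> carrier (ch n)"
  interpret S: comm_group "ch n" by (rule comm_group_chain[OF Y X])
  interpret T: comm_group "ch (n - 1)" by (rule comm_group_chain[OF Y X])
  show "bd n (A \<otimes>\<^bsub>ch n\<^esub> B) = bd n A \<otimes>\<^bsub>ch (n - 1)\<^esub> bd n B"
  proof (rule chain_eqI[OF Y X])
    fix y ps x assume y: "y \<in> mspace_of Y" and ps: "ps \<in> mspace_of (power_manifold M (n - 1))"
    have "JC_count (y, insert_at i (pt \<epsilon>) ps) x (A \<otimes>\<^bsub>ch n\<^esub> B) =
        JC_count (y, insert_at i (pt \<epsilon>) ps) x A + JC_count (y, insert_at i (pt \<epsilon>) ps) x B" if "i < n" for i \<epsilon>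
    proof -
      \<comment> \<open>An index \<open>i < n\<close> forces \<open>n\<close> to be positive, so
        \<open>Suc (n - 1)\<close> is \<open>n\<close>.\<close>
      have "insert_at i (pt \<epsilon>) ps \<in> mspace_of (power_manifold M (Suc (n - 1)))"
        by (rule pseudoholomorphic_in_mspace[OF pseudoholomorphic_insert_at[OF M pt_in] ps]) (use that in simp)
      then show ?thesis using that by (intro chain_mult_count[OF Y X y _ A B]) (simp del: power_manifold.simps)
    qed
    then have "JC_count (y, ps) x (bd n (A \<otimes>\<^bsub>ch n\<^esub> B)) = (\<Sum>(\<epsilon>, i)\<in>{0, 1} \<times> {..<n}.
        (- 1) ^ (\<epsilon> + i) * JC_count (y, insert_at i (pt \<epsilon>) ps) x A + (- 1) ^ (\<epsilon> + i) * JC_count (y, insert_at i (pt \<epsilon>) ps) x B)"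
      unfolding boundary_count_insert[OF S.m_closed[OF A B] y ps]
      by (intro sum.cong refl) (clarsimp simp: distrib_left simp del: One_nat_def)
    also have "\<dots> = JC_count (y, ps) x (bd n A) + JC_count (y, ps) x (bd n B)"
      unfolding boundary_count_insert[OF A y ps] boundary_count_insert[OF B y ps]
      by (simp add: sum.distrib split_beta)
    also have "\<dots> = JC_count (y, ps) x (bd n A \<otimes>\<^bsub>ch (n - 1)\<^esub> bd n B)"
      using chain_mult_count[OF Y X y ps boundary_closed[OF A] boundary_closed[OF B]] by simp
    finally show "JC_count (y, ps) x (bd n (A \<otimes>\<^bsub>ch n\<^esub> B)) = JC_count (y, ps) x (bd n A \<otimes>\<^bsub>ch (n - 1)\<^esub> bd n B)" .
  qed (intro boundary_closed S.m_closed A B, intro T.m_closed boundary_closed A B)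
qed (rule boundary_closed)

text \<open>In degree 0 the third group is again the chain group of degree 0, and the map to it is
  the empty product, so every chain is a cycle.\<close>

lemma homology_at_chain: "homology_at (ch (Suc n)) (ch n) (ch (n - 1)) (bd (Suc n)) (bd n)"
proof (rule homology_at.intro)
  show "bd (Suc n) \<in> hom (ch (Suc n)) (ch n)" using boundary_hom[of "Suc n"] by simp
qed (intro comm_group_chain[OF Y X] comm_group.axioms(2) boundary_hom)+

text \<open>The faces of \<open>H a\<close> with index at least 1 add up to \<open>- H (d a)\<close>, which vanishes on cycles.\<close>

lemma cubical_homotopy:
  fixes h :: "nat \<Rightarrow> _ \<Rightarrow> _"
  assumes h: "\<And>n. h n \<in> hom (ch n) (ch (Suc n))"
    and face0: "\<And>n a. a \<in> carrier (ch n) \<Longrightarrow> JC_face M Y X (Suc n) 0 p0 (h n a) = e n a"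
    and face1: "\<And>n a. a \<in> carrier (ch n) \<Longrightarrow> JC_face M Y X (Suc n) 0 p1 (h n a) = a"
    and face: "\<And>n a i q. a \<in> carrier (ch n) \<Longrightarrow> i < n \<Longrightarrow> q \<in> mspace_of M \<Longrightarrow>
      JC_face M Y X (Suc n) (Suc i) q (h n a) = h (n - 1) (JC_face M Y X n i q a)"
    and a: "a \<in> carrier (ch n)" "bd n a = \<one>\<^bsub>ch (n - 1)\<^esub>"
  shows "e n a = bd (Suc n) (h n a) \<otimes>\<^bsub>ch n\<^esub> a"
proof (rule chain_eqI[OF Y X])
  interpret T: comm_group "ch n" by (rule comm_group_chain[OF Y X])
  have ha: "h n a \<in> carrier (ch (Suc n))" using hom_in_carrier[OF h a(1)] .
  have bha: "bd (Suc n) (h n a) \<in> carrier (ch n)" using boundary_closed[OF ha] by simp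
  show "e n a \<in> carrier (ch n)"
    using hom_in_carrier[OF JC_face_hom[OF Y X p(1), of 0 "Suc n"] ha] face0[OF a(1)] by simp
  show "bd (Suc n) (h n a) \<otimes>\<^bsub>ch n\<^esub> a \<in> carrier (ch n)" by (rule T.m_closed[OF bha a(1)])
  fix y ps and x :: 'x assume y: "y \<in> mspace_of Y" and ps: "ps \<in> mspace_of (power_manifold M n)"
  let ?c = "JC_count (y, ps) x"
  \<comment> \<open>The signed contribution of one face of the homotopy, counted at the fixed
    point.\<close>
  define F where "F \<epsilon> i = (- 1) ^ (\<epsilon> + i) * ?c (JC_face M Y X (Suc n) i (pt \<epsilon>) (h n a))" for \<epsilon> i :: nat
  have "?c (bd (Suc n) (h n a)) = (\<Sum>(\<epsilon>, i)\<in>{0, 1} \<times> {..<Suc n}. F \<epsilon> i)"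
    unfolding F_def by (rule boundary_count[OF ha y]) (use ps in simp)
  also have "\<dots> = (\<Sum>\<epsilon>\<in>{0, 1}. \<Sum>i<Suc n. F \<epsilon> i)" by (rule sum.cartesian_product[symmetric])
  also have "\<dots> = (\<Sum>\<epsilon>\<in>{0, 1}. F \<epsilon> 0) + (\<Sum>\<epsilon>\<in>{0, 1}. \<Sum>i<n. F \<epsilon> (Suc i))"
    unfolding sum.lessThan_Suc_shift sum.distrib ..
  \<comment> \<open>The faces of index 0 carry sign +1 at \<open>p0\<close> and -1 at
    \<open>p1\<close>.\<close>
  also have "(\<Sum>\<epsilon>\<in>{0, 1}. F \<epsilon> 0) = ?c (e n a) - ?c a"
    by (simp add: F_def face0[OF a(1)] face1[OF a(1)])
  also have "(\<Sum>\<epsilon>\<in>{0, 1}. \<Sum>i<n. F \<epsilon> (Suc i)) = 0"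
  proof (cases n)
    case (Suc m)
    \<comment> \<open>Counting after the homotopy in degree one lower is additive, so it can be
      evaluated on the boundary of \<open>a\<close>, which is trivial. In degree 0 there are no
      faces left to sum.\<close>
    let ?\<phi> = "\<lambda>b. ?c (h m b)"
    have m: "n - 1 = m" using Suc by simp
    have \<phi>: "?\<phi> (A \<otimes>\<^bsub>ch m\<^esub> B) = ?\<phi> A + ?\<phi> B" if "A \<in> carrier (ch m)" "B \<in> carrier (ch m)" for A B
      unfolding hom_mult[OF h that]
      using chain_mult_count[OF Y X y, of ps "Suc m"] hom_in_carrier[OF h that(1)] hom_in_carrier[OF h that(2)] ps Suc
      by simp
    have "?\<phi> (bd n a) = (\<Sum>(\<epsilon>, i)\<in>{0, 1} \<times> {..<n}. (- 1) ^ (\<epsilon> + i) * ?\<phi> (JC_face M Y X n i (pt \<epsilon>) a))"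
      by (rule JC_boundary_additive(2)[OF Y X a(1)]) (simp only: m \<phi>)
    also have "\<dots> = (\<Sum>\<epsilon>\<in>{0, 1}. \<Sum>i<n. (- 1) ^ (\<epsilon> + i) * ?\<phi> (JC_face M Y X n i (pt \<epsilon>) a))"
      by (simp only: sum.cartesian_product)
    \<comment> \<open>Raising the face index by one changes its sign, whence the minus.\<close>
    also have "\<dots> = (\<Sum>\<epsilon>\<in>{0, 1}. \<Sum>i<n. - F \<epsilon> (Suc i))"
      unfolding F_def using face[OF a(1) _ pt_in] m by (intro sum.cong refl) (simp only: power_add power_Suc lessThan_iff)
    also have "\<dots> = - (\<Sum>\<epsilon>\<in>{0, 1}. \<Sum>i<n. F \<epsilon> (Suc i))" by (simp only: sum_negf)
    finally have "(\<Sum>\<epsilon>\<in>{0, 1}. \<Sum>i<n. F \<epsilon> (Suc i)) = - ?\<phi> \<one>\<^bsub>ch m\<^esub>" using a(2) m by simp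
    moreover have "?\<phi> \<one>\<^bsub>ch m\<^esub> = 0"
    proof -
      interpret U: comm_group "ch m" by (rule comm_group_chain[OF Y X])
      show ?thesis using \<phi>[OF U.one_closed U.one_closed] by simp
    qed
    ultimately show ?thesis by simp
  qed simp
  finally show "?c (e n a) = ?c (bd (Suc n) (h n a) \<otimes>\<^bsub>ch n\<^esub> a)"
    using chain_mult_count[OF Y X y ps bha a(1)] by simp
qed

end

text \<open>The boundary is a signed product of faces with the same signs on both sides. Expanding
  it under the additive function "count after \<open>f (n - 1)\<close>" lets faces be exchanged with
  \<open>f\<close> one at a time.\<close>

lemma chain_map_boundary:
  fixes X' :: "('w, 'l) manifold_data"
  assumes Y: "ac_manifold Y" and X: "ac_manifold X" and Y': "ac_manifold Y'" and X': "ac_manifold X'"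
    and f: "\<And>n. f n \<in> hom (JC_chain M Y X n) (JC_chain M Y' X' n)"
    and face: "\<And>n i q a. i < n \<Longrightarrow> q \<in> mspace_of M \<Longrightarrow> a \<in> carrier (JC_chain M Y X n) \<Longrightarrow>
      JC_face M Y' X' n i q (f n a) = f (n - 1) (JC_face M Y X n i q a)"
    and a: "a \<in> carrier (JC_chain M Y X n)"
  shows "JC_boundary M p0 p1 Y' X' n (f n a) = f (n - 1) (JC_boundary M p0 p1 Y X n a)"
proof (rule chain_eqI[OF Y' X'])
  have fa: "f n a \<in> carrier (JC_chain M Y' X' n)" by (rule hom_in_carrier[OF f a])
  show "JC_boundary M p0 p1 Y' X' n (f n a) \<in> carrier (JC_chain M Y' X' (n - 1))"
    by (rule boundary_closed[OF Y' X' fa])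
  show "f (n - 1) (JC_boundary M p0 p1 Y X n a) \<in> carrier (JC_chain M Y' X' (n - 1))"
    by (rule hom_in_carrier[OF f boundary_closed[OF Y X a]])
  fix y ps and x :: 'w assume y: "y \<in> mspace_of Y'" and ps: "ps \<in> mspace_of (power_manifold M (n - 1))"
  let ?c = "JC_count (y, ps) x"
  have "?c (f (n - 1) (JC_boundary M p0 p1 Y X n a)) =
      (\<Sum>(\<epsilon>, i)\<in>{0, 1} \<times> {..<n}. (- 1) ^ (\<epsilon> + i) * ?c (f (n - 1) (JC_face M Y X n i (pt \<epsilon>) a)))"
  proof (rule JC_boundary_additive(2)[OF Y X a])
    fix A B assume AB: "A \<in> carrier (JC_chain M Y X (n - 1))" "B \<in> carrier (JC_chain M Y X (n - 1))"
    show "?c (f (n - 1) (A \<otimes>\<^bsub>JC_chain M Y X (n - 1)\<^esub> B)) = ?c (f (n - 1) A) + ?c (f (n - 1) B)"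
      unfolding hom_mult[OF f AB]
      by (rule chain_mult_count[OF Y' X' y ps hom_in_carrier[OF f AB(1)] hom_in_carrier[OF f AB(2)]])
  qed
  also have "\<dots> = (\<Sum>(\<epsilon>, i)\<in>{0, 1} \<times> {..<n}. (- 1) ^ (\<epsilon> + i) * ?c (JC_face M Y' X' n i (pt \<epsilon>) (f n a)))"
    by (rule sum.cong[OF refl]) (auto simp: face[OF _ _ a] p)
  also have "\<dots> = ?c (JC_boundary M p0 p1 Y' X' n (f n a))"
    by (rule boundary_count[OF Y' X' fa y ps, symmetric])
  finally show "?c (JC_boundary M p0 p1 Y' X' n (f n a)) = ?c (f (n - 1) (JC_boundary M p0 p1 Y X n a))" by simp
qed

text \<open>Reduces both halves of the theorem to identities between single faces. The maps are
  given in all degrees, because degree \<open>n\<close> of homology involves those in degrees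
  \<open>n + 1\<close>, \<open>n\<close> and \<open>n - 1\<close>.\<close>

theorem JH_isomorphisms:
  assumes Y: "ac_manifold Y" and X: "ac_manifold X" and Y': "ac_manifold Y'" and X': "ac_manifold X'"
    and f: "\<And>n. f n \<in> hom (JC_chain M Y X n) (JC_chain M Y' X' n)"
    and f_face: "\<And>n i q a. i < n \<Longrightarrow> q \<in> mspace_of M \<Longrightarrow> a \<in> carrier (JC_chain M Y X n) \<Longrightarrow>
      JC_face M Y' X' n i q (f n a) = f (n - 1) (JC_face M Y X n i q a)"
    and g: "\<And>n. g n \<in> hom (JC_chain M Y' X' n) (JC_chain M Y X n)"
    and g_face: "\<And>n i q a. i < n \<Longrightarrow> q \<in> mspace_of M \<Longrightarrow> a \<in> carrier (JC_chain M Y' X' n) \<Longrightarrow>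
      JC_face M Y X n i q (g n a) = g (n - 1) (JC_face M Y' X' n i q a)"
    and fg: "\<And>n b. b \<in> carrier (JC_chain M Y' X' n) \<Longrightarrow> f n (g n b) = b"
    and h: "\<And>n. h n \<in> hom (JC_chain M Y X n) (JC_chain M Y X (Suc n))"
    and h_face0: "\<And>n a. a \<in> carrier (JC_chain M Y X n) \<Longrightarrow> JC_face M Y X (Suc n) 0 p0 (h n a) = g n (f n a)"
    and h_face1: "\<And>n a. a \<in> carrier (JC_chain M Y X n) \<Longrightarrow> JC_face M Y X (Suc n) 0 p1 (h n a) = a"
    and h_face: "\<And>n a i q. a \<in> carrier (JC_chain M Y X n) \<Longrightarrow> i < n \<Longrightarrow> q \<in> mspace_of M \<Longrightarrow>
      JC_face M Y X (Suc n) (Suc i) q (h n a) = h (n - 1) (JC_face M Y X n i q a)"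
  shows "group_isomorphisms (JH M p0 p1 Y X n) (JH M p0 p1 Y' X' n)
    (\<lambda>A. JC_boundaries M p0 p1 Y' X' n <#>\<^bsub>JC_chain M Y' X' n\<^esub> (f n ` A))
    (\<lambda>A. JC_boundaries M p0 p1 Y X n <#>\<^bsub>JC_chain M Y X n\<^esub> (g n ` A))"
  unfolding JH_def JC_cycles_def JC_boundaries_def
proof (rule chain_homotopy_equivalence_isomorphisms[OF homology_at_chain[OF Y X] homology_at_chain[OF Y' X'] f f f g g g])
  show "JC_boundary M p0 p1 Y' X' n (f n a) = f (n - 1) (JC_boundary M p0 p1 Y X n a)"
    if "a \<in> carrier (JC_chain M Y X n)" for a
    by (rule chain_map_boundary[OF Y X Y' X' f f_face that])
  show "JC_boundary M p0 p1 Y X n (g n a) = g (n - 1) (JC_boundary M p0 p1 Y' X' n a)"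
    if "a \<in> carrier (JC_chain M Y' X' n)" for a
    by (rule chain_map_boundary[OF Y' X' Y X g g_face that])
  show "JC_boundary M p0 p1 Y' X' (Suc n) (f (Suc n) a) = f n (JC_boundary M p0 p1 Y X (Suc n) a)"
    if "a \<in> carrier (JC_chain M Y X (Suc n))" for a
    using chain_map_boundary[OF Y X Y' X' f f_face that] by simp
  show "JC_boundary M p0 p1 Y X (Suc n) (g (Suc n) a) = g n (JC_boundary M p0 p1 Y' X' (Suc n) a)"
    if "a \<in> carrier (JC_chain M Y' X' (Suc n))" for a
    using chain_map_boundary[OF Y' X' Y X g g_face that] by simp
  show "f n (g n b) = b" if "b \<in> carrier (JC_chain M Y' X' n)" for b by (rule fg[OF that])
  fix a assume a: "a \<in> carrier (JC_chain M Y X n)" "JC_boundary M p0 p1 Y X n a = \<one>\<^bsub>JC_chain M Y X (n - 1)\<^esub>"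
  show "\<exists>e\<in>carrier (JC_chain M Y X (Suc n)). g n (f n a) = JC_boundary M p0 p1 Y X (Suc n) e \<otimes>\<^bsub>JC_chain M Y X n\<^esub> a"
    using cubical_homotopy[OF Y X h h_face0 h_face1 h_face a] hom_in_carrier[OF h a(1)] by blast
qed

end

section \<open>The homotopies\<close>

lemma pull_hom:
  assumes "ac_manifold Z" "ac_manifold Y" "ac_manifold X" "pseudoholomorphic Z Y h"
  shows "(\<lambda>s. \<lambda>z\<in>mspace_of Z. s (h z)) \<in> hom (JCor_monoid Y X) (JCor_monoid Z X)"
  unfolding pull_eq_corr_op
  by (rule corr_op_hom[OF _ _ _ _ _ pseudoholomorphic_snd]) (use assms in simp_all)

lemma push_hom:
  assumes Y: "ac_manifold Y" and X: "ac_manifold X" and W: "ac_manifold W" and g: "pseudoholomorphic X W g"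
  shows "(\<lambda>s. \<lambda>y\<in>mspace_of Y. image_mset g (s y)) \<in> hom (JCor_monoid Y X) (JCor_monoid Y W)"
proof -
  have o: "open_atlas Y" "open_atlas X" "open_atlas W" using assms by simp_all
  show ?thesis
    unfolding push_eq_corr_op
    by (rule corr_op_hom[OF Y o pseudoholomorphic_id[OF Y]
          pseudoholomorphic_compose[OF open_atlas_prod[OF o(1,2)] o(2,3) pseudoholomorphic_snd[OF o(1) X] g]])
qed

lemma pseudoholomorphic_slice:
  assumes "ac_manifold Y" "open_atlas M" "q \<in> mspace_of M"
  shows "pseudoholomorphic Y (Y \<times>\<^sub>m M) (\<lambda>y. (y, q))"
  by (rule pseudoholomorphic_pair[OF pseudoholomorphic_id[OF assms(1)] pseudoholomorphic_const[OF assms(2,3)]])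

lemma insert_at_0: "insert_at 0 q ps = q # ps"
  by (simp add: insert_at_def)

lemma insert_at_Suc_Cons: "insert_at (Suc i) q (r # ps) = r # insert_at i q ps"
  by (simp add: insert_at_def)

section \<open>The two contractions defined by \<gamma>\<close>

context
  fixes X :: "('x, 'i) manifold_data" and Y :: "('y, 'j) manifold_data" and M :: "('m, 'k) manifold_data"
    and p0 p1 :: 'm and \<gamma> :: "'m \<times> 'm \<Rightarrow> 'm"
  assumes X: "ac_manifold X" and Y: "ac_manifold Y" and M: "ac_manifold M"
    and p: "p0 \<in> mspace_of M" "p1 \<in> mspace_of M"
    and \<gamma>: "pseudoholomorphic (M \<times>\<^sub>m M) M \<gamma>"
    and \<gamma>0: "\<And>q. q \<in> mspace_of M \<Longrightarrow> \<gamma> (p0, q) = p0"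
    and \<gamma>1: "\<And>q. q \<in> mspace_of M \<Longrightarrow> \<gamma> (p1, q) = q"
begin

lemmas XM = ac_manifold_prod[OF X M] and YM = ac_manifold_prod[OF Y M]

lemmas atlases = X[THEN ac_manifold_imp_open_atlas] Y[THEN ac_manifold_imp_open_atlas] M[THEN ac_manifold_imp_open_atlas]
  XM[THEN ac_manifold_imp_open_atlas] YM[THEN ac_manifold_imp_open_atlas]

lemmas P = ac_manifold_power[OF M]

lemma insert_at_in_power:
  "q \<in> mspace_of M \<Longrightarrow> i \<le> n \<Longrightarrow> ps \<in> mspace_of (power_manifold M n) \<Longrightarrow>
    insert_at i q ps \<in> mspace_of (power_manifold M (Suc n))"
  by (rule pseudoholomorphic_in_mspace[OF pseudoholomorphic_insert_at[OF M]])

lemma power_SucE: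
  assumes "ps \<in> mspace_of (power_manifold M (Suc n))"
  obtains r qs where "ps = r # qs" "r \<in> mspace_of M" "qs \<in> mspace_of (power_manifold M n)"
  using assms unfolding mspace_power_Suc by blast

theorem JH_push_isomorphisms:
  "group_isomorphisms (JH M p0 p1 Y (X \<times>\<^sub>m M) n) (JH M p0 p1 Y X n)
      (JH_push M p0 p1 Y X n fst) (JH_push M p0 p1 Y (X \<times>\<^sub>m M) n (\<lambda>x. (x, p0)))"
proof -
  let ?YP = "\<lambda>n. Y \<times>\<^sub>m power_manifold M n"
  have YP: "ac_manifold (?YP n)" for n by (rule ac_manifold_prod[OF Y P])
  note oYP = YP[THEN ac_manifold_imp_open_atlas]
  have cg: "corr_group (?YP n) X" "corr_group (?YP n) (X \<times>\<^sub>m M)" for n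
    by (intro corr_group.intro YP atlases)+
  let ?pr = "\<lambda>n s. \<lambda>z\<in>mspace_of (?YP n). image_mset fst (s z)"
  let ?j = "\<lambda>n s. \<lambda>z\<in>mspace_of (?YP n). image_mset (\<lambda>x. (x, p0)) (s z)"
  \<comment> \<open>For base point (y, t # ts) and value (x, m) this is (x, \<gamma> (t, m)): the
    head of the list is the time parameter.\<close>
  let ?\<Phi> = "\<lambda>w. (fst (snd w), \<gamma> (hd (snd (fst w)), snd (snd w)))"
  \<comment> \<open>The correspondence itself is read at (y, ts), that is, after dropping the time
    parameter.\<close>
  let ?h = "\<lambda>n. corr_op (?YP (Suc n)) (map_prod id tl) ?\<Phi>"
  let ?face = "\<lambda>n i q s. \<lambda>z\<in>mspace_of (?YP n). s (map_prod id (insert_at i q) z)"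
  note face = face_hom[OF M p Y]
  have pr: "?pr n \<in> hom (JCor_monoid (?YP n) (X \<times>\<^sub>m M)) (JCor_monoid (?YP n) X)" for n
    by (rule push_hom[OF YP XM X pseudoholomorphic_fst[OF X atlases(3)]])
  have j: "?j n \<in> hom (JCor_monoid (?YP n) X) (JCor_monoid (?YP n) (X \<times>\<^sub>m M))" for n
    by (rule push_hom[OF YP X XM pseudoholomorphic_slice[OF X atlases(3) p(1)]])
  have h: "?h n \<in> hom (JCor_monoid (?YP n) (X \<times>\<^sub>m M)) (JCor_monoid (?YP (Suc n)) (X \<times>\<^sub>m M))" for n
  proof (rule corr_op_hom[OF YP oYP atlases(4,4)])
    note hd_tl = pseudoholomorphic_hd_tl[OF M] and oP = P[THEN ac_manifold_imp_open_atlas]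
    have "pseudoholomorphic Y Y id" using pseudoholomorphic_id[OF Y] by (simp add: id_def)
    then show "pseudoholomorphic (?YP (Suc n)) (?YP n) (map_prod id tl)"
      by (rule pseudoholomorphic_map_prod[OF Y P atlases(2) oP _ hd_tl(2)])
    let ?S = "?YP (Suc n) \<times>\<^sub>m (X \<times>\<^sub>m M)"
    have S: "open_atlas ?S" by (rule open_atlas_prod[OF oYP atlases(4)])
    note s = pseudoholomorphic_snd[OF oYP XM, of "Suc n"]
    note f = pseudoholomorphic_compose[OF S oYP oP pseudoholomorphic_fst[OF YP atlases(4)] pseudoholomorphic_snd[OF atlases(2) P]]
    show "pseudoholomorphic ?S (X \<times>\<^sub>m M) ?\<Phi>"
      by (rule pseudoholomorphic_pair[OF pseudoholomorphic_compose[OF S atlases(4,1) s pseudoholomorphic_fst[OF X atlases(3)]]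
          pseudoholomorphic_compose[OF S open_atlas_prod[OF atlases(3,3)] atlases(3) pseudoholomorphic_pair[OF
              pseudoholomorphic_compose[OF S oP atlases(3) f hd_tl(1)]
              pseudoholomorphic_compose[OF S atlases(4,3) s pseudoholomorphic_snd[OF atlases(1) M]]] \<gamma>]])
  qed
  \<comment> \<open>The identities for \<gamma> at \<open>p0\<close> and \<open>p1\<close> hold only
    on \<open>M\<close>, so the values of \<open>s\<close> must be known to lie in X x M.\<close>
  have val: "x \<in> mspace_of (X \<times>\<^sub>m M)"
    if "s \<in> JCor (?YP n) (X \<times>\<^sub>m M)" "y \<in> mspace_of Y" "ps \<in> mspace_of (power_manifold M n)" "x \<in># s (y, ps)"
    for s n y ps x
    by (rule JCor_values[OF that(1) _ that(4)]) (use that in simp)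
  show ?thesis
    unfolding JH_push_def[abs_def]
  proof (rule JH_isomorphisms[OF M p Y XM Y X, where f = "\<lambda>n. JC_push (?YP n) X fst"
        and g = "\<lambda>n. JC_push (?YP n) (X \<times>\<^sub>m M) (\<lambda>x. (x, p0))"
        and h = "\<lambda>n. grothendieck_map (JCor_monoid (?YP (Suc n)) (X \<times>\<^sub>m M)) (?h n)"])
    show "JC_push (?YP n) X fst \<in> hom (JC_chain M Y (X \<times>\<^sub>m M) n) (JC_chain M Y X n)" for n
      unfolding JC_push_def JC_chain_def by (rule grothendieck_map_JC_hom[OF cg(2,1) pr])
    show "JC_push (?YP n) (X \<times>\<^sub>m M) (\<lambda>x. (x, p0)) \<in> hom (JC_chain M Y X n) (JC_chain M Y (X \<times>\<^sub>m M) n)" for n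
      unfolding JC_push_def JC_chain_def by (rule grothendieck_map_JC_hom[OF cg(1,2) j])
    show "grothendieck_map (JCor_monoid (?YP (Suc n)) (X \<times>\<^sub>m M)) (?h n)
        \<in> hom (JC_chain M Y (X \<times>\<^sub>m M) n) (JC_chain M Y (X \<times>\<^sub>m M) (Suc n))" for n
      unfolding JC_chain_def by (rule grothendieck_map_JC_hom[OF cg(2,2) h])
    show "JC_face M Y X n i q (JC_push (?YP n) X fst a) =
        JC_push (?YP (n - 1)) X fst (JC_face M Y (X \<times>\<^sub>m M) n i q a)"
      if i: "i < n" and q: "q \<in> mspace_of M" and a: "a \<in> carrier (JC_chain M Y (X \<times>\<^sub>m M) n)" for n i q a
    proof -
      obtain m where n: "n = Suc m" "i \<le> m" using i by (cases n) auto
      show ?thesis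
        unfolding n(1) diff_Suc_1 JC_face_def JC_pull_def JC_push_def
        by (rule grothendieck_map_JC_eq[OF cg(2,1,2,1) pr face[OF X q n(2)] face[OF XM q n(2)] pr])
           (use a insert_at_in_power[OF q n(2)] n in \<open>auto simp: fun_eq_iff JC_chain_def simp del: power_manifold.simps\<close>)
    qed
    show "JC_face M Y (X \<times>\<^sub>m M) n i q (JC_push (?YP n) (X \<times>\<^sub>m M) (\<lambda>x. (x, p0)) a) =
        JC_push (?YP (n - 1)) (X \<times>\<^sub>m M) (\<lambda>x. (x, p0)) (JC_face M Y X n i q a)"
      if i: "i < n" and q: "q \<in> mspace_of M" and a: "a \<in> carrier (JC_chain M Y X n)" for n i q a
    proof -
      obtain m where n: "n = Suc m" "i \<le> m" using i by (cases n) auto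
      show ?thesis
        unfolding n(1) diff_Suc_1 JC_face_def JC_pull_def JC_push_def
        by (rule grothendieck_map_JC_eq[OF cg(1,2,1,2) j face[OF XM q n(2)] face[OF X q n(2)] j])
           (use a insert_at_in_power[OF q n(2)] n in \<open>auto simp: fun_eq_iff JC_chain_def simp del: power_manifold.simps\<close>)
    qed
    show "JC_push (?YP n) X fst (JC_push (?YP n) (X \<times>\<^sub>m M) (\<lambda>x. (x, p0)) b) = b"
      if b: "b \<in> carrier (JC_chain M Y X n)" for n b
      unfolding JC_push_def
    proof (rule grothendieck_map_JC_inverse[OF cg(1,2) j pr])
      show "?pr n (?j n s) = s" if "s \<in> JCor (?YP n) X" for s
        by (rule JCor_restrict_eq[OF that]) (simp add: multiset.map_comp o_def)
    qed (use b in \<open>simp add: JC_chain_def\<close>)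
    fix n a assume a: "a \<in> carrier (JC_chain M Y (X \<times>\<^sub>m M) n)"
    \<comment> \<open>Insertion at 0 makes \<open>q\<close> the time parameter; \<open>tl\<close>
      removes it again, so the face of index 0 is the correspondence moved by \<gamma> (q,
      .).\<close>
    have hz: "?h n s (map_prod id (insert_at 0 q) (y, ps)) = image_mset (\<lambda>x. (fst x, \<gamma> (q, snd x))) (s (y, ps))"
      if "q \<in> mspace_of M" "y \<in> mspace_of Y" "ps \<in> mspace_of (power_manifold M n)"
      for s :: "'y \<times> 'm list \<Rightarrow> ('x \<times> 'm) multiset" and q y ps
      using that insert_at_in_power[OF that(1) le0 that(3)]
      by (simp add: corr_op_def insert_at_0 del: power_manifold.simps)
    show "JC_face M Y (X \<times>\<^sub>m M) (Suc n) 0 p0 (grothendieck_map (JCor_monoid (?YP (Suc n)) (X \<times>\<^sub>m M)) (?h n) a) =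
        JC_push (?YP n) (X \<times>\<^sub>m M) (\<lambda>x. (x, p0)) (JC_push (?YP n) X fst a)"
      unfolding diff_Suc_1 JC_face_def JC_pull_def JC_push_def
    proof (rule grothendieck_map_JC_eq[OF cg(2,2,1,2) h face[OF XM p(1) le0] pr j])
      fix s assume s: "s \<in> JCor (?YP n) (X \<times>\<^sub>m M)"
      show "?face n 0 p0 (?h n s) = ?j n (?pr n s)"
      proof (rule restrict_ext)
        fix z assume z: "z \<in> mspace_of (?YP n)"
        then obtain y ps where y: "z = (y, ps)" "y \<in> mspace_of Y" "ps \<in> mspace_of (power_manifold M n)" by auto
        have "image_mset (\<lambda>x. (fst x, \<gamma> (p0, snd x))) (s (y, ps)) = image_mset (\<lambda>x. (fst x, p0)) (s (y, ps))"
          using val[OF s y(2,3)] by (intro image_mset_cong) (auto simp: \<gamma>0)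
        then show "?h n s (map_prod id (insert_at 0 p0) z) = image_mset (\<lambda>x. (x, p0)) (?pr n s z)"
          using z unfolding y(1) hz[OF p(1) y(2,3)] by (simp add: multiset.map_comp o_def)
      qed
    qed (use a in \<open>simp add: JC_chain_def\<close>)
    show "JC_face M Y (X \<times>\<^sub>m M) (Suc n) 0 p1 (grothendieck_map (JCor_monoid (?YP (Suc n)) (X \<times>\<^sub>m M)) (?h n) a) = a"
      unfolding diff_Suc_1 JC_face_def JC_pull_def
    proof (rule grothendieck_map_JC_inverse[OF cg(2,2) h face[OF XM p(2) le0]])
      fix s assume s: "s \<in> JCor (?YP n) (X \<times>\<^sub>m M)"
      show "?face n 0 p1 (?h n s) = s"
      proof (rule JCor_restrict_eq[OF s])
        fix z assume z: "z \<in> mspace_of (?YP n)"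
        then obtain y ps where y: "z = (y, ps)" "y \<in> mspace_of Y" "ps \<in> mspace_of (power_manifold M n)" by auto
        have "image_mset (\<lambda>x. (fst x, \<gamma> (p1, snd x))) (s (y, ps)) = image_mset (\<lambda>x. x) (s (y, ps))"
          using val[OF s y(2,3)] by (intro image_mset_cong) (auto simp: \<gamma>1)
        then show "?h n s (map_prod id (insert_at 0 p1) z) = s z"
          unfolding y(1) hz[OF p(2) y(2,3)] by simp
      qed
    qed (use a in \<open>simp add: JC_chain_def\<close>)
    fix i q assume i: "i < n" and q: "q \<in> mspace_of M"
    obtain m where n: "n = Suc m" "i \<le> m" by (rule less_natE[OF i]) simp
    then have n': "Suc i \<le> Suc m" by simp
    show "JC_face M Y (X \<times>\<^sub>m M) (Suc n) (Suc i) q (grothendieck_map (JCor_monoid (?YP (Suc n)) (X \<times>\<^sub>m M)) (?h n) a) =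
        grothendieck_map (JCor_monoid (?YP (Suc (n - 1))) (X \<times>\<^sub>m M)) (?h (n - 1)) (JC_face M Y (X \<times>\<^sub>m M) n i q a)"
      unfolding n(1) diff_Suc_1 JC_face_def JC_pull_def
    proof (rule grothendieck_map_JC_eq[OF cg(2,2,2,2) h face[OF XM q n'] face[OF XM q n(2)] h])
      fix s
      show "?face (Suc m) (Suc i) q (?h (Suc m) s) = ?h m (?face m i q s)"
        unfolding corr_op_def
      proof (rule restrict_ext)
        fix z assume "z \<in> mspace_of (?YP (Suc m))"
        then obtain y ps where z: "z = (y, ps)" "y \<in> mspace_of Y" "ps \<in> mspace_of (power_manifold M (Suc m))" by auto
        \<comment> \<open>Insertion at \<open>Suc i\<close> leaves the head \<open>r\<close>, the
          time parameter, untouched, so it commutes with both reading and dropping the head.\<close>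
        obtain r qs where r: "ps = r # qs" "qs \<in> mspace_of (power_manifold M m)" by (rule power_SucE[OF z(3)])
        show "(\<lambda>z\<in>mspace_of (?YP (Suc (Suc m))). image_mset (\<lambda>x. ?\<Phi> (z, x)) (s (map_prod id tl z)))
            (map_prod id (insert_at (Suc i) q) z) =
          image_mset (\<lambda>x. ?\<Phi> (z, x)) (?face m i q s (map_prod id tl z))"
          using z r insert_at_in_power[OF q n' z(3)] by (simp add: insert_at_Suc_Cons del: power_manifold.simps)
      qed
    qed (use a n in \<open>simp add: JC_chain_def del: power_manifold.simps\<close>)
  qed
qed

theorem JH_pull_isomorphisms:
  "group_isomorphisms (JH M p0 p1 Y X n) (JH M p0 p1 (Y \<times>\<^sub>m M) X n)
      (JH_pull M p0 p1 (Y \<times>\<^sub>m M) X n fst) (JH_pull M p0 p1 Y X n (\<lambda>y. (y, p0)))"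
\<comment> \<open>The direction is reversed because the composite that is the identity on chains is
  restriction to Y x p0 after pullback from Y. The homotopy therefore lives on the complex of Y x
  M.\<close>
proof (rule group_isomorphisms_sym)
  let ?YP = "\<lambda>n. Y \<times>\<^sub>m power_manifold M n" and ?YMP = "\<lambda>n. (Y \<times>\<^sub>m M) \<times>\<^sub>m power_manifold M n"
  have YP: "ac_manifold (?YP n)" and YMP: "ac_manifold (?YMP n)" for n
    by (intro ac_manifold_prod[OF _ P] Y YM)+
  note oP = P[THEN ac_manifold_imp_open_atlas] and oYMP = YMP[THEN ac_manifold_imp_open_atlas]
  have cg: "corr_group (?YP n) X" "corr_group (?YMP n) X" for n
    by (intro corr_group.intro YP YMP atlases)+
  let ?i = "\<lambda>n s. \<lambda>z\<in>mspace_of (?YP n). s (map_prod (\<lambda>y. (y, p0)) id z)"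
  let ?pr = "\<lambda>n s. \<lambda>z\<in>mspace_of (?YMP n). s (map_prod fst id z)"
  \<comment> \<open>Sends ((y, r), t # ts) to ((y, \<gamma> (t, r)), ts); here \<gamma> moves the
    source, so the homotopy is a pullback.\<close>
  let ?k = "\<lambda>z. ((fst (fst z), \<gamma> (hd (snd z), snd (fst z))), tl (snd z))"
  let ?h = "\<lambda>n s. \<lambda>z\<in>mspace_of (?YMP (Suc n)). s (?k z)"
  let ?face = "\<lambda>n i q s. \<lambda>z\<in>mspace_of (?YMP n). s (map_prod id (insert_at i q) z)"
  let ?faceY = "\<lambda>n i q s. \<lambda>z\<in>mspace_of (?YP n). s (map_prod id (insert_at i q) z)"
  note face = face_hom[OF M p YM X] and faceY = face_hom[OF M p Y X]
  have idP: "pseudoholomorphic (power_manifold M n) (power_manifold M n) id" for n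
    using pseudoholomorphic_id[OF P] by (simp add: id_def)
  have i: "?i n \<in> hom (JCor_monoid (?YMP n) X) (JCor_monoid (?YP n) X)" for n
    by (rule pull_hom[OF YP YMP X pseudoholomorphic_map_prod[OF Y P atlases(5) oP
        pseudoholomorphic_slice[OF Y atlases(3) p(1)] idP]])
  have pr: "?pr n \<in> hom (JCor_monoid (?YP n) X) (JCor_monoid (?YMP n) X)" for n
    by (rule pull_hom[OF YMP YP X pseudoholomorphic_map_prod[OF YM P atlases(2) oP
        pseudoholomorphic_fst[OF Y atlases(3)] idP]])
  have h: "?h n \<in> hom (JCor_monoid (?YMP n) X) (JCor_monoid (?YMP (Suc n)) X)" for n
  proof (rule pull_hom[OF YMP YMP X])
    note hd_tl = pseudoholomorphic_hd_tl[OF M, of n]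
    note S = oYMP[of "Suc n"]
    note f = pseudoholomorphic_fst[OF YM oP, of "Suc n"] and s = pseudoholomorphic_snd[OF atlases(5) P, of "Suc n"]
    show "pseudoholomorphic (?YMP (Suc n)) (?YMP n) ?k"
      by (rule pseudoholomorphic_pair[OF pseudoholomorphic_pair[OF
              pseudoholomorphic_compose[OF S atlases(5,2) f pseudoholomorphic_fst[OF Y atlases(3)]]
              pseudoholomorphic_compose[OF S open_atlas_prod[OF atlases(3,3)] atlases(3) pseudoholomorphic_pair[OF
                pseudoholomorphic_compose[OF S oP atlases(3) s hd_tl(1)]
                pseudoholomorphic_compose[OF S atlases(5,3) f pseudoholomorphic_snd[OF atlases(2) M]]] \<gamma>]]
            pseudoholomorphic_compose[OF S oP oP s hd_tl(2)]])
  qed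
  show "group_isomorphisms (JH M p0 p1 (Y \<times>\<^sub>m M) X n) (JH M p0 p1 Y X n)
      (JH_pull M p0 p1 Y X n (\<lambda>y. (y, p0))) (JH_pull M p0 p1 (Y \<times>\<^sub>m M) X n fst)"
    unfolding JH_pull_def[abs_def]
  proof (rule JH_isomorphisms[OF M p YM X Y X, where f = "\<lambda>n. JC_pull (?YP n) X (map_prod (\<lambda>y. (y, p0)) id)"
        and g = "\<lambda>n. JC_pull (?YMP n) X (map_prod fst id)"
        and h = "\<lambda>n. grothendieck_map (JCor_monoid (?YMP (Suc n)) X) (?h n)"])
    show "JC_pull (?YP n) X (map_prod (\<lambda>y. (y, p0)) id) \<in> hom (JC_chain M (Y \<times>\<^sub>m M) X n) (JC_chain M Y X n)" for n
      unfolding JC_pull_def JC_chain_def by (rule grothendieck_map_JC_hom[OF cg(2,1) i])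
    show "JC_pull (?YMP n) X (map_prod fst id) \<in> hom (JC_chain M Y X n) (JC_chain M (Y \<times>\<^sub>m M) X n)" for n
      unfolding JC_pull_def JC_chain_def by (rule grothendieck_map_JC_hom[OF cg(1,2) pr])
    show "grothendieck_map (JCor_monoid (?YMP (Suc n)) X) (?h n)
        \<in> hom (JC_chain M (Y \<times>\<^sub>m M) X n) (JC_chain M (Y \<times>\<^sub>m M) X (Suc n))" for n
      unfolding JC_chain_def by (rule grothendieck_map_JC_hom[OF cg(2,2) h])
    show "JC_face M Y X n l q (JC_pull (?YP n) X (map_prod (\<lambda>y. (y, p0)) id) a) =
        JC_pull (?YP (n - 1)) X (map_prod (\<lambda>y. (y, p0)) id) (JC_face M (Y \<times>\<^sub>m M) X n l q a)"
      if l: "l < n" and q: "q \<in> mspace_of M" and a: "a \<in> carrier (JC_chain M (Y \<times>\<^sub>m M) X n)" for n l q a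
    proof -
      obtain m where n: "n = Suc m" "l \<le> m" using l by (cases n) auto
      show ?thesis
        unfolding n(1) diff_Suc_1 JC_face_def JC_pull_def
        by (rule grothendieck_map_JC_eq[OF cg(2,1,2,1) i faceY[OF q n(2)] face[OF q n(2)] i])
           (use a p insert_at_in_power[OF q n(2)] n in \<open>auto simp: fun_eq_iff JC_chain_def simp del: power_manifold.simps\<close>)
    qed
    show "JC_face M (Y \<times>\<^sub>m M) X n l q (JC_pull (?YMP n) X (map_prod fst id) a) =
        JC_pull (?YMP (n - 1)) X (map_prod fst id) (JC_face M Y X n l q a)"
      if l: "l < n" and q: "q \<in> mspace_of M" and a: "a \<in> carrier (JC_chain M Y X n)" for n l q a
    proof -
      obtain m where n: "n = Suc m" "l \<le> m" using l by (cases n) auto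
      show ?thesis
        unfolding n(1) diff_Suc_1 JC_face_def JC_pull_def
        by (rule grothendieck_map_JC_eq[OF cg(1,2,1,2) pr face[OF q n(2)] faceY[OF q n(2)] pr])
           (use a insert_at_in_power[OF q n(2)] n in \<open>auto simp: fun_eq_iff JC_chain_def simp del: power_manifold.simps\<close>)
    qed
    show "JC_pull (?YP n) X (map_prod (\<lambda>y. (y, p0)) id) (JC_pull (?YMP n) X (map_prod fst id) b) = b"
      if b: "b \<in> carrier (JC_chain M Y X n)" for n b
      unfolding JC_pull_def
    proof (rule grothendieck_map_JC_inverse[OF cg(1,2) pr i])
      show "?i n (?pr n s) = s" if "s \<in> JCor (?YP n) X" for s
        by (rule JCor_restrict_eq[OF that]) (use p in auto)
    qed (use b in \<open>simp add: JC_chain_def\<close>)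
    fix n a assume a: "a \<in> carrier (JC_chain M (Y \<times>\<^sub>m M) X n)"
    have hz: "?h n s (map_prod id (insert_at 0 q) ((y, r), ps)) = s ((y, \<gamma> (q, r)), ps)"
      if "q \<in> mspace_of M" "y \<in> mspace_of Y" "r \<in> mspace_of M" "ps \<in> mspace_of (power_manifold M n)" for s q y r ps
      using that insert_at_in_power[OF that(1) le0 that(4)]
      by (simp add: insert_at_0 del: power_manifold.simps)
    show "JC_face M (Y \<times>\<^sub>m M) X (Suc n) 0 p0 (grothendieck_map (JCor_monoid (?YMP (Suc n)) X) (?h n) a) =
        JC_pull (?YMP n) X (map_prod fst id) (JC_pull (?YP n) X (map_prod (\<lambda>y. (y, p0)) id) a)"
      unfolding diff_Suc_1 JC_face_def JC_pull_def
    proof (rule grothendieck_map_JC_eq[OF cg(2,2,1,2) h face[OF p(1) le0] i pr])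
      fix s
      show "?face n 0 p0 (?h n s) = ?pr n (?i n s)"
      proof (rule restrict_ext)
        fix z assume z: "z \<in> mspace_of (?YMP n)"
        then obtain y r ps where y: "z = ((y, r), ps)" "y \<in> mspace_of Y" "r \<in> mspace_of M" "ps \<in> mspace_of (power_manifold M n)"
          by auto
        show "?h n s (map_prod id (insert_at 0 p0) z) = ?i n s (map_prod fst id z)"
          \<comment> \<open>Both sides evaluate \<open>s\<close> at ((y, p0), ps), since \<gamma>
            (p0, r) is p0.\<close>
          unfolding y(1) hz[OF p(1) y(2-4)] using y by (simp add: \<gamma>0)
      qed
    qed (use a in \<open>simp add: JC_chain_def\<close>)
    show "JC_face M (Y \<times>\<^sub>m M) X (Suc n) 0 p1 (grothendieck_map (JCor_monoid (?YMP (Suc n)) X) (?h n) a) = a"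
      unfolding diff_Suc_1 JC_face_def JC_pull_def
    proof (rule grothendieck_map_JC_inverse[OF cg(2,2) h face[OF p(2) le0]])
      fix s assume s: "s \<in> JCor (?YMP n) X"
      show "?face n 0 p1 (?h n s) = s"
      proof (rule JCor_restrict_eq[OF s])
        fix z assume z: "z \<in> mspace_of (?YMP n)"
        then obtain y r ps where y: "z = ((y, r), ps)" "y \<in> mspace_of Y" "r \<in> mspace_of M" "ps \<in> mspace_of (power_manifold M n)"
          by auto
        show "?h n s (map_prod id (insert_at 0 p1) z) = s z"
          unfolding y(1) hz[OF p(2) y(2-4)] using y by (simp add: \<gamma>1)
      qed
    qed (use a in \<open>simp add: JC_chain_def\<close>)
    fix l q assume l: "l < n" and q: "q \<in> mspace_of M"
    obtain m where n: "n = Suc m" "l \<le> m" by (rule less_natE[OF l]) simp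
    then have n': "Suc l \<le> Suc m" by simp
    show "JC_face M (Y \<times>\<^sub>m M) X (Suc n) (Suc l) q (grothendieck_map (JCor_monoid (?YMP (Suc n)) X) (?h n) a) =
        grothendieck_map (JCor_monoid (?YMP (Suc (n - 1))) X) (?h (n - 1)) (JC_face M (Y \<times>\<^sub>m M) X n l q a)"
      unfolding n(1) diff_Suc_1 JC_face_def JC_pull_def
    proof (rule grothendieck_map_JC_eq[OF cg(2,2,2,2) h face[OF q n'] face[OF q n(2)] h])
      fix s
      show "?face (Suc m) (Suc l) q (?h (Suc m) s) = ?h m (?face m l q s)"
      proof (rule restrict_ext)
        fix z assume "z \<in> mspace_of (?YMP (Suc m))"
        then obtain y r ps where z: "z = ((y, r), ps)" "y \<in> mspace_of Y" "r \<in> mspace_of M"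
            "ps \<in> mspace_of (power_manifold M (Suc m))" by auto
        obtain r' qs where r': "ps = r' # qs" "r' \<in> mspace_of M" "qs \<in> mspace_of (power_manifold M m)"
          by (rule power_SucE[OF z(4)])
        \<comment> \<open>The face of \<open>s\<close> is a restricted function, so its value at the
          moved point is meaningful only once that point is known to lie in the manifold.\<close>
        have "\<gamma> (r', r) \<in> mspace_of M" by (rule pseudoholomorphic_in_mspace[OF \<gamma>]) (use r' z in simp)
        then show "?h (Suc m) s (map_prod id (insert_at (Suc l) q) z) = ?face m l q s (?k z)"
          using z r' insert_at_in_power[OF q n' z(4)] by (simp add: insert_at_Suc_Cons del: power_manifold.simps)
      qed
    qed (use a n in \<open>simp add: JC_chain_def del: power_manifold.simps\<close>)
  qed
qed

end

theorem theorem11p3: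
  fixes X :: "('x, 'i) manifold_data"
    and Y :: "('y, 'j) manifold_data"
    and M :: "('m, 'k) manifold_data"
    and p0 p1 :: 'm
    and \<gamma> :: "'m \<times> 'm \<Rightarrow> 'm"
  assumes "compatible_symplectic_manifold X"
    and "compatible_symplectic_manifold Y"
    and "compatible_symplectic_manifold M"
    and "connected_space (mtop M)"
    and "p0 \<in> mspace_of M" and "p1 \<in> mspace_of M"
    and "pseudoholomorphic (M \<times>\<^sub>m M) M \<gamma>"
    and "\<And>q. q \<in> mspace_of M \<Longrightarrow> \<gamma> (p0, q) = p0"
    and "\<And>q. q \<in> mspace_of M \<Longrightarrow> \<gamma> (p1, q) = q"
  shows "(\<forall>n. group_isomorphisms
              (JH M p0 p1 Y (X \<times>\<^sub>m M) n) (JH M p0 p1 Y X n)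
              (JH_push M p0 p1 Y X n fst)
              (JH_push M p0 p1 Y (X \<times>\<^sub>m M) n (\<lambda>x. (x, p0)))) \<and>
         (\<forall>n. group_isomorphisms
              (JH M p0 p1 Y X n) (JH M p0 p1 (Y \<times>\<^sub>m M) X n)
              (JH_pull M p0 p1 (Y \<times>\<^sub>m M) X n fst)
              (JH_pull M p0 p1 Y X n (\<lambda>y. (y, p0))))"
  using JH_push_isomorphisms[OF assms(1-3)[THEN compatible_symplectic_manifold_imp_ac_manifold] assms(5-9)]
    JH_pull_isomorphisms[OF assms(1-3)[THEN compatible_symplectic_manifold_imp_ac_manifold] assms(5-9)]
  by blast

end
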